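(* Let $\pi$ be a unitary representation of a group $G$ in an infinite-dimensional Hilbert space $\mathcal H$. If every subrepresentation of $\pi$ having finite codimension is amenable (that is, $\pi$ is not of the form $\pi_1\oplus\pi_2$, where $\pi_1$ is finite-dimensional and $\pi_2$ is non-amenable), then the dynamical system $(\mathbb S_{\mathcal H},G,\pi)$ has the concentration property.
   Context: As usual for unitary representations, Hilbert spaces are complex. $G$ is an abstract group; no topology on $G$ and no continuity of $\pi$ is assumed. $\mathbb S_{\mathcal H}$ is the unit sphere of $\mathcal H$, with the uniform structure given by the norm distance, on which $G$ acts by the operators $\pi(g)$. Amenable representation (Bekka): a unitary representation $\pi$ of $G$ in $\mathcal H$ is amenable if there is a $G$-invariant state on the algebra $\mathcal L(\mathcal H)$ of all bounded operators, i.e. a linear functional $\phi\in\mathcal L(\mathcal H)^*$ with $\phi\ge 0$, $\phi(\mathbb I)=1$ and $\phi(\pi(g)T\pi(g)^{-1})=\phi(T)$ for all $T\in\mathcal L(\mathcal H)$, $g\in G$. Subrepresentations are restrictions of $\pi$ to closed $G$-invariant subspaces; one of finite codimension is one on a subspace of finite codimension (codimension $0$, i.e. $\pi$ itself, included; correspondingly $\pi_1$ may be zero). Concentration property: a set $A\subseteq\mathbb S_{\mathcal H}$ is essential if for every $\epsilon>0$ and every finite collection $g_1,\dots,g_n\in G$ one has $\bigcap_{i=1}^n\pi(g_i)\mathcal O_\epsilon(A)\ne\emptyset$, where $\mathcal O_\epsilon(A)$ is the $\epsilon$-neighbourhood of $A$ in $\mathbb S_{\mathcal H}$. The system $(\mathbb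 S_{\mathcal H},G,\pi)$ has the concentration property if every finite cover of $\mathbb S_{\mathcal H}$ by subsets contains an essential set. *)

theory Defs
  imports "HOL-Analysis.Analysis" "HOL-Algebra.Group"
begin

text \<open>
  A complex inner product space is presented as a real inner product space (which supplies the norm,
  the metric and the topology) together with a complex scalar multiplication extending the real one
  and a sesquilinear form, linear in its first argument, whose real part is the real inner product.
  Positive definiteness of the form is inherited from \<^class>\<open>real_inner\<close>: \<open>cinner x x\<close> is real by
  Hermitian symmetry, hence equal to \<open>x \<bullet> x\<close>.
\<close>

class complex_inner = real_inner +
  fixes scaleC :: "complex \<Rightarrow> 'a \<Rightarrow> 'a" (infixr "*\<^sub>C" 75)
    and cinner :: "'a \<Rightarrow> 'a \<Rightarrow> complex"
  assumes scaleC_add_right: "a *\<^sub>C (x + y) = a *\<^sub>C x + a *\<^sub>C y"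
    and scaleC_add_left: "(a + b) *\<^sub>C x = a *\<^sub>C x + b *\<^sub>C x"
    and scaleC_scaleC: "a *\<^sub>C (b *\<^sub>C x) = (a * b) *\<^sub>C x"
    and scaleC_of_real: "complex_of_real r *\<^sub>C x = r *\<^sub>R x"
    and cinner_commute: "cinner x y = cnj (cinner y x)"
    and cinner_add_left: "cinner (x + y) z = cinner x z + cinner y z"
    and cinner_scaleC_left: "cinner (a *\<^sub>C x) y = a * cinner x y"
    and Re_cinner: "Re (cinner x y) = x \<bullet> y"

class chilbert_space = complex_inner + complete_space

lemma vector_space_scaleC:
  "vector_space (scaleC :: complex \<Rightarrow> 'a \<Rightarrow> 'a::complex_inner)"
proof
  show "1 *\<^sub>C x = x" for x :: 'a
    using scaleC_of_real[of 1 x] by simp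
qed (simp_all add: scaleC_add_right scaleC_add_left scaleC_scaleC)

abbreviation csubspace :: "'a::complex_inner set \<Rightarrow> bool"
  where "csubspace \<equiv> module.subspace scaleC"

abbreviation cspan :: "'a::complex_inner set \<Rightarrow> 'a set"
  where "cspan \<equiv> module.span scaleC"

abbreviation clinear :: "('a::complex_inner \<Rightarrow> 'b::complex_inner) \<Rightarrow> bool"
  where "clinear \<equiv> Vector_Spaces.linear scaleC scaleC"

text \<open>The quotient by \<open>V\<close> is finite-dimensional iff it is spanned by the classes of a finite set \<open>B\<close>.\<close>

definition finite_codim :: "'a::complex_inner set \<Rightarrow> bool"
  where "finite_codim V \<longleftrightarrow> (\<exists>B. finite B \<and> cspan (V \<union> B) = UNIV)"

definition unitary_group :: "('a::complex_inner \<Rightarrow> 'a) monoid"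
  where "unitary_group =
    \<lparr>carrier = {U. clinear U \<and> surj U \<and> (\<forall>x y. cinner (U x) (U y) = cinner x y)},
     monoid.mult = (\<circ>), one = id\<rparr>"

definition unitary_rep :: "('g, 'm) monoid_scheme \<Rightarrow> ('g \<Rightarrow> 'a::chilbert_space \<Rightarrow> 'a) \<Rightarrow> bool"
  where "unitary_rep G \<pi> \<longleftrightarrow> group G \<and> \<pi> \<in> hom G unitary_group"

definition invariant_subspace ::
    "('g, 'm) monoid_scheme \<Rightarrow> ('g \<Rightarrow> 'a::chilbert_space \<Rightarrow> 'a) \<Rightarrow> 'a set \<Rightarrow> bool"
  where "invariant_subspace G \<pi> V \<longleftrightarrow>
    csubspace V \<and> closed V \<and> (\<forall>g\<in>carrier G. \<forall>x\<in>V. \<pi> g x \<in> V)"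

definition subrep :: "('g \<Rightarrow> 'a \<Rightarrow> 'a) \<Rightarrow> 'a set \<Rightarrow> 'g \<Rightarrow> 'a \<Rightarrow> 'a"
  where "subrep \<pi> V g = restrict (\<pi> g) V"

text \<open>
  An operator on a subspace \<open>V\<close> is a function that is \<^const>\<open>extensional\<close> on \<open>V\<close>, so that it is
  determined by its values on \<open>V\<close>.
\<close>

definition bounded_ops :: "'a::complex_inner set \<Rightarrow> ('a \<Rightarrow> 'a) set"
  where "bounded_ops V = {T \<in> V \<rightarrow>\<^sub>E V.
    (\<forall>x\<in>V. \<forall>y\<in>V. T (x + y) = T x + T y) \<and>
    (\<forall>c. \<forall>x\<in>V. T (c *\<^sub>C x) = c *\<^sub>C T x) \<and>
    (\<exists>K. \<forall>x\<in>V. norm (T x) \<le> K * norm x)}"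

definition op_norm :: "'a::complex_inner set \<Rightarrow> ('a \<Rightarrow> 'a) \<Rightarrow> real"
  where "op_norm V T = (SUP x\<in>{x\<in>V. norm x \<le> 1}. norm (T x))"

definition positive_op :: "'a::complex_inner set \<Rightarrow> ('a \<Rightarrow> 'a) \<Rightarrow> bool"
  where "positive_op V T \<longleftrightarrow> T \<in> bounded_ops V \<and> (\<forall>x\<in>V. cinner (T x) x \<in> \<real>\<^sub>\<ge>\<^sub>0)"

text \<open>Only the values of a functional \<open>\<phi>\<close> on \<^term>\<open>bounded_ops V\<close> are relevant.\<close>

definition bounded_functional ::
    "'a::complex_inner set \<Rightarrow> (('a \<Rightarrow> 'a) \<Rightarrow> complex) \<Rightarrow> bool"
  where "bounded_functional V \<phi> \<longleftrightarrow>
    (\<forall>S\<in>bounded_ops V. \<forall>T\<in>bounded_ops V. \<phi> (\<lambda>x\<in>V. S x + T x) = \<phi> S + \<phi> T) \<and>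
    (\<forall>c. \<forall>T\<in>bounded_ops V. \<phi> (\<lambda>x\<in>V. c *\<^sub>C T x) = c * \<phi> T) \<and>
    (\<exists>M. \<forall>T\<in>bounded_ops V. norm (\<phi> T) \<le> M * op_norm V T)"

definition state_on :: "'a::complex_inner set \<Rightarrow> (('a \<Rightarrow> 'a) \<Rightarrow> complex) \<Rightarrow> bool"
  where "state_on V \<phi> \<longleftrightarrow>
    bounded_functional V \<phi> \<and> (\<forall>T. positive_op V T \<longrightarrow> \<phi> T \<in> \<real>\<^sub>\<ge>\<^sub>0) \<and> \<phi> (\<lambda>x\<in>V. x) = 1"

text \<open>
  Bekka amenability of a unitary representation \<open>\<sigma>\<close> of \<open>G\<close> in the Hilbert space \<open>V\<close>, the operators
  \<open>\<sigma> g\<close> being given on \<open>V\<close> only.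
\<close>

definition amenable_rep ::
    "('g, 'm) monoid_scheme \<Rightarrow> 'a::chilbert_space set \<Rightarrow> ('g \<Rightarrow> 'a \<Rightarrow> 'a) \<Rightarrow> bool"
  where "amenable_rep G V \<sigma> \<longleftrightarrow>
    (\<exists>\<phi>. state_on V \<phi> \<and>
      (\<forall>g\<in>carrier G. \<forall>T\<in>bounded_ops V.
        \<phi> (compose V (\<sigma> g) (compose V T (\<sigma> (inv\<^bsub>G\<^esub> g)))) = \<phi> T))"

text \<open>\<open>X\<close> is a subset of a metric space on which \<open>G\<close> acts by \<open>\<tau>\<close>.\<close>

definition nbhd_in :: "'a::metric_space set \<Rightarrow> real \<Rightarrow> 'a set \<Rightarrow> 'a set"
  where "nbhd_in X \<epsilon> A = {x\<in>X. \<exists>a\<in>A. dist x a < \<epsilon>}"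

definition essential ::
    "('g, 'm) monoid_scheme \<Rightarrow> 'a::metric_space set \<Rightarrow> ('g \<Rightarrow> 'a \<Rightarrow> 'a) \<Rightarrow> 'a set \<Rightarrow> bool"
  where "essential G X \<tau> A \<longleftrightarrow>
    A \<subseteq> X \<and>
    (\<forall>\<epsilon>>0. \<forall>F. finite F \<and> F \<noteq> {} \<and> F \<subseteq> carrier G \<longrightarrow> (\<Inter>g\<in>F. \<tau> g ` nbhd_in X \<epsilon> A) \<noteq> {})"

definition concentration_property ::
    "('g, 'm) monoid_scheme \<Rightarrow> 'a::metric_space set \<Rightarrow> ('g \<Rightarrow> 'a \<Rightarrow> 'a) \<Rightarrow> bool"
  where "concentration_property G X \<tau> \<longleftrightarrow>
    (\<forall>\<C>. finite \<C> \<and> (\<forall>A\<in>\<C>. A \<subseteq> X) \<and> \<Union>\<C> = X \<longrightarrow> (\<exists>A\<in>\<C>. essential G X \<tau> A))"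

end

theory Submission
  imports Defs "HOL-Probability.Distributions" "HOL-Library.Function_Algebras"
begin

text \<open>
  Concentration of measure is used for Gaussian random vectors \<open>X = \<gamma>\<^sub>1 x\<^sub>1 + \<dots> + \<gamma>\<^sub>n x\<^sub>n\<close> of total
  variance one whose covariance operator has small norm: Lipschitz semiconcave functions of \<open>X\<close>,
  such as truncated squared distances, are nearly constant. Hence for every finite cover of the
  sphere some member has a cone with mean squared distance to \<open>X\<close> close to zero. If moreover the
  covariance operator of \<open>X\<close> is almost invariant in trace norm under finitely many group elements,
  then \<open>\<pi> g X\<close> is distributed almost as \<open>X\<close>, so all translates of a neighbourhood of that member
  meet.

  Almost invariant covariance operators come from amenability. If there are invariant
  finite-dimensional subspaces of arbitrarily large dimension, normalized projections onto them are
  exactly invariant. Otherwise split off a maximal one; an invariant state on its orthogonal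
  complement vanishes on finite-rank operators, because a nonzero normal part would have a
  finite-dimensional invariant eigenspace. If no almost invariant operator of small norm existed, a
  separation argument (Namioka's trick) would produce bounded operators \<open>B\<^sub>g\<close> for which
  \<open>\<Sum>\<^sub>g (\<pi> g\<inverse> B\<^sub>g \<pi> g - B\<^sub>g)\<close> is bounded below by a positive constant on a subspace of finite
  codimension, although the state vanishes on this sum.
\<close>

section \<open>Gaussian averages\<close>

text \<open>An invariant state may live on a finite-dimensional summand, where an operator of trace
  one cannot have small norm; this is why all subspaces of finite codimension enter. A state that
  vanishes on finite-rank operators, in turn, cannot see what happens on a subspace of finite
  dimension. Gaussian vectors replace uniform measures on finite-dimensional spheres because their
  law depends on the covariance operator alone: an almost invariant operator suffices, and no almost
  invariant subspace has to be extracted from it. The price is that X does not lie on the sphere, so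
  members of a cover are replaced by their cones. These members need not be measurable; they enter
  only through distance functions, which are Lipschitz. Semiconcavity of squared distances is a
  one-sided second-order bound that replaces differentiability. Covariance operators are represented
  throughout by finite lists of vectors and their quadratic forms. Most of the argument treats the
  space as a real Hilbert space; the complex structure returns late, as an isometry J with square
  -1.\<close>

definition gauss :: "real measure" where
  "gauss = density lborel std_normal_density"

lemma prob_space_gauss: "prob_space gauss"
  unfolding gauss_def by (rule prob_space_normal_density) simp

interpretation gauss: prob_space gauss
  by (rule prob_space_gauss)

lemma sets_gauss [simp, measurable_cong]: "sets gauss = sets borel"
  by (simp add: gauss_def)

lemma space_gauss [simp]: "space gauss = UNIV"
  by (simp add: gauss_def)

lemma integrable_gauss_power: "integrable gauss (\<lambda>t. t ^ k)"
  unfolding gauss_def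
  by (subst integrable_density) (auto intro: integrable_std_normal_moment)

lemma integrable_gauss_abs: "integrable gauss (\<lambda>t. \<bar>t\<bar>)"
  using integrable_abs[OF integrable_gauss_power[of 1]] by simp

lemma integral_gauss_power_even: "(\<integral>t. t ^ (2 * k) \<partial>gauss) = fact (2 * k) / (2 ^ k * fact k)"
  unfolding gauss_def
  by (subst integral_density) (auto simp: integral_std_normal_moment_even)

lemma integral_gauss_power_odd: "(\<integral>t. t ^ (2 * k + 1) \<partial>gauss) = 0"
  unfolding gauss_def
  using integral_std_normal_moment_odd[of k]
  by (subst integral_density) auto

lemma integral_gauss_poly4:
  fixes a0 a1 a2 a3 a4 :: real
  shows "integrable gauss (\<lambda>t. a0 + a1 * t + a2 * t^2 + a3 * t^3 + a4 * t^4)" (is ?A)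
    and "(\<integral>t. (a0 + a1 * t + a2 * t^2 + a3 * t^3 + a4 * t^4) \<partial>gauss) = a0 + a2 + 3 * a4" (is ?B)
proof -
  have i: "integrable gauss (\<lambda>t. a * t ^ k)" for a :: real and k
    using integrable_gauss_power by simp
  have i1: "integrable gauss (\<lambda>t. a * t)" for a :: real
    using i[of a 1] by simp
  show ?A
    by (intro Bochner_Integration.integrable_add i i1 gauss.integrable_const)
  have "(\<integral>t. t \<partial>gauss) = 0" "(\<integral>t. t^3 \<partial>gauss) = 0"
    using integral_gauss_power_odd[of 0] integral_gauss_power_odd[of 1] by simp_all
  moreover have "(\<integral>t. t^2 \<partial>gauss) = 1" "(\<integral>t. t^4 \<partial>gauss) = 3"
    using integral_gauss_power_even[of 1] integral_gauss_power_even[of 2]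
    by (simp_all add: fact_numeral)
  ultimately show ?B
    using i i1 integrable_gauss_power
    by (simp add: gauss.prob_space[unfolded space_gauss])
qed

lemma nn_integral_gauss:
  "f \<in> borel_measurable borel \<Longrightarrow>
    (\<integral>\<^sup>+t. f t \<partial>gauss) = (\<integral>\<^sup>+t. ennreal (std_normal_density t) * f t \<partial>lborel)"
  unfolding gauss_def by (subst nn_integral_density) auto

text \<open>A rotation with c \<noteq> 0 factors into two substitutions of one variable each, v = s
  t + c u at fixed t and then w = (t - s v) / c at fixed v, with Fubini in between; the Jacobians
  1/|c| and |c| cancel. For c = 0 it is a swap of coordinates up to sign.\<close>

lemma nn_integral_lborel_rotate:
  fixes G :: "real \<times> real \<Rightarrow> ennreal"
  assumes [measurable]: "G \<in> borel_measurable (borel \<Otimes>\<^sub>M borel)" and cs: "c\<^sup>2 + s\<^sup>2 = (1::real)"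
  shows "(\<integral>\<^sup>+t. \<integral>\<^sup>+u. G (c * t - s * u, s * t + c * u) \<partial>lborel \<partial>lborel)
       = (\<integral>\<^sup>+t. \<integral>\<^sup>+u. G (t, u) \<partial>lborel \<partial>lborel)"
proof (cases "c = 0")
  case True
  then have s: "s \<noteq> 0" "\<bar>s\<bar> = 1"
    using cs by (auto simp: power2_eq_1_iff)
  have "(\<integral>\<^sup>+t. \<integral>\<^sup>+u. G (c * t - s * u, s * t + c * u) \<partial>lborel \<partial>lborel)
      = (\<integral>\<^sup>+t. \<integral>\<^sup>+u. G (u, s * t) \<partial>lborel \<partial>lborel)"
  proof (rule nn_integral_cong)
    fix t
    show "(\<integral>\<^sup>+u. G (c * t - s * u, s * t + c * u) \<partial>lborel) = (\<integral>\<^sup>+u. G (u, s * t) \<partial>lborel)"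
      using True s by (subst nn_integral_real_affine[where c="-s" and t=0 and f="\<lambda>u. G (u, s * t)"]) auto
  qed
  also have "\<dots> = (\<integral>\<^sup>+t. \<integral>\<^sup>+u. G (u, t) \<partial>lborel \<partial>lborel)"
    using s by (subst nn_integral_real_affine[where c="s" and t=0 and f="\<lambda>t. \<integral>\<^sup>+u. G (u, t) \<partial>lborel"]) auto
  also have "\<dots> = (\<integral>\<^sup>+t. \<integral>\<^sup>+u. G (t, u) \<partial>lborel \<partial>lborel)"
    by (rule lborel_pair.Fubini') (auto simp: split_beta')
  finally show ?thesis .
next
  case c: False
  have e: "c * t - s * ((v - s * t) / c) = (t - s * v) / c" for t v
  proof -
    have "c * (c * t) = t - s * (s * t)"
      using cs by (metis (no_types) add_diff_cancel_right' mult.assoc mult_1 power2_eq_square ring_class.ring_distribs(2))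
    then show ?thesis
      using c by (simp add: field_simps)
  qed
  have "(\<integral>\<^sup>+t. \<integral>\<^sup>+u. G (c * t - s * u, s * t + c * u) \<partial>lborel \<partial>lborel)
      = (\<integral>\<^sup>+t. \<integral>\<^sup>+v. ennreal \<bar>1/c\<bar> * G ((t - s * v) / c, v) \<partial>lborel \<partial>lborel)"
  proof (rule nn_integral_cong)
    fix t
    show "(\<integral>\<^sup>+u. G (c * t - s * u, s * t + c * u) \<partial>lborel) = (\<integral>\<^sup>+v. ennreal \<bar>1/c\<bar> * G ((t - s * v) / c, v) \<partial>lborel)"
      using c e[of t]
      by (subst nn_integral_real_affine[where c="1/c" and t="- s * t / c"])
         (auto simp: nn_integral_cmult[symmetric] field_simps intro!: nn_integral_cong)
  qed
  also have "\<dots> = (\<integral>\<^sup>+v. \<integral>\<^sup>+t. ennreal \<bar>1/c\<bar> * G ((t - s * v) / c, v) \<partial>lborel \<partial>lborel)"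
    by (rule lborel_pair.Fubini') (auto simp: split_beta')
  also have "\<dots> = (\<integral>\<^sup>+v. \<integral>\<^sup>+w. G (w, v) \<partial>lborel \<partial>lborel)"
  proof (rule nn_integral_cong)
    fix v
    have "(\<integral>\<^sup>+t. ennreal \<bar>1/c\<bar> * G ((t - s * v) / c, v) \<partial>lborel)
       = ennreal \<bar>c\<bar> * (\<integral>\<^sup>+w. ennreal \<bar>1/c\<bar> * G (w, v) \<partial>lborel)"
      using c by (subst nn_integral_real_affine[where c="c" and t="s * v"]) auto
    also have "\<dots> = (\<integral>\<^sup>+w. G (w, v) \<partial>lborel)"
      using c by (subst nn_integral_cmult[symmetric]) (auto simp: mult.assoc[symmetric] ennreal_mult[symmetric])
    finally show "(\<integral>\<^sup>+t. ennreal \<bar>1/c\<bar> * G ((t - s * v) / c, v) \<partial>lborel) = (\<integral>\<^sup>+w. G (w, v) \<partial>lborel)" .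
  qed
  also have "\<dots> = (\<integral>\<^sup>+t. \<integral>\<^sup>+u. G (t, u) \<partial>lborel \<partial>lborel)"
    by (rule lborel_pair.Fubini') (auto simp: split_beta')
  finally show ?thesis .
qed

lemma std_normal_density_rotate:
  assumes "c\<^sup>2 + s\<^sup>2 = (1::real)"
  shows "std_normal_density (c * t - s * u) * std_normal_density (s * t + c * u)
    = std_normal_density t * std_normal_density u"
proof -
  have "(c * t - s * u)\<^sup>2 + (s * t + c * u)\<^sup>2 = (c\<^sup>2 + s\<^sup>2) * (t\<^sup>2 + u\<^sup>2)"
    by (simp add: power2_eq_square algebra_simps)
  then show ?thesis
    unfolding std_normal_density_def using assms
    by (simp add: exp_add[symmetric] add_divide_distrib[symmetric] minus_add_distrib[symmetric] del: minus_add_distrib)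
qed

interpretation gauss_pair: pair_prob_space gauss gauss ..

text \<open>The joint density depends only on t^2 + u^2, and Lebesgue measure on the plane is
  rotation invariant. Apart from moments, this is the property of \<open>gauss\<close> on which
  everything below rests.\<close>

lemma distr_gauss_rotate:
  assumes cs: "c\<^sup>2 + s\<^sup>2 = (1::real)"
  shows "distr (gauss \<Otimes>\<^sub>M gauss) (borel \<Otimes>\<^sub>M borel) (\<lambda>(t, u). (c * t - s * u, s * t + c * u)) = gauss \<Otimes>\<^sub>M gauss"
    (is "distr ?M ?B ?R = _")
proof (rule measure_eqI)
  show "sets (distr ?M ?B ?R) = sets ?M"
    by (simp cong: sets_pair_measure_cong)
  have R[measurable]: "?R \<in> measurable ?M ?B"
    by measurable
  fix A assume "A \<in> sets (distr ?M ?B ?R)"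
  then have [measurable]: "A \<in> sets (borel \<Otimes>\<^sub>M borel)" by simp
  have A': "A \<in> sets ?M"
    using \<open>A \<in> sets (distr ?M ?B ?R)\<close> \<open>sets (distr ?M ?B ?R) = sets ?M\<close> by simp
  let ?d = "\<lambda>t. ennreal (std_normal_density t)"
  have double: "(\<integral>\<^sup>+p. F p \<partial>?M) = (\<integral>\<^sup>+t. \<integral>\<^sup>+u. ?d t * ?d u * F (t, u) \<partial>lborel \<partial>lborel)"
    if [measurable]: "F \<in> borel_measurable (borel \<Otimes>\<^sub>M borel)" for F :: "real \<times> real \<Rightarrow> ennreal"
  proof -
    have "(\<integral>\<^sup>+p. F p \<partial>?M) = (\<integral>\<^sup>+t. \<integral>\<^sup>+u. F (t, u) \<partial>gauss \<partial>gauss)"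
      by (rule gauss.nn_integral_fst[symmetric]) measurable
    also have "\<dots> = (\<integral>\<^sup>+t. ?d t * (\<integral>\<^sup>+u. ?d u * F (t, u) \<partial>lborel) \<partial>lborel)"
      by (simp add: nn_integral_gauss)
    also have "\<dots> = (\<integral>\<^sup>+t. \<integral>\<^sup>+u. ?d t * ?d u * F (t, u) \<partial>lborel \<partial>lborel)"
      by (simp add: nn_integral_cmult[symmetric] mult.assoc)
    finally show ?thesis .
  qed
  have "emeasure (distr ?M ?B ?R) A = (\<integral>\<^sup>+p. indicator A (?R p) \<partial>?M)"
    by (simp add: nn_integral_indicator[symmetric] nn_integral_distr del: nn_integral_indicator)
  also have "\<dots> = (\<integral>\<^sup>+t. \<integral>\<^sup>+u. ?d t * ?d u * indicator A (c * t - s * u, s * t + c * u) \<partial>lborel \<partial>lborel)"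
    by (subst double) auto
  also have "\<dots> = (\<integral>\<^sup>+t. \<integral>\<^sup>+u. (\<lambda>(t, u). ?d t * ?d u * indicator A (t, u)) (c * t - s * u, s * t + c * u) \<partial>lborel \<partial>lborel)"
    by (simp add: ennreal_mult[symmetric] std_normal_density_rotate[OF cs])
  also have "\<dots> = (\<integral>\<^sup>+t. \<integral>\<^sup>+u. ?d t * ?d u * indicator A (t, u) \<partial>lborel \<partial>lborel)"
    by (subst nn_integral_lborel_rotate[OF _ cs]) auto
  also have "\<dots> = (\<integral>\<^sup>+p. indicator A p \<partial>?M)"
    by (subst double) auto
  also have "\<dots> = emeasure ?M A"
    by (simp add: A')
  finally show "emeasure (distr ?M ?B ?R) A = emeasure ?M A" .
qed

section \<open>Lipschitz functions and iterated Gaussian averages\<close>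

definition lip :: "('a::metric_space \<Rightarrow> real) \<Rightarrow> bool" where
  "lip f \<longleftrightarrow> (\<exists>L. L-lipschitz_on UNIV f)"

lemma lipI: "L-lipschitz_on UNIV f \<Longrightarrow> lip f"
  by (auto simp: lip_def)

lemma lipE:
  assumes "lip f" obtains L where "L \<ge> 0" "L-lipschitz_on UNIV f"
  using assms lipschitz_on_nonneg by (auto simp: lip_def)

lemma lip_const [simp]: "lip (\<lambda>x. c)"
  by (rule lipI[OF lipschitz_on_constant])

lemma lip_add: "lip f \<Longrightarrow> lip g \<Longrightarrow> lip (\<lambda>x. f x + g x)"
  by (auto simp: lip_def intro: lipschitz_on_add)

lemma lip_cmult: "lip f \<Longrightarrow> lip (\<lambda>x. c * f x)"
  by (auto simp: lip_def intro: lipschitz_on_cmult_real)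

lemma lip_diff: "lip f \<Longrightarrow> lip g \<Longrightarrow> lip (\<lambda>x. f x - g x)"
  by (auto simp: lip_def intro: lipschitz_on_diff)

lemma lip_sum: "(\<And>i. i \<in> I \<Longrightarrow> lip (f i)) \<Longrightarrow> lip (\<lambda>x. \<Sum>i\<in>I. f i x)"
  by (induction I rule: infinite_finite_induct) (auto intro: lip_add)

lemma lip_compose: "lip f \<Longrightarrow> L-lipschitz_on UNIV g \<Longrightarrow> lip (\<lambda>x. f (g x))"
  unfolding lip_def using lipschitz_on_compose2[of L UNIV g _ f] lipschitz_on_subset by blast

lemma lipschitz_on_abs: "L-lipschitz_on U f \<Longrightarrow> L-lipschitz_on U (\<lambda>x. \<bar>f x :: real\<bar>)"
  unfolding lipschitz_on_def dist_real_def by (meson abs_triangle_ineq3 order_trans)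

lemma lip_abs: "lip f \<Longrightarrow> lip (\<lambda>x. \<bar>f x\<bar>)"
  by (auto simp: lip_def intro: lipschitz_on_abs)

text \<open>Integrating out one normal variable at a time avoids product measures of varying
  dimension; the base point z carries the part of the random sum already drawn.\<close>

definition gstep :: "'a::real_normed_vector \<Rightarrow> ('a \<Rightarrow> real) \<Rightarrow> 'a \<Rightarrow> real" where
  "gstep x f z = (\<integral>t. f (z + t *\<^sub>R x) \<partial>gauss)"

text \<open>\<open>gexp [x\<^sub>1, \<dots>, x\<^sub>n] f z\<close> is the expectation of \<open>f (z + \<gamma>\<^sub>1 x\<^sub>1 + \<dots> + \<gamma>\<^sub>n x\<^sub>n)\<close> for independent
  standard normal variables \<open>\<gamma>\<^sub>i\<close>.\<close>

primrec gexp :: "'a::real_normed_vector list \<Rightarrow> ('a \<Rightarrow> real) \<Rightarrow> 'a \<Rightarrow> real" where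
  "gexp [] f = f"
| "gexp (x # xs) f = gstep x (gexp xs f)"

lemma gexp_append: "gexp (xs @ ys) f = gexp xs (gexp ys f)"
  by (induction xs) auto

text \<open>Linear growth and the finite first absolute moment of \<open>gauss\<close> suffice.
  Since averaging also preserves Lipschitz constants, Lipschitz functions form a class in which all
  averages exist and can be iterated.\<close>

lemma integrable_line:
  fixes f :: "'a::real_normed_vector \<Rightarrow> real"
  assumes "lip f" shows "integrable gauss (\<lambda>t. f (z + t *\<^sub>R x))"
proof -
  obtain L where L: "L \<ge> 0" "L-lipschitz_on UNIV f" by (rule lipE[OF assms])
  have "continuous_on UNIV f"
    by (rule lipschitz_on_continuous_on[OF L(2)])
  then have "continuous_on UNIV (\<lambda>t. f (z + t *\<^sub>R x))"
    by (rule continuous_on_compose2[of UNIV f UNIV "\<lambda>t. z + t *\<^sub>R x"])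
       (auto intro!: continuous_intros)
  from borel_measurable_continuous_onI[OF this]
  have m: "(\<lambda>t. f (z + t *\<^sub>R x)) \<in> borel_measurable gauss"
    by (simp cong: measurable_cong_sets)
  have b: "\<bar>f (z + t *\<^sub>R x)\<bar> \<le> \<bar>f z\<bar> + L * norm x * \<bar>t\<bar>" for t
    using lipschitz_onD[OF L(2), of "z + t *\<^sub>R x" z] by (simp add: dist_norm mult_ac)
  show ?thesis
    by (rule Bochner_Integration.integrable_bound[of _ "\<lambda>t. \<bar>f z\<bar> + L * norm x * \<bar>t\<bar>"])
       (use m b L integrable_gauss_abs in \<open>auto intro!: AE_I2\<close>)
qed

lemma lipschitz_gstep:
  assumes "L-lipschitz_on UNIV f" shows "L-lipschitz_on UNIV (gstep x f)"
proof (rule lipschitz_onI)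
  show "0 \<le> L" using assms by (rule lipschitz_on_nonneg)
  have i: "integrable gauss (\<lambda>t. f (z + t *\<^sub>R x))" for z
    by (rule integrable_line[OF lipI[OF assms]])
  fix z w
  have "\<bar>gstep x f z - gstep x f w\<bar> = \<bar>\<integral>t. f (z + t *\<^sub>R x) - f (w + t *\<^sub>R x) \<partial>gauss\<bar>"
    by (simp add: gstep_def i)
  also have "\<dots> \<le> (\<integral>t. \<bar>f (z + t *\<^sub>R x) - f (w + t *\<^sub>R x)\<bar> \<partial>gauss)"
    by (rule integral_abs_bound)
  also have "\<dots> \<le> (\<integral>t. L * dist z w \<partial>gauss)"
  proof (rule integral_mono)
    show "\<bar>f (z + t *\<^sub>R x) - f (w + t *\<^sub>R x)\<bar> \<le> L * dist z w" for t
      using lipschitz_onD[OF assms, of "z + t *\<^sub>R x" "w + t *\<^sub>R x"] by (simp add: dist_norm)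
  qed (use i in auto)
  also have "\<dots> = L * dist z w"
    using gauss.prob_space by simp
  finally show "dist (gstep x f z) (gstep x f w) \<le> L * dist z w"
    by (simp add: dist_real_def)
qed

lemma lipschitz_gexp: "L-lipschitz_on UNIV f \<Longrightarrow> L-lipschitz_on UNIV (gexp xs f)"
  by (induction xs) (auto intro: lipschitz_gstep)

lemma lip_gstep: "lip f \<Longrightarrow> lip (gstep x f)"
  by (auto simp: lip_def intro: lipschitz_gstep)

lemma lip_gexp: "lip f \<Longrightarrow> lip (gexp xs f)"
  by (auto simp: lip_def intro: lipschitz_gexp)

lemma gexp_add:
  "lip f \<Longrightarrow> lip g \<Longrightarrow> gexp xs (\<lambda>x. f x + g x) z = gexp xs f z + gexp xs g z"
proof (induction xs arbitrary: z)
  case (Cons x xs)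
  then have "gexp xs (\<lambda>x. f x + g x) = (\<lambda>z. gexp xs f z + gexp xs g z)" by auto
  with integrable_line[OF lip_gexp[OF Cons.prems(1)]] integrable_line[OF lip_gexp[OF Cons.prems(2)]]
  show ?case by (simp add: gstep_def)
qed simp

lemma gexp_cmult: "lip f \<Longrightarrow> gexp xs (\<lambda>x. c * f x) z = c * gexp xs f z"
proof (induction xs arbitrary: z)
  case (Cons x xs)
  then have "gexp xs (\<lambda>x. c * f x) = (\<lambda>z. c * gexp xs f z)" by auto
  with Cons show ?case by (simp add: gstep_def)
qed simp

lemma gexp_const: "gexp xs (\<lambda>x. c) z = c"
proof (induction xs arbitrary: z)
  case (Cons x xs)
  then have "gexp xs (\<lambda>x. c) = (\<lambda>z. c)" by auto
  then show ?case using gauss.prob_space by (simp add: gstep_def)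
qed simp

lemma gexp_diff:
  "lip f \<Longrightarrow> lip g \<Longrightarrow> gexp xs (\<lambda>x. f x - g x) z = gexp xs f z - gexp xs g z"
  using gexp_add[OF _ lip_cmult, of f g xs "-1" z] gexp_cmult[of g xs "-1" z] by simp

lemma gexp_sum:
  "(\<And>i. i \<in> I \<Longrightarrow> lip (f i)) \<Longrightarrow> gexp xs (\<lambda>x. \<Sum>i\<in>I. f i x) z = (\<Sum>i\<in>I. gexp xs (f i) z)"
  by (induction I rule: infinite_finite_induct) (auto simp: gexp_const gexp_add lip_sum)

lemma gexp_mono:
  "lip f \<Longrightarrow> lip g \<Longrightarrow> (\<And>x. f x \<le> g x) \<Longrightarrow> gexp xs f z \<le> gexp xs g z"
proof (induction xs arbitrary: z)
  case (Cons x xs)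
  show ?case
    unfolding gexp.simps gstep_def
    by (rule integral_mono[OF integrable_line[OF lip_gexp[OF Cons.prems(1)]]
        integrable_line[OF lip_gexp[OF Cons.prems(2)]] Cons.IH[OF Cons.prems]])
qed simp

lemma abs_gexp_le:
  assumes "lip f" shows "\<bar>gexp xs f z\<bar> \<le> gexp xs (\<lambda>x. \<bar>f x\<bar>) z"
proof -
  have "gexp xs f z \<le> gexp xs (\<lambda>x. \<bar>f x\<bar>) z"
    using assms by (intro gexp_mono lip_abs) auto
  moreover have "gexp xs (\<lambda>x. (-1) * f x) z \<le> gexp xs (\<lambda>x. \<bar>f x\<bar>) z"
    using assms by (intro gexp_mono lip_abs lip_cmult) auto
  ultimately show ?thesis
    using gexp_cmult[OF assms, of xs "-1" z] by simp
qed

lemma gexp_map: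
  assumes "linear A"
  shows "gexp (map A xs) f (A z) = gexp xs (\<lambda>x. f (A x)) z"
proof (induction xs arbitrary: z)
  case (Cons x xs)
  have "A z + t *\<^sub>R A x = A (z + t *\<^sub>R x)" for t
    using assms by (simp add: linear_add linear_cmul)
  with Cons show ?case by (simp add: gstep_def)
qed simp

lemma gexp_map_fst: "gexp (map (\<lambda>x. (x, 0)) xs) F (a, b) = gexp xs (\<lambda>x. F (x, b)) a"
  by (induction xs arbitrary: a) (auto simp: gstep_def)

lemma gexp_map_snd: "gexp (map (\<lambda>x. (0, x)) xs) F (a, b) = gexp xs (\<lambda>y. F (a, y)) b"
  by (induction xs arbitrary: b) (auto simp: gstep_def)

text \<open>The dominating polynomial is not Lipschitz, so \<open>gexp_mono\<close> does not apply.
  Instead the induction carries the exact mean of the polynomial: a step in direction x kills the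
  linear term and adds the quadratic part at x.\<close>

lemma gexp_le_quadratic:
  fixes f :: "'a::real_inner \<Rightarrow> real"
  assumes "lip f" and "\<And>z. f z \<le> a + b * (p \<bullet> z)\<^sup>2 + d * (norm z)\<^sup>2"
  shows "gexp xs f z \<le> a + b * (\<Sum>x\<leftarrow>xs. (p \<bullet> x)\<^sup>2) + d * (\<Sum>x\<leftarrow>xs. (norm x)\<^sup>2) + b * (p \<bullet> z)\<^sup>2 + d * (norm z)\<^sup>2"
proof (induction xs arbitrary: z)
  case (Cons x xs)
  let ?A = "a + b * (\<Sum>x\<leftarrow>xs. (p \<bullet> x)\<^sup>2) + d * (\<Sum>x\<leftarrow>xs. (norm x)\<^sup>2)"
  let ?q0 = "?A + b * (p \<bullet> z)\<^sup>2 + d * (z \<bullet> z)" and ?q1 = "2 * b * (p \<bullet> z) * (p \<bullet> x) + 2 * d * (z \<bullet> x)"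
    and ?q2 = "b * (p \<bullet> x)\<^sup>2 + d * (x \<bullet> x)"
  have e: "?A + b * (p \<bullet> (z + t *\<^sub>R x))\<^sup>2 + d * (norm (z + t *\<^sub>R x))\<^sup>2
      = ?q0 + ?q1 * t + ?q2 * t\<^sup>2 + 0 * t^3 + 0 * t^4" for t
    unfolding power2_norm_eq_inner
    by (simp add: inner_simps power2_eq_square inner_commute[of x z] algebra_simps)
  have "gexp (x # xs) f z \<le> (\<integral>t. ?A + b * (p \<bullet> (z + t *\<^sub>R x))\<^sup>2 + d * (norm (z + t *\<^sub>R x))\<^sup>2 \<partial>gauss)"
    unfolding gexp.simps gstep_def
  proof (rule integral_mono)
    show "integrable gauss (\<lambda>t. ?A + b * (p \<bullet> (z + t *\<^sub>R x))\<^sup>2 + d * (norm (z + t *\<^sub>R x))\<^sup>2)"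
      unfolding e by (rule integral_gauss_poly4)
  qed (rule integrable_line[OF lip_gexp[OF assms(1)]], rule Cons.IH)
  also have "\<dots> = ?q0 + ?q2"
    unfolding e by (subst integral_gauss_poly4) simp
  finally show ?case
    by (simp add: power2_norm_eq_inner algebra_simps)
qed (use assms in simp)

text \<open>The quartic polynomial bounds the fourth moment of \<open>norm (z + X)\<close>, the Gaussian vector \<open>X\<close>
  having variance \<open>\<tau>\<close>.\<close>

lemma gexp_ge_quartic:
  fixes f :: "'a::real_inner \<Rightarrow> real"
  assumes "lip f" and "\<And>z. f z \<ge> (norm z)\<^sup>2 - d * (norm z)^4" and "d \<ge> 0"
    and "\<tau> = (\<Sum>x\<leftarrow>xs. (norm x)\<^sup>2)"
  shows "gexp xs f z \<ge> (norm z)\<^sup>2 + \<tau> - d * ((norm z)^4 + 6 * \<tau> * (norm z)\<^sup>2 + 3 * \<tau>\<^sup>2)"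
  using assms(4)
proof (induction xs arbitrary: z \<tau>)
  case (Cons x xs)
  define s where "s = (\<Sum>x\<leftarrow>xs. (norm x)\<^sup>2)"
  let ?Z = "z \<bullet> z" and ?X = "x \<bullet> x" and ?Y = "z \<bullet> x"
  let ?q0 = "?Z + s - d * (?Z\<^sup>2 + 6 * s * ?Z + 3 * s\<^sup>2)"
    and ?q1 = "2 * ?Y - d * (4 * ?Y * ?Z + 12 * s * ?Y)"
    and ?q2 = "?X - d * (4 * ?Y\<^sup>2 + 2 * ?Z * ?X + 6 * s * ?X)"
    and ?q3 = "- d * (4 * ?Y * ?X)" and ?q4 = "- d * ?X\<^sup>2"
  have n4: "(norm v)^4 = (v \<bullet> v)\<^sup>2" for v :: 'a
    by (simp add: power2_norm_eq_inner[symmetric])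
  have nt: "(z + t *\<^sub>R x) \<bullet> (z + t *\<^sub>R x) = ?Z + 2 * t * ?Y + t\<^sup>2 * ?X" for t
    by (simp add: inner_simps power2_eq_square inner_commute algebra_simps)
  have e: "(norm (z + t *\<^sub>R x))\<^sup>2 + s - d * ((norm (z + t *\<^sub>R x))^4 + 6 * s * (norm (z + t *\<^sub>R x))\<^sup>2 + 3 * s\<^sup>2)
      = ?q0 + ?q1 * t + ?q2 * t\<^sup>2 + ?q3 * t^3 + ?q4 * t^4" for t
    unfolding n4 power2_norm_eq_inner nt by (simp add: algebra_simps power2_eq_square power3_eq_cube power4_eq_xxxx)
  \<comment> \<open>With Z, X, Y the inner products of z and x, Cauchy-Schwarz replaces 4 Y^2 + 2 Z
    X by 6 Z X, so that the bound depends on the list only through its variance.\<close>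
  have "(norm z)\<^sup>2 + \<tau> - d * ((norm z)^4 + 6 * \<tau> * (norm z)\<^sup>2 + 3 * \<tau>\<^sup>2) \<le> ?q0 + ?q2 + 3 * ?q4"
  proof -
    have "\<tau> = ?X + s" using Cons.prems by (simp add: s_def power2_norm_eq_inner)
    moreover have "d * ?Y\<^sup>2 \<le> d * (?Z * ?X)"
      using Cauchy_Schwarz_ineq[of z x] assms(3) by (intro mult_left_mono) auto
    ultimately show ?thesis
      unfolding n4 power2_norm_eq_inner by (simp add: algebra_simps power2_eq_square)
  qed
  also have "\<dots> = (\<integral>t. (norm (z + t *\<^sub>R x))\<^sup>2 + s - d * ((norm (z + t *\<^sub>R x))^4 + 6 * s * (norm (z + t *\<^sub>R x))\<^sup>2 + 3 * s\<^sup>2) \<partial>gauss)"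
    unfolding e by (subst integral_gauss_poly4) simp
  also have "\<dots> \<le> gexp (x # xs) f z"
    unfolding gexp.simps gstep_def
  proof (rule integral_mono)
    show "integrable gauss (\<lambda>t. (norm (z + t *\<^sub>R x))\<^sup>2 + s - d * ((norm (z + t *\<^sub>R x))^4 + 6 * s * (norm (z + t *\<^sub>R x))\<^sup>2 + 3 * s\<^sup>2))"
      unfolding e by (rule integral_gauss_poly4)
  qed (rule integrable_line[OF lip_gexp[OF assms(1)]], rule Cons.IH[OF s_def])
  finally show ?case .
qed (use assms in simp)

section \<open>Rotations, and dependence of the law on the covariance form alone\<close>

lemma gstep_rotate:
  fixes f :: "'a::real_normed_vector \<Rightarrow> real"
  assumes f: "lip f" and cs: "c\<^sup>2 + s\<^sup>2 = (1::real)"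
  shows "gstep (c *\<^sub>R x + s *\<^sub>R y) (gstep (c *\<^sub>R y - s *\<^sub>R x) f) z = gstep x (gstep y f) z"
proof -
  \<comment> \<open>Both steps together are one integral over the product measure; there the
    rotation of (t, u) can be moved from the measure onto the directions x and y.\<close>
  let ?F = "\<lambda>(t, u). f (z + t *\<^sub>R x + u *\<^sub>R y)" and ?R = "\<lambda>(t, u). (c * t - s * u, s * t + c * u)"
  have "continuous_on UNIV f"
    using f lipschitz_on_continuous_on by (auto simp: lip_def)
  then have "continuous_on UNIV ?F"
    unfolding split_beta'
    by (rule continuous_on_compose2[of UNIV f UNIV "\<lambda>p. z + fst p *\<^sub>R x + snd p *\<^sub>R y"])
       (auto intro!: continuous_intros)
  from borel_measurable_continuous_onI[OF this]
  have m: "?F \<in> borel_measurable (borel \<Otimes>\<^sub>M borel)"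
    by (simp add: borel_prod)
  then have m': "?F \<in> borel_measurable (gauss \<Otimes>\<^sub>M gauss)"
    by (simp cong: measurable_cong_sets sets_pair_measure_cong)
  have i: "integrable (gauss \<Otimes>\<^sub>M gauss) ?F"
  proof (rule gauss_pair.Fubini_integrable[OF m'])
    have "(\<integral>u. norm (?F (t, u)) \<partial>gauss) = gstep y (\<lambda>x. \<bar>f x\<bar>) (z + t *\<^sub>R x)" for t
      by (simp add: gstep_def)
    then show "integrable gauss (\<lambda>t. \<integral>u. norm (?F (t, u)) \<partial>gauss)"
      using integrable_line[OF lip_gstep[OF lip_abs[OF f], of y], of z x] by simp
    show "AE t in gauss. integrable gauss (\<lambda>u. ?F (t, u))"
      using integrable_line[OF f] by simp
  qed
  have R: "?R \<in> measurable (gauss \<Otimes>\<^sub>M gauss) (borel \<Otimes>\<^sub>M borel)"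
    by measurable
  have i': "integrable (gauss \<Otimes>\<^sub>M gauss) (\<lambda>p. ?F (?R p))"
    using integrable_distr[OF R, of ?F] i by (simp add: distr_gauss_rotate[OF cs])
  have "gstep x (gstep y f) z = (\<integral>p. ?F p \<partial>(gauss \<Otimes>\<^sub>M gauss))"
    using gauss_pair.integral_fst'[OF i] by (simp add: gstep_def)
  also have "\<dots> = (\<integral>p. ?F (?R p) \<partial>(gauss \<Otimes>\<^sub>M gauss))"
    using integral_distr[OF R m] by (simp add: distr_gauss_rotate[OF cs])
  also have "\<dots> = (\<integral>t. \<integral>u. ?F (?R (t, u)) \<partial>gauss \<partial>gauss)"
    using gauss_pair.integral_fst'[OF i'] by simp
  also have "\<dots> = gstep (c *\<^sub>R x + s *\<^sub>R y) (gstep (c *\<^sub>R y - s *\<^sub>R x) f) z"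
    unfolding gstep_def by (simp add: algebra_simps)
  finally show ?thesis by simp
qed

text \<open>The bilinear form of the covariance operator of the Gaussian vector attached to
  \<open>xs\<close>.\<close>

definition frame :: "'a::real_inner list \<Rightarrow> 'a \<Rightarrow> 'a \<Rightarrow> real" where
  "frame xs h k = (\<Sum>x\<leftarrow>xs. (h \<bullet> x) * (k \<bullet> x))"

lemma frame_simps [simp]:
  "frame [] h k = 0" "frame (x # xs) h k = (h \<bullet> x) * (k \<bullet> x) + frame xs h k"
  "frame (xs @ ys) h k = frame xs h k + frame ys h k"
  by (auto simp: frame_def)

text \<open>Plane rotations, one per entry, collect the whole component along e in the head of the
  list; averages and covariance form do not change. The sign condition on the head allows two such
  normal forms to be compared.\<close>

lemma gexp_reduce:
  fixes xs :: "'a::real_inner list" and e :: 'a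
  shows "\<exists>x rest. (\<forall>f. lip f \<longrightarrow> gexp (x # rest) f = gexp xs f) \<and> frame (x # rest) = frame xs \<and>
    (\<forall>r\<in>set rest. e \<bullet> r = 0) \<and> e \<bullet> x \<ge> 0 \<and> set (x # rest) \<subseteq> span (set xs)"
proof (induction xs)
  case Nil
  have "gstep 0 f = f" for f :: "'a \<Rightarrow> real"
    using gauss.prob_space by (auto simp: gstep_def)
  then show ?case
    by (intro exI[of _ 0] exI[of _ "[]"]) (auto simp: frame_def)
next
  case (Cons y xs)
  then obtain x rest where IH: "\<And>f. lip f \<Longrightarrow> gexp (x # rest) f = gexp xs f"
      "frame (x # rest) = frame xs" "\<forall>r\<in>set rest. e \<bullet> r = 0" "set (x # rest) \<subseteq> span (set xs)"
    by blast
  define a b where "a = e \<bullet> y" and "b = e \<bullet> x"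
  define r where "r = sqrt (a\<^sup>2 + b\<^sup>2)"
  \<comment> \<open>(c, s) is the unit vector in direction (a, b), so the second of the two rotated
    vectors becomes orthogonal to e.\<close>
  obtain c s where cs: "c\<^sup>2 + s\<^sup>2 = (1::real)" "c * a + s * b = r" "c * b - s * a = 0"
  proof (cases "r = 0")
    case True
    then have "a = 0" "b = 0" by (auto simp: r_def sum_power2_eq_zero_iff)
    with True show ?thesis by (intro that[of 1 0]) auto
  next
    case False
    have r2: "r\<^sup>2 = a\<^sup>2 + b\<^sup>2" by (simp add: r_def)
    show ?thesis
    proof (rule that[of "a / r" "b / r"])
      show "(a / r)\<^sup>2 + (b / r)\<^sup>2 = 1"
        using False by (simp add: power_divide add_divide_distrib[symmetric] r2[symmetric])
      have "a / r * a + b / r * b = r\<^sup>2 / r"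
        unfolding r2 by (simp add: add_divide_distrib power2_eq_square)
      then show "a / r * a + b / r * b = r"
        using False by (simp add: power2_eq_square)
    qed simp
  qed
  let ?x = "c *\<^sub>R y + s *\<^sub>R x" and ?y = "c *\<^sub>R x - s *\<^sub>R y"
  have rot: "(c * p + s * q) * (c * p' + s * q') + (c * q - s * p) * (c * q' - s * p') = p * p' + q * q'"
    for p q p' q' :: real
  proof -
    have "(c * p + s * q) * (c * p' + s * q') + (c * q - s * p) * (c * q' - s * p')
        = (c\<^sup>2 + s\<^sup>2) * (p * p' + q * q')"
      by (simp add: power2_eq_square algebra_simps)
    then show ?thesis using cs(1) by simp
  qed
  have "frame (?x # ?y # rest) = frame (y # xs)"
  proof (intro ext)
    fix h k
    have "(h \<bullet> ?x) * (k \<bullet> ?x) + (h \<bullet> ?y) * (k \<bullet> ?y) = (h \<bullet> y) * (k \<bullet> y) + (h \<bullet> x) * (k \<bullet> x)"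
      using rot by (simp add: inner_simps)
    with fun_cong[OF fun_cong[OF IH(2)], of h k]
    show "frame (?x # ?y # rest) h k = frame (y # xs) h k"
      by simp
  qed
  moreover have "gexp (?x # ?y # rest) f = gexp (y # xs) f" if "lip f" for f
    unfolding gexp.simps IH(1)[OF that, symmetric] by (rule ext) (rule gstep_rotate[OF lip_gexp[OF that] cs(1)])
  moreover have "\<forall>r\<in>set (?y # rest). e \<bullet> r = 0"
    using IH(3) cs(3) by (auto simp: inner_simps a_def b_def)
  moreover have "e \<bullet> ?x \<ge> 0"
    using cs(2) by (simp add: inner_simps a_def b_def r_def)
  moreover have "set (?x # ?y # rest) \<subseteq> span (set (y # xs))"
  proof -
    have "span (set xs) \<subseteq> span (set (y # xs))" by (rule span_mono) auto
    then have "set (x # rest) \<subseteq> span (set (y # xs))" "y \<in> span (set (y # xs))"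
      using IH(4) by (auto intro: span_base)
    then show ?thesis by (auto intro: span_add span_diff span_scale)
  qed
  ultimately show ?case by blast
qed

lemma gexp_zeros: "(\<forall>x\<in>set xs. x = 0) \<Longrightarrow> gexp xs f = f"
proof (induction xs)
  case (Cons x xs)
  then show ?case using gauss.prob_space by (auto simp: gstep_def)
qed simp

text \<open>Equality in law is obtained by bringing both families into a common shape through
  rotations, direction by direction. Characteristic functions are avoided.\<close>

lemma gexp_frame_cong:
  fixes xs ys :: "'a::real_inner list"
  assumes f: "lip f" and fr: "\<And>h. frame xs h h = frame ys h h"
  shows "gexp xs f z = gexp ys f z"
proof -
  \<comment> \<open>The induction runs over a list es that separates the points of S. Each step
    brings both families into the normal form for e and passes to the vectors of S orthogonal to
    e.\<close>
  have "gexp xs f = gexp ys f"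
    if "subspace S" "\<forall>v\<in>S. (\<forall>e\<in>set es. e \<bullet> v = 0) \<longrightarrow> v = 0" "set xs \<subseteq> S" "set ys \<subseteq> S"
      "frame xs = frame ys"
    for S es and xs ys :: "'a list"
    using that
  proof (induction es arbitrary: S xs ys)
    case Nil
    then have "\<forall>x\<in>set xs. x = 0" "\<forall>y\<in>set ys. y = 0" by auto
    then show ?case by (simp add: gexp_zeros)
  next
    case (Cons e es)
    obtain x xr where x: "gexp (x # xr) f = gexp xs f" "frame (x # xr) = frame xs"
        "\<forall>r\<in>set xr. e \<bullet> r = 0" "e \<bullet> x \<ge> 0" "set (x # xr) \<subseteq> span (set xs)"
      using gexp_reduce[of xs e] f by blast
    obtain y yr where y: "gexp (y # yr) f = gexp ys f" "frame (y # yr) = frame ys"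
        "\<forall>r\<in>set yr. e \<bullet> r = 0" "e \<bullet> y \<ge> 0" "set (y # yr) \<subseteq> span (set ys)"
      using gexp_reduce[of ys e] f by blast
    let ?S = "{v \<in> S. e \<bullet> v = 0}"
    have sub: "subspace ?S"
      using Cons.prems(1) by (auto simp: subspace_def inner_simps)
    have z: "\<forall>v\<in>?S. (\<forall>e\<in>set es. e \<bullet> v = 0) \<longrightarrow> v = 0"
      using Cons.prems(2) by simp
    have xS: "set (x # xr) \<subseteq> S" and yS: "set (y # yr) \<subseteq> S"
      using x(5) y(5) span_minimal[OF Cons.prems(3,1)] span_minimal[OF Cons.prems(4,1)] by auto
    have fr: "frame (x # xr) = frame (y # yr)"
      using Cons.prems(5) x(2) y(2) by simp
    have frr: "frame xr h e = 0" "frame yr h e = 0" for h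
      using x(3) y(3) by (auto simp: frame_def cong: map_cong)
    have he: "(h \<bullet> x) * (e \<bullet> x) = (h \<bullet> y) * (e \<bullet> y)" for h
      using fun_cong[OF fun_cong[OF fr], of h e] frr by simp
    \<comment> \<open>Both numbers are nonnegative square roots of the same value of the covariance
      form at (e, e).\<close>
    have eq: "e \<bullet> x = e \<bullet> y"
      using he[of e] x(4) y(4) by (simp add: power2_eq_square[symmetric])
    show ?case
    proof (cases "e \<bullet> x = 0")
      case True
      have "gexp (x # xr) f = gexp (y # yr) f"
        by (rule Cons.IH[OF sub z _ _ fr]) (use True eq x(3) y(3) xS yS in auto)
      then show ?thesis using x(1) y(1) by simp
    next
      case False
      \<comment> \<open>The head is determined by pairing the covariance form with e, so the two
        heads agree and can be cancelled.\<close>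
      then have "h \<bullet> (x - y) = 0" for h
        using he[of h] eq by (simp add: inner_simps)
      then have xy: "x = y" by (metis inner_eq_zero_iff right_minus_eq)
      have "frame xr = frame yr"
        using fr by (auto simp: fun_eq_iff xy)
      then have "gexp xr f = gexp yr f"
        by (intro Cons.IH[OF sub z]) (use x(3) y(3) xS yS in auto)
      then have "gexp (x # xr) f = gexp (y # yr) f"
        by (simp add: xy)
      then show ?thesis using x(1) y(1) by simp
    qed
  qed
  note * = this[where S="span (set xs \<union> set ys)" and es="xs @ ys" and xs=xs and ys=ys]
  have polar: "frame us h k = (frame us (h + k) (h + k) - frame us h h - frame us k k) / 2" for us :: "'a list" and h k
  proof (induction us)
    case (Cons u us)
    then show ?case
      unfolding frame_simps inner_add_left by (simp add: field_simps)
  qed simp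
  have "gexp xs f = gexp ys f"
  proof (rule *[OF subspace_span])
    show "\<forall>v\<in>span (set xs \<union> set ys). (\<forall>e\<in>set (xs @ ys). e \<bullet> v = 0) \<longrightarrow> v = 0"
    proof (intro ballI impI)
      fix v assume v: "v \<in> span (set xs \<union> set ys)" "\<forall>e\<in>set (xs @ ys). e \<bullet> v = 0"
      have "orthogonal v v"
        by (rule orthogonal_to_span[OF v(1)]) (use v(2) in \<open>auto simp: orthogonal_def inner_commute\<close>)
      then show "v = 0" by (simp add: orthogonal_def)
    qed
    show "frame xs = frame ys"
    proof (intro ext)
      show "frame xs h k = frame ys h k" for h k
        unfolding polar[of xs h k] polar[of ys h k] fr ..
    qed
  qed (auto intro: span_base)
  then show ?thesis by simp
qed

section \<open>Concentration for semiconcave functions\<close>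

lemma gexp_shift: "gexp xs f (w + z) = gexp xs (\<lambda>x. f (w + x)) z"
  by (induction xs arbitrary: z) (auto simp: gstep_def add.assoc)

lemma lip_bounded_linear: "lip f \<Longrightarrow> bounded_linear A \<Longrightarrow> lip (\<lambda>x. f (A x))"
  by (metis bounded_linear.lipschitz_boundE lip_compose)

text \<open>An independent summand Y moves the average of f by at most L times the mean of |Y|,
  which is at most the square root of the variance of Y.\<close>

lemma gexp_append_close:
  fixes f :: "'a::real_inner \<Rightarrow> real"
  assumes f: "L-lipschitz_on UNIV f" and r: "r > 0" and ys: "(\<Sum>y\<leftarrow>ys. (norm y)\<^sup>2) \<le> r\<^sup>2"
  shows "\<bar>gexp (xs @ ys) f z - gexp xs f z\<bar> \<le> L * r"
proof -
  have L: "L \<ge> 0" using f by (rule lipschitz_on_nonneg)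
  have lf: "lip f" using f by (rule lipI)
  have ls: "lip (\<lambda>y. f (w + y))" for w
  proof -
    have "1-lipschitz_on UNIV (\<lambda>y. w + y)" by (rule lipschitz_onI) auto
    then show ?thesis by (rule lip_compose[OF lf])
  qed
  have *: "\<bar>gexp ys f w - f w\<bar> \<le> L * r" for w
  proof -
    have "gexp ys f w - f w = gexp ys (\<lambda>y. f (w + y) - f w) 0"
      using gexp_shift[of ys f w 0] by (simp add: gexp_diff ls gexp_const)
    also have "\<bar>\<dots>\<bar> \<le> gexp ys (\<lambda>y. \<bar>f (w + y) - f w\<bar>) 0"
      by (intro abs_gexp_le lip_diff ls lip_const)
    also have "\<dots> \<le> L * r / 2 + 0 * (\<Sum>x\<leftarrow>ys. (0 \<bullet> x)\<^sup>2) + L / (2 * r) * (\<Sum>x\<leftarrow>ys. (norm x)\<^sup>2)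
        + 0 * (0 \<bullet> (0::'a))\<^sup>2 + L / (2 * r) * (norm (0::'a))\<^sup>2"
    proof (rule gexp_le_quadratic)
      fix y :: 'a
      have "\<bar>f (w + y) - f w\<bar> \<le> L * norm y"
        using lipschitz_onD[OF f, of "w + y" w] by (simp add: dist_norm)
      \<comment> \<open>Replaces Cauchy-Schwarz for expectations by a pointwise quadratic bound, as
        \<open>gexp_le_quadratic\<close> requires.\<close>
      also have "norm y \<le> r / 2 + (norm y)\<^sup>2 / (2 * r)"
        using r zero_le_power2[of "norm y - r"] by (simp add: field_simps power2_eq_square)
      finally show "\<bar>f (w + y) - f w\<bar> \<le> L * r / 2 + 0 * (0 \<bullet> y)\<^sup>2 + L / (2 * r) * (norm y)\<^sup>2"
        using L by (simp add: mult_left_mono ring_distribs)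
    qed (intro lip_abs lip_diff ls lip_const)
    also have "\<dots> \<le> L * r / 2 + L / (2 * r) * r\<^sup>2"
      using mult_left_mono[OF ys, of "L / (2 * r)"] L r by simp
    also have "\<dots> = L * r"
      using r by (simp add: power2_eq_square)
    finally show ?thesis .
  qed
  have "gexp (xs @ ys) f z - gexp xs f z = gexp xs (\<lambda>w. gexp ys f w - f w) z"
    by (simp add: gexp_append gexp_diff lf lip_gexp)
  also have "\<bar>\<dots>\<bar> \<le> gexp xs (\<lambda>w. \<bar>gexp ys f w - f w\<bar>) z"
    by (intro abs_gexp_le lip_diff lip_gexp lf)
  also have "\<dots> \<le> gexp xs (\<lambda>w. L * r) z"
    using * by (intro gexp_mono lip_abs lip_diff lip_gexp lf lip_const)
  finally show ?thesis by (simp add: gexp_const)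
qed

section \<open>Independent copies and the rotation argument\<close>

context
  fixes xs :: "'a::real_inner list"
begin

text \<open>The average over two independent copies (X, Y), written as a single \<open>gexp\<close>
  in the product space so that \<open>gexp_frame_cong\<close> applies to pairs.\<close>

definition gexp_pair :: "('a \<times> 'a \<Rightarrow> real) \<Rightarrow> real" where
  "gexp_pair F = gexp (map (\<lambda>x. (x, 0)) xs @ map (\<lambda>x. (0, x)) xs) F (0, 0)"

lemma gexp_pair_iterated: "gexp_pair F = gexp xs (\<lambda>x. gexp xs (\<lambda>y. F (x, y)) 0) 0"
  by (simp add: gexp_pair_def gexp_append gexp_map_fst gexp_map_snd)

lemma lip_inner: "lip F \<Longrightarrow> lip (\<lambda>y. F (x, y))" for F :: "'a \<times> 'a \<Rightarrow> real"
  by (rule lip_compose[where L=1]) (auto simp: lipschitz_on_def dist_Pair_Pair)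

lemma lip_outer: "lip F \<Longrightarrow> lip (\<lambda>x. gexp xs (\<lambda>y. F (x, y)) 0)" for F :: "'a \<times> 'a \<Rightarrow> real"
  unfolding gexp_map_snd[symmetric]
  by (rule lip_compose[where L=1]) (auto simp: lipschitz_on_def dist_Pair_Pair intro: lip_gexp)

text \<open>The covariance form of (X, Y) is the sum of two equal forms, one in each component, and
  such a sum is invariant under rotations mixing the components.\<close>

lemma gexp_pair_rotate:
  assumes "lip F" and cs: "c\<^sup>2 + s\<^sup>2 = (1::real)"
  shows "gexp_pair (\<lambda>w. F (c *\<^sub>R fst w + s *\<^sub>R snd w, c *\<^sub>R snd w - s *\<^sub>R fst w)) = gexp_pair F"
proof -
  let ?ws = "map (\<lambda>x. (x, 0)) xs @ map (\<lambda>x. (0, x)) xs"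
  let ?R = "\<lambda>w. (c *\<^sub>R fst w + s *\<^sub>R snd w, c *\<^sub>R snd w - s *\<^sub>R fst w) :: 'a \<times> 'a"
  have lin: "linear ?R"
    by (rule linearI) (auto simp: algebra_simps)
  have "gexp (map ?R ?ws) F (?R (0, 0)) = gexp ?ws F (0, 0)"
  proof -
    have "frame (map ?R ?ws) h h = frame ?ws h h" for h
    proof -
      have rot2: "(c * p - s * q)\<^sup>2 + (s * p + c * q)\<^sup>2 = p\<^sup>2 + q\<^sup>2" for p q
      proof -
        have "(c * p - s * q)\<^sup>2 + (s * p + c * q)\<^sup>2 = (c\<^sup>2 + s\<^sup>2) * (p\<^sup>2 + q\<^sup>2)"
          by (simp add: power2_eq_square algebra_simps)
        then show ?thesis using cs by simp
      qed
      have "frame (map ?R (map (\<lambda>x. (x, 0)) ys)) h h + frame (map ?R (map (\<lambda>x. (0, x)) ys)) h h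
          = frame (map (\<lambda>x. (x, 0)) ys) h h + frame (map (\<lambda>x. (0, x)) ys) h h" for ys
      proof (induction ys)
        case (Cons a ys)
        with rot2[of "fst h \<bullet> a" "snd h \<bullet> a"] show ?case
          by (simp add: inner_prod_def power2_eq_square algebra_simps)
      qed simp
      then show ?thesis unfolding map_append frame_simps .
    qed
    then show ?thesis
      using gexp_frame_cong[OF assms(1), of "map ?R ?ws" ?ws "(0, 0)"] by simp
  qed
  then show ?thesis
    unfolding gexp_map[OF lin] gexp_pair_def .
qed

lemma young: "0 < q \<Longrightarrow> a \<le> q + a\<^sup>2 / (4 * q)" for a q :: real
proof -
  assume q: "0 < q"
  have "(a - q) * (4 * q) \<le> a\<^sup>2"
    using zero_le_power2[of "a - 2 * q"] by (simp add: power2_eq_square algebra_simps)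
  then have "a - q \<le> a\<^sup>2 / (4 * q)"
    using q by (simp add: pos_le_divide_eq)
  then show ?thesis by simp
qed

text \<open>A Gaussian vector is moved to an independent copy by many small rotations. Semiconcavity bounds the
  increment of \<open>f\<close> along one of them from above; the absolute value of the increment is controlled
  by its positive part because its mean vanishes.\<close>

theorem gexp_concentration:
  fixes f :: "'a \<Rightarrow> real"
  assumes f: "lip f"
    and sc: "\<And>x \<eta>. \<eta> > 0 \<Longrightarrow> \<exists>p. norm p \<le> 2 \<and> (\<forall>v. f (x + v) \<le> f x + \<eta> + p \<bullet> v + (norm v)\<^sup>2)"
    and tr: "(\<Sum>x\<leftarrow>xs. (norm x)\<^sup>2) = 1" and op: "\<And>p. (\<Sum>x\<leftarrow>xs. (p \<bullet> x)\<^sup>2) \<le> \<delta> * (norm p)\<^sup>2" and \<delta>: "\<delta> > 0"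
  shows "gexp xs (\<lambda>x. \<bar>f x - gexp xs f 0\<bar>) 0 \<le> 8 * sqrt \<delta>"
proof -
  \<comment> \<open>\<open>A \<theta> (X, Y)\<close> moves from X at angle 0 to the independent copy
    Y at angle pi/2, with the law of X throughout; \<open>D \<theta>\<close> is the mean
    displacement of f along this path.\<close>
  define A where "A \<theta> w = cos \<theta> *\<^sub>R fst w + sin \<theta> *\<^sub>R snd w" for \<theta> and w :: "'a \<times> 'a"
  define D where "D \<theta> = gexp_pair (\<lambda>w. \<bar>f (A \<theta> w) - f (fst w)\<bar>)" for \<theta>
  have A: "bounded_linear (A \<theta>)" for \<theta>
    unfolding A_def by (intro bounded_linear_intros)
  have fA: "lip (\<lambda>w. f (A \<theta> w))" for \<theta>
    by (rule lip_bounded_linear[OF f A])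
  have f1: "lip (\<lambda>w::'a \<times> 'a. f (fst w))"
    by (rule lip_bounded_linear[OF f bounded_linear_fst])
  note lips = lip_abs lip_diff lip_add lip_cmult fA f1
  have cs: "(cos \<theta>)\<^sup>2 + (sin \<theta>)\<^sup>2 = 1" for \<theta> :: real by simp
  have rot: "gexp_pair (\<lambda>w. F (A \<theta> w, cos \<theta> *\<^sub>R snd w - sin \<theta> *\<^sub>R fst w)) = gexp_pair F" if "lip F" for F \<theta>
    unfolding A_def by (rule gexp_pair_rotate[OF that cs])
  \<comment> \<open>Rotating (X, Y) by \<phi> carries the increment over the angles [0, \<theta>] to
    the one over [\<phi>, \<phi> + \<theta>] without changing its law.\<close>
  have D_add: "D (\<phi> + \<theta>) \<le> D \<theta> + D \<phi>" for \<theta> \<phi>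
  proof -
    let ?R = "\<lambda>w. (A \<phi> w, cos \<phi> *\<^sub>R snd w - sin \<phi> *\<^sub>R fst w)"
    have "A \<theta> (?R w) = A (\<phi> + \<theta>) w" for w
      unfolding A_def by (simp add: cos_add sin_add algebra_simps)
    then have e: "D \<theta> = gexp_pair (\<lambda>w. \<bar>f (A (\<phi> + \<theta>) w) - f (A \<phi> w)\<bar>)"
      unfolding D_def
      by (subst rot[symmetric, where \<theta>=\<phi>]) (auto intro!: lips)
    have "D (\<phi> + \<theta>) \<le> gexp_pair (\<lambda>w. \<bar>f (A (\<phi> + \<theta>) w) - f (A \<phi> w)\<bar> + \<bar>f (A \<phi> w) - f (fst w)\<bar>)"
      unfolding D_def gexp_pair_def by (intro gexp_mono lips) auto
    also have "\<dots> = D \<theta> + D \<phi>"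
      unfolding e unfolding D_def gexp_pair_def by (intro gexp_add lips)
    finally show ?thesis .
  qed
  have D_mult: "D (real k * \<theta>) \<le> real k * D \<theta>" for k \<theta>
  proof (induction k)
    case 0
    have "A 0 w = fst w" for w by (simp add: A_def)
    then show ?case by (simp add: D_def gexp_pair_def gexp_const)
  next
    case (Suc k)
    then show ?case using D_add[of "real k * \<theta>" \<theta>] by (simp add: ring_distribs add.commute)
  qed
  \<comment> \<open>Only the linear term survives subdivision into many small angles, so it is the
    linear coefficient that has to be of order sqrt \<delta>.\<close>
  have D_small: "D \<theta> \<le> 4 * \<theta> * sqrt \<delta> + 10 * \<theta>\<^sup>2" if \<theta>: "0 < \<theta>" "\<theta> \<le> 1" for \<theta>
  proof -
    let ?g = "\<lambda>w. f (A \<theta> w) - f (fst w)"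
    let ?m = "\<lambda>w. (\<bar>?g w\<bar> + ?g w) / 2"
    have lm: "lip ?m"
      using lip_cmult[of "\<lambda>w. \<bar>?g w\<bar> + ?g w" "1/2"] by (simp add: lips)
    have g0: "gexp_pair ?g = 0"
      using rot[OF f1, of \<theta>] by (simp add: gexp_pair_def gexp_diff lips)
    have "gexp_pair ?m = gexp_pair (\<lambda>w. (1 / 2) * (\<bar>?g w\<bar> + ?g w))" by simp
    also have "\<dots> = (1 / 2) * gexp_pair (\<lambda>w. \<bar>?g w\<bar> + ?g w)"
      unfolding gexp_pair_def by (intro gexp_cmult lips)
    also have "gexp_pair (\<lambda>w. \<bar>?g w\<bar> + ?g w) = D \<theta> + gexp_pair ?g"
      unfolding D_def gexp_pair_def by (intro gexp_add lips)
    finally have D2: "D \<theta> = 2 * gexp_pair ?m"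
      using g0 by simp
    \<comment> \<open>The displacement is sin \<theta> y - c x, and c is of second order: to first
      order only the independent direction y contributes.\<close>
    define c where "c = 1 - cos \<theta>"
    have "c = 2 * (sin (\<theta> / 2))\<^sup>2"
      using cos_double_sin[of "\<theta> / 2"] by (simp add: c_def)
    moreover have "(sin (\<theta> / 2))\<^sup>2 \<le> (\<theta> / 2)\<^sup>2"
      using abs_sin_x_le_abs_x[of "\<theta> / 2"] unfolding abs_le_square_iff .
    ultimately have c: "0 \<le> c" "c \<le> \<theta>\<^sup>2 / 2"
      by (simp_all add: power_divide)
    have s: "\<bar>sin \<theta>\<bar> \<le> \<theta>"
      using abs_sin_x_le_abs_x[of \<theta>] \<theta> by simp
    have \<theta>2: "\<theta>\<^sup>2 \<le> 1"
      using \<theta> by (simp add: power_le_one)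
    have sq: "sqrt \<delta> > 0" "sqrt \<delta> * sqrt \<delta> = \<delta>" using \<delta> by auto
    have in1: "gexp xs (\<lambda>y. ?m (x, y)) 0 \<le> 2 * \<theta> * sqrt \<delta> + 7/2 * \<theta>\<^sup>2 + 3/2 * \<theta>\<^sup>2 * (norm x)\<^sup>2" for x
    proof -
      \<comment> \<open>The slack in semiconcavity is set to \<theta>^2, the order of the other
        errors.\<close>
      obtain p where p: "norm p \<le> 2" "\<And>v. f (x + v) \<le> f x + \<theta>\<^sup>2 + p \<bullet> v + (norm v)\<^sup>2"
        using sc[of "\<theta>\<^sup>2" x] \<theta> by auto
      \<comment> \<open>Young's inequality with q = sqrt \<delta> splits |p \<bullet> y|. As (p
        \<bullet> y)^2 has mean at most 4 \<delta>, both halves contribute \<theta> sqrt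
        \<delta>.\<close>
      let ?a = "\<theta> * sqrt \<delta> + 3/2 * \<theta>\<^sup>2 + 3/2 * \<theta>\<^sup>2 * (norm x)\<^sup>2" and ?b = "\<theta> / (4 * sqrt \<delta>)" and ?d = "2 * \<theta>\<^sup>2"
      have "gexp xs (\<lambda>y. ?m (x, y)) 0 \<le> ?a + ?b * (\<Sum>y\<leftarrow>xs. (p \<bullet> y)\<^sup>2) + ?d * (\<Sum>y\<leftarrow>xs. (norm y)\<^sup>2)
          + ?b * (p \<bullet> 0)\<^sup>2 + ?d * (norm (0::'a))\<^sup>2"
      proof (rule gexp_le_quadratic)
        show "lip (\<lambda>y. ?m (x, y))" by (rule lip_inner[OF lm])
        fix y
        let ?v = "sin \<theta> *\<^sub>R y - c *\<^sub>R x"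
        have xv: "A \<theta> (x, y) = x + ?v"
          by (simp add: A_def c_def algebra_simps)
        have "?g (x, y) \<le> \<theta>\<^sup>2 + p \<bullet> ?v + (norm ?v)\<^sup>2"
          unfolding xv using p(2)[of ?v] by simp
        moreover have "p \<bullet> ?v \<le> (\<theta> * sqrt \<delta> + ?b * (p \<bullet> y)\<^sup>2) + \<theta>\<^sup>2 / 2 * (1 + (norm x)\<^sup>2)"
        proof -
          have "sin \<theta> * (p \<bullet> y) \<le> \<theta> * \<bar>p \<bullet> y\<bar>"
            using mult_right_mono[OF s abs_ge_zero[of "p \<bullet> y"]] abs_ge_self[of "sin \<theta> * (p \<bullet> y)"]
            by (simp add: abs_mult)
          also have "\<bar>p \<bullet> y\<bar> \<le> sqrt \<delta> + (p \<bullet> y)\<^sup>2 / (4 * sqrt \<delta>)"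
            using young[OF sq(1), of "\<bar>p \<bullet> y\<bar>"] by simp
          finally have 1: "sin \<theta> * (p \<bullet> y) \<le> \<theta> * sqrt \<delta> + ?b * (p \<bullet> y)\<^sup>2"
            using \<theta> by (simp add: mult_left_mono ring_distribs)
          have "- (p \<bullet> x) \<le> norm p * norm x"
            using Cauchy_Schwarz_ineq2[of p x] by simp
          also have "\<dots> \<le> 2 * norm x"
            using p(1) by (intro mult_right_mono) auto
          also have "\<dots> \<le> 1 + (norm x)\<^sup>2"
            using zero_le_power2[of "norm x - 1"] by (simp add: power2_eq_square algebra_simps)
          finally have "c * - (p \<bullet> x) \<le> c * (1 + (norm x)\<^sup>2)"
            using c by (intro mult_left_mono)
          also have "\<dots> \<le> \<theta>\<^sup>2 / 2 * (1 + (norm x)\<^sup>2)"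
            using c by (intro mult_right_mono) auto
          finally show ?thesis using 1 by (simp add: inner_simps)
        qed
        moreover have "(norm ?v)\<^sup>2 \<le> 2 * \<theta>\<^sup>2 * (norm y)\<^sup>2 + \<theta>\<^sup>2 * (norm x)\<^sup>2"
        proof -
          have "norm ?v \<le> \<bar>sin \<theta>\<bar> * norm y + c * norm x"
            using norm_triangle_ineq4[of "sin \<theta> *\<^sub>R y" "c *\<^sub>R x"] c by simp
          also have "\<dots> \<le> \<theta> * norm y + \<theta>\<^sup>2 / 2 * norm x"
            using s c by (intro add_mono mult_right_mono) auto
          finally have "(norm ?v)\<^sup>2 \<le> (\<theta> * norm y + \<theta>\<^sup>2 / 2 * norm x)\<^sup>2"
            by (intro power_mono) auto
          also have "\<dots> \<le> 2 * (\<theta> * norm y)\<^sup>2 + 2 * (\<theta>\<^sup>2 / 2 * norm x)\<^sup>2"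
            using zero_le_power2[of "\<theta> * norm y - \<theta>\<^sup>2 / 2 * norm x"] unfolding power2_diff power2_sum by simp
          also have "2 * (\<theta>\<^sup>2 / 2 * norm x)\<^sup>2 = \<theta>\<^sup>2 * (\<theta>\<^sup>2 * (norm x)\<^sup>2) / 2"
            by (simp add: power2_eq_square)
          also have "\<dots> \<le> \<theta>\<^sup>2 * (1 * (norm x)\<^sup>2) / 2"
            using \<theta>2 by (intro divide_right_mono mult_left_mono mult_right_mono) auto
          also have "\<dots> \<le> \<theta>\<^sup>2 * (norm x)\<^sup>2" by simp
          finally show ?thesis by (simp add: power_mult_distrib)
        qed
        moreover have "0 \<le> ?a + ?b * (p \<bullet> y)\<^sup>2 + ?d * (norm y)\<^sup>2"
          using \<theta> sq by simp
        ultimately show "?m (x, y) \<le> ?a + ?b * (p \<bullet> y)\<^sup>2 + ?d * (norm y)\<^sup>2"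
          by (simp add: ring_distribs abs_if)
      qed
      also have "?b * (\<Sum>y\<leftarrow>xs. (p \<bullet> y)\<^sup>2) \<le> ?b * (\<delta> * 4)"
      proof (intro mult_left_mono)
        have "(norm p)\<^sup>2 \<le> 2\<^sup>2" using p(1) by (intro power_mono) auto
        then have "\<delta> * (norm p)\<^sup>2 \<le> \<delta> * 4"
          using \<delta> by (intro mult_left_mono) auto
        with op[of p] show "(\<Sum>y\<leftarrow>xs. (p \<bullet> y)\<^sup>2) \<le> \<delta> * 4"
          by linarith
      qed (use \<theta> sq in simp)
      also have "?b * (\<delta> * 4) = \<theta> * sqrt \<delta>"
      proof -
        have "?b * (\<delta> * 4) = \<theta> * (\<delta> / sqrt \<delta>)" by simp
        then show ?thesis using \<delta> by (simp only: real_div_sqrt less_imp_le)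
      qed
      finally show ?thesis by (simp add: tr)
    qed
    have "gexp_pair ?m \<le> (2 * \<theta> * sqrt \<delta> + 7/2 * \<theta>\<^sup>2) + 0 * (\<Sum>x\<leftarrow>xs. (0 \<bullet> x)\<^sup>2)
        + 3/2 * \<theta>\<^sup>2 * (\<Sum>x\<leftarrow>xs. (norm x)\<^sup>2) + 0 * (0 \<bullet> (0::'a))\<^sup>2 + 3/2 * \<theta>\<^sup>2 * (norm (0::'a))\<^sup>2"
      unfolding gexp_pair_iterated
    proof (rule gexp_le_quadratic)
      show "lip (\<lambda>x. gexp xs (\<lambda>y. ?m (x, y)) 0)" by (rule lip_outer[OF lm])
    qed (use in1 in simp)
    then show ?thesis
      unfolding D2 by (simp add: tr)
  qed
  have "D (pi / 2) \<le> 8 * sqrt \<delta>"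
  proof (rule field_le_epsilon)
    fix e :: real assume e: "e > 0"
    \<comment> \<open>K \<ge> 2 keeps each angle pi / (2 K) below 1, as \<open>D_small\<close>
      demands; the other bound makes the accumulated quadratic error 10 K (pi / (2 K))^2 at most e.
      The linear terms add up to 2 pi sqrt \<delta>, rounded up to 8 sqrt \<delta>.\<close>
    define K where "K = max 2 (nat \<lceil>5 * pi\<^sup>2 / (2 * e)\<rceil>)"
    have K: "real K \<ge> 2" "real K \<ge> 5 * pi\<^sup>2 / (2 * e)"
      unfolding K_def by linarith+
    have "D (pi / 2) = D (real K * (pi / (2 * real K)))"
      using K by simp
    also have "\<dots> \<le> real K * D (pi / (2 * real K))"
      by (rule D_mult)
    also have "\<dots> \<le> real K * (4 * (pi / (2 * real K)) * sqrt \<delta> + 10 * (pi / (2 * real K))\<^sup>2)"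
      using K pi_less_4 by (intro mult_left_mono D_small) (auto simp: field_simps)
    also have "\<dots> = 2 * pi * sqrt \<delta> + 5 * pi\<^sup>2 / (2 * real K)"
      using K by (simp add: field_simps power2_eq_square)
    also have "2 * pi * sqrt \<delta> \<le> 8 * sqrt \<delta>"
      using pi_less_4 \<delta> by (intro mult_right_mono) auto
    also have "5 * pi\<^sup>2 / (2 * real K) \<le> e"
      using K e by (simp add: field_simps)
    finally show "D (pi / 2) \<le> 8 * sqrt \<delta> + e" by simp
  qed
  \<comment> \<open>After a quarter turn the two points are independent; averaging over one of them
    inside the absolute value leaves the deviation from the mean.\<close>
  moreover have "gexp xs (\<lambda>x. \<bar>f x - gexp xs f 0\<bar>) 0 \<le> D (pi / 2)"
  proof -
    have "A (pi / 2) w = snd w" for w by (simp add: A_def)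
    then have D: "D (pi / 2) = gexp xs (\<lambda>x. gexp xs (\<lambda>y. \<bar>f y - f x\<bar>) 0) 0"
      by (simp add: D_def gexp_pair_iterated)
    show ?thesis
      unfolding D
    proof (rule gexp_mono)
      show "lip (\<lambda>x. \<bar>f x - gexp xs f 0\<bar>)" by (intro lips f lip_const)
      show "lip (\<lambda>x. gexp xs (\<lambda>y. \<bar>f y - f x\<bar>) 0)"
        using lip_outer[of "\<lambda>w. \<bar>f (snd w) - f (fst w)\<bar>"]
        by (simp add: lips lip_bounded_linear[OF f bounded_linear_snd])
      fix x
      have "\<bar>f x - gexp xs f 0\<bar> = \<bar>gexp xs (\<lambda>y. f y - f x) 0\<bar>"
        by (simp add: gexp_diff f gexp_const)
      also have "\<dots> \<le> gexp xs (\<lambda>y. \<bar>f y - f x\<bar>) 0"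
        by (intro abs_gexp_le lips f lip_const)
      finally show "\<bar>f x - gexp xs f 0\<bar> \<le> gexp xs (\<lambda>y. \<bar>f y - f x\<bar>) 0" .
    qed
  qed
  ultimately show ?thesis by linarith
qed

end

section \<open>Truncated squared distances to cones\<close>

definition sqdist :: "'a::metric_space set \<Rightarrow> 'a \<Rightarrow> real" where
  "sqdist S x = min 1 ((infdist x S)\<^sup>2)"

lemma sqdist_nonneg: "0 \<le> sqdist S x"
  by (simp add: sqdist_def)

lemma sqdist_eq: "sqdist S x = (min 1 (infdist x S))\<^sup>2"
proof (cases "infdist x S \<le> 1")
  case True
  then show ?thesis using infdist_nonneg[of x S] by (simp add: sqdist_def power_le_one)
next
  case False
  then show ?thesis by (simp add: sqdist_def one_le_power)
qed

lemma lipschitz_sqdist: "2-lipschitz_on UNIV (sqdist S)"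
proof (rule lipschitz_onI)
  fix x y
  define a b where "a = min 1 (infdist x S)" and "b = min 1 (infdist y S)"
  have ab: "0 \<le> a" "a \<le> 1" "0 \<le> b" "b \<le> 1" "\<bar>a - b\<bar> \<le> dist x y"
    using infdist_triangle_abs[of x S y] by (auto simp: a_def b_def infdist_nonneg)
  have "\<bar>a\<^sup>2 - b\<^sup>2\<bar> = \<bar>a - b\<bar> * (a + b)"
    using ab by (simp add: power2_eq_square square_diff_square_factored abs_mult mult.commute)
  also have "\<dots> \<le> dist x y * 2"
    using ab by (intro mult_mono) auto
  finally show "dist (sqdist S x) (sqdist S y) \<le> 2 * dist x y"
    unfolding sqdist_eq a_def b_def dist_real_def by simp
qed simp

lemma lip_sqdist: "lip (sqdist S)"
  by (rule lipI[OF lipschitz_sqdist])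

text \<open>A squared distance is an infimum of functions |x - s|^2, whose second-order term is
  |v|^2. A near minimizer s supplies p = 2 (x - s), and \<eta> pays for an infimum that is not
  attained. Where the truncation is active the function is at its maximum and p = 0 works. The
  truncation itself is there to make the squared distance globally Lipschitz.\<close>

lemma sqdist_semiconcave:
  fixes x :: "'a::real_inner"
  assumes S: "S \<noteq> {}" and \<eta>: "\<eta> > 0"
  shows "\<exists>p. norm p \<le> 2 \<and> (\<forall>v. sqdist S (x + v) \<le> sqdist S x + \<eta> + p \<bullet> v + (norm v)\<^sup>2)"
proof (cases "infdist x S < 1")
  case True
  define D where "D = infdist x S"
  have D: "0 \<le> D" "D < 1" using True by (auto simp: D_def infdist_nonneg)
  \<comment> \<open>The bound 1 ensures |p| = 2 |x - s| \<le> 2; the square root makes s optimal up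
    to \<eta> in squared distance.\<close>
  define d where "d = min 1 (sqrt (D\<^sup>2 + \<eta>))"
  have "D < sqrt (D\<^sup>2 + \<eta>)"
    using D \<eta> by (intro real_less_rsqrt) auto
  then have "infdist x S < d" using True by (simp add: d_def D_def)
  then obtain s where s: "s \<in> S" "dist x s < d"
    using S unfolding infdist_notempty[OF S] by (subst (asm) cINF_less_iff) auto
  have "(dist x s)\<^sup>2 \<le> (sqrt (D\<^sup>2 + \<eta>))\<^sup>2"
    using s(2) by (intro power_mono) (auto simp: d_def)
  also have "\<dots> = D\<^sup>2 + \<eta>" using \<eta> by simp
  also have "D\<^sup>2 = sqdist S x"
    using D unfolding sqdist_eq D_def[symmetric] by simp
  finally have sx: "(norm (x - s))\<^sup>2 \<le> sqdist S x + \<eta>" by (simp add: dist_norm)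
  have "sqdist S (x + v) \<le> sqdist S x + \<eta> + (2 *\<^sub>R (x - s)) \<bullet> v + (norm v)\<^sup>2" for v
  proof -
    have "sqdist S (x + v) \<le> (infdist (x + v) S)\<^sup>2" by (simp add: sqdist_def)
    also have "\<dots> \<le> (dist (x + v) s)\<^sup>2"
      using infdist_le[OF s(1), of "x + v"] infdist_nonneg[of "x + v" S] by (intro power_mono)
    also have "\<dots> = (norm ((x - s) + v))\<^sup>2" by (simp add: dist_norm algebra_simps)
    also have "\<dots> = (norm (x - s))\<^sup>2 + 2 * ((x - s) \<bullet> v) + (norm v)\<^sup>2"
      by (simp only: power2_norm_eq_inner) (simp add: inner_simps inner_commute)
    finally show ?thesis using sx by simp
  qed
  moreover have "norm (2 *\<^sub>R (x - s)) \<le> 2"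
    using s(2) by (simp add: d_def dist_norm)
  ultimately show ?thesis by blast
next
  case False
  then have "1 \<le> (infdist x S)\<^sup>2" by (simp add: one_le_power)
  then have "sqdist S x = 1" by (simp add: sqdist_def)
  moreover have "sqdist S y \<le> 1" for y by (simp add: sqdist_def)
  ultimately have "norm (0::'a) \<le> 2 \<and> (\<forall>v. sqdist S (x + v) \<le> sqdist S x + \<eta> + 0 \<bullet> v + (norm v)\<^sup>2)"
    using \<eta> by (auto intro: order_trans[of _ 1])
  then show ?thesis by blast
qed

text \<open>After scaling w to norm one, moving a cone point r a back to the sphere costs |r - 1|,
  which is at most its distance from w. Distance \<epsilon> from A thus leaves distance \<epsilon>/2
  from the cone. Inserting 0 keeps the cone nonempty.\<close>

lemma sqdist_cone_ge:
  fixes A :: "'a::real_normed_vector set"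
  assumes \<epsilon>: "0 < \<epsilon>" "\<epsilon> \<le> 1" and far: "\<And>a. a \<in> A \<Longrightarrow> dist (w /\<^sub>R norm w) a \<ge> \<epsilon>"
    and A: "A \<subseteq> sphere 0 1" and w: "w \<noteq> 0"
  shows "sqdist (insert 0 {r *\<^sub>R a | r a. 0 \<le> r \<and> a \<in> A}) w \<ge> \<epsilon>\<^sup>2 / 4 * min 1 ((norm w)\<^sup>2)"
proof -
  let ?C = "insert 0 {r *\<^sub>R a | r a. 0 \<le> r \<and> a \<in> A}"
  have "\<epsilon> / 2 * norm w \<le> dist w z" if z_in: "z \<in> ?C" for z
  proof (cases "z = 0")
    case True
    have "\<epsilon> / 2 * norm w \<le> 1 * norm w" using \<epsilon> by (intro mult_right_mono) auto
    with True show ?thesis by simp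
  next
    case False
    then obtain r a where z: "z = r *\<^sub>R a" "0 \<le> r" "a \<in> A" using z_in by auto
    let ?w = "w /\<^sub>R norm w" and ?r = "r / norm w"
    have na: "norm a = 1" using A z(3) by auto
    have nw: "norm ?w = 1" using w by simp
    have "\<epsilon> \<le> norm (?w - a)" using far[OF z(3)] by (simp add: dist_norm)
    also have "?w - a = (?w - ?r *\<^sub>R a) + (?r - 1) *\<^sub>R a" by (simp add: algebra_simps)
    also have "norm \<dots> \<le> norm (?w - ?r *\<^sub>R a) + \<bar>?r - 1\<bar>"
      using norm_triangle_ineq[of "?w - ?r *\<^sub>R a" "(?r - 1) *\<^sub>R a"] na by simp
    also have "\<bar>?r - 1\<bar> = \<bar>norm ?w - norm (?r *\<^sub>R a)\<bar>"
      unfolding nw using na z(2) by (simp add: abs_minus_commute)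
    also have "\<dots> \<le> norm (?w - ?r *\<^sub>R a)" by (rule norm_triangle_ineq3)
    finally have "\<epsilon> / 2 * norm w \<le> norm (?w - ?r *\<^sub>R a) * norm w"
      using w by (intro mult_right_mono) auto
    also have "\<dots> = norm (norm w *\<^sub>R (?w - ?r *\<^sub>R a))" by simp
    also have "norm w *\<^sub>R (?w - ?r *\<^sub>R a) = w - z"
      using w z(1) by (simp add: scaleR_diff_right)
    finally show ?thesis by (simp add: dist_norm)
  qed
  then have "\<epsilon> / 2 * norm w \<le> infdist w ?C"
    unfolding infdist_notempty[OF insert_not_empty] by (rule cINF_greatest[OF insert_not_empty])
  then have "(\<epsilon> / 2 * norm w)\<^sup>2 \<le> (infdist w ?C)\<^sup>2"
    using \<epsilon> by (intro power_mono) auto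
  then have 1: "\<epsilon>\<^sup>2 / 4 * (norm w)\<^sup>2 \<le> (infdist w ?C)\<^sup>2"
    by (simp add: power_mult_distrib power_divide)
  have 2: "0 \<le> \<epsilon>\<^sup>2 / 4" "\<epsilon>\<^sup>2 / 4 \<le> 1"
    using \<epsilon> by (auto simp: power_le_one intro: order_trans[of _ 1])
  have "\<epsilon>\<^sup>2 / 4 * min 1 ((norm w)\<^sup>2) \<le> 1"
    using mult_mono[of "\<epsilon>\<^sup>2 / 4" 1 "min 1 ((norm w)\<^sup>2)" 1] 2 by simp
  moreover have "\<epsilon>\<^sup>2 / 4 * min 1 ((norm w)\<^sup>2) \<le> \<epsilon>\<^sup>2 / 4 * (norm w)\<^sup>2"
    using 2 by (intro mult_left_mono) auto
  ultimately show ?thesis using 1 by (simp add: sqdist_def)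
qed

text \<open>Trace-norm closeness of the covariance operator of \<open>xs\<close> to its translate, without operators: both
  become equal after adding families of small total variance.\<close>

definition almost_invariant :: "('a::real_inner \<Rightarrow> 'a) set \<Rightarrow> real \<Rightarrow> 'a list \<Rightarrow> bool" where
  "almost_invariant F \<delta> xs \<longleftrightarrow>
    (\<Sum>x\<leftarrow>xs. (norm x)\<^sup>2) = 1 \<and> (\<forall>p. (\<Sum>x\<leftarrow>xs. (p \<bullet> x)\<^sup>2) \<le> \<delta> * (norm p)\<^sup>2) \<and>
    (\<forall>T\<in>F. \<exists>rs rs'. (\<Sum>r\<leftarrow>rs. (norm r)\<^sup>2) \<le> \<delta> \<and> (\<Sum>r\<leftarrow>rs'. (norm r)\<^sup>2) \<le> \<delta> \<and>
      (\<forall>h. frame (xs @ rs) h h = frame (map T xs @ rs') h h))"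

text \<open>If no z works for A, every z is moved by some T in F away from the cone of A, so the sum
  over T of the squared distances at T z is at least c min(1, |z|^2). Its mean is then bounded
  below, while almost invariance compares each summand with the mean squared distance for A itself,
  which is tiny for some member.\<close>

lemma concentration_of_almost_invariant:
  fixes \<C> :: "'a::real_inner set set" and F :: "('a \<Rightarrow> 'a) set"
  assumes \<C>: "finite \<C>" "\<Union>\<C> = sphere 0 1"
    and F: "finite F" "\<And>T. T \<in> F \<Longrightarrow> linear T" "\<And>T x. T \<in> F \<Longrightarrow> norm (T x) = norm x"
    and \<epsilon>: "\<epsilon> > 0"
    and inv: "\<And>\<delta>. \<delta> > 0 \<Longrightarrow> \<exists>xs. almost_invariant F \<delta> xs"
  obtains A z where "A \<in> \<C>" "z \<in> sphere 0 1" "\<And>T. T \<in> F \<Longrightarrow> \<exists>a\<in>A. dist (T z) a < \<epsilon>"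
proof (rule ccontr)
  assume "\<not> thesis"
  with that have neg: "\<And>A z. A \<in> \<C> \<Longrightarrow> z \<in> sphere 0 1 \<Longrightarrow> \<exists>T\<in>F. \<forall>a\<in>A. \<not> dist (T z) a < \<epsilon>"
    by blast
  define \<epsilon>' where "\<epsilon>' = min \<epsilon> 1"
  have \<epsilon>': "0 < \<epsilon>'" "\<epsilon>' \<le> 1" "\<epsilon>' \<le> \<epsilon>" using \<epsilon> by (auto simp: \<epsilon>'_def)
  have far: "\<exists>T\<in>F. \<forall>a\<in>A. dist (T z) a \<ge> \<epsilon>'" if Az: "A \<in> \<C>" "z \<in> sphere 0 1" for A z
  proof -
    obtain T where "T \<in> F" "\<forall>a\<in>A. \<not> dist (T z) a < \<epsilon>" using neg[OF Az] by blast
    then show ?thesis using \<epsilon>'(3) by (intro bexI[of _ T]) force+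
  qed
  define C where "C A = insert 0 {r *\<^sub>R a | r a. 0 \<le> r \<and> a \<in> A}" for A :: "'a set"
  define c where "c = \<epsilon>'\<^sup>2 / 4"
  have c: "c > 0" using \<epsilon>' by (simp add: c_def)
  \<comment> \<open>Chosen so that the final estimate adds up to N s = c/8, below the lower bound
    c/4; the added 1 keeps N positive for empty F.\<close>
  define N where "N = (real (card F) + 1) * (8 * real (card \<C>) + 4)"
  have N: "N > 0" unfolding N_def by (intro mult_pos_pos) auto
  define s where "s = c / (8 * N)"
  have s: "s > 0" using c N by (simp add: s_def)
  obtain xs where xs: "almost_invariant F (s\<^sup>2) xs" using inv[of "s\<^sup>2"] s by auto
  have tr: "(\<Sum>x\<leftarrow>xs. (norm x)\<^sup>2) = 1" and op: "\<And>p. (\<Sum>x\<leftarrow>xs. (p \<bullet> x)\<^sup>2) \<le> s\<^sup>2 * (norm p)\<^sup>2"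
    using xs by (auto simp: almost_invariant_def)
  define m where "m A = gexp xs (sqdist (C A)) 0" for A
  have conc: "gexp xs (\<lambda>x. \<bar>sqdist (C A) x - m A\<bar>) 0 \<le> 8 * s" for A
  proof -
    have "gexp xs (\<lambda>x. \<bar>sqdist (C A) x - m A\<bar>) 0 \<le> 8 * sqrt (s\<^sup>2)"
      unfolding m_def
      by (rule gexp_concentration[OF lip_sqdist sqdist_semiconcave tr op]) (use s in \<open>auto simp: C_def\<close>)
    then show ?thesis using s by simp
  qed
  \<comment> \<open>Appending the corrections makes the two laws equal; each of the two appendices
    costs 2 s because \<open>sqdist\<close> has Lipschitz constant 2.\<close>
  have trans: "gexp xs (\<lambda>x. sqdist S (T x)) 0 \<le> gexp xs (sqdist S) 0 + 4 * s" if T: "T \<in> F" for S T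
  proof -
    obtain rs rs' where r: "(\<Sum>r\<leftarrow>rs. (norm r)\<^sup>2) \<le> s\<^sup>2" "(\<Sum>r\<leftarrow>rs'. (norm r)\<^sup>2) \<le> s\<^sup>2"
      "\<And>h. frame (xs @ rs) h h = frame (map T xs @ rs') h h"
      using xs T unfolding almost_invariant_def by blast
    have "gexp xs (\<lambda>x. sqdist S (T x)) 0 = gexp (map T xs) (sqdist S) 0"
      using gexp_map[OF F(2)[OF T], of xs "sqdist S" 0] by (simp add: linear_0[OF F(2)[OF T]])
    moreover have "gexp (xs @ rs) (sqdist S) 0 = gexp (map T xs @ rs') (sqdist S) 0"
      by (rule gexp_frame_cong[OF lip_sqdist r(3)])
    ultimately show ?thesis
      using gexp_append_close[OF lipschitz_sqdist[of S] s r(1), where xs=xs and z=0]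
        gexp_append_close[OF lipschitz_sqdist[of S] s r(2), where xs="map T xs" and z=0] by linarith
  qed
  have lower: "c / 4 \<le> real (card F) * (m A + 4 * s)" if A: "A \<in> \<C>" for A
  proof -
    have lT: "lip (\<lambda>x. sqdist (C A) (T x))" if "T \<in> F" for T
    proof (rule lip_compose[OF lip_sqdist])
      show "1-lipschitz_on UNIV T"
        using F(2,3)[OF that] by (intro lipschitz_onI) (auto simp: dist_norm linear_diff[symmetric])
    qed
    have lS: "lip (\<lambda>z. (1 / c) * (\<Sum>T\<in>F. sqdist (C A) (T z)))"
      by (intro lip_cmult lip_sum lT)
    \<comment> \<open>The mean of min(1, |z|^2) is bounded below by means of t - t^2/4 \<le> min(1,
      t): at unit variance the fourth moment is at most 3, which leaves 1 - 3/4 = 1/4.\<close>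
    have "(norm (0::'a))\<^sup>2 + 1 - 1/4 * ((norm (0::'a))^4 + 6 * 1 * (norm (0::'a))\<^sup>2 + 3 * 1\<^sup>2)
        \<le> gexp xs (\<lambda>z. (1 / c) * (\<Sum>T\<in>F. sqdist (C A) (T z))) 0"
    proof (rule gexp_ge_quartic[OF lS])
      fix z :: 'a
      show "(norm z)\<^sup>2 - 1/4 * (norm z)^4 \<le> (1 / c) * (\<Sum>T\<in>F. sqdist (C A) (T z))"
      proof (cases "z = 0")
        case True
        then show ?thesis using c by (simp add: sum_nonneg sqdist_nonneg)
      next
        case False
        then obtain T where T: "T \<in> F" "\<forall>a\<in>A. dist (T (z /\<^sub>R norm z)) a \<ge> \<epsilon>'"
          using far[OF A, of "z /\<^sub>R norm z"] by auto
        have Tz: "T (z /\<^sub>R norm z) = T z /\<^sub>R norm (T z)"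
          using F(2,3)[OF T(1)] by (simp add: linear_cmul)
        have "c * min 1 ((norm (T z))\<^sup>2) \<le> sqdist (C A) (T z)"
          unfolding c_def C_def
        proof (rule sqdist_cone_ge[OF \<epsilon>'(1,2)])
          show "A \<subseteq> sphere 0 1" using \<C> A by auto
          show "T z \<noteq> 0" using F(3)[OF T(1), of z] False by auto
          show "dist (T z /\<^sub>R norm (T z)) a \<ge> \<epsilon>'" if "a \<in> A" for a
            using T(2) that unfolding Tz by auto
        qed
        also have "\<dots> \<le> (\<Sum>T\<in>F. sqdist (C A) (T z))"
          using T(1) F(1) by (intro member_le_sum) (auto simp: sqdist_nonneg)
        finally have 1: "min 1 ((norm z)\<^sup>2) \<le> (1 / c) * (\<Sum>T\<in>F. sqdist (C A) (T z))"
          using c F(3)[OF T(1)] by (simp add: field_simps)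
        define t where "t = (norm z)\<^sup>2"
        have "t - 1/4 * t\<^sup>2 \<le> min 1 t"
          using zero_le_power2[of "1 - t / 2"] zero_le_power2[of t]
          by (auto simp: min_def power2_eq_square algebra_simps)
        from order_trans[OF this 1[folded t_def]] show ?thesis by (simp add: t_def)
      qed
    qed (use tr in auto)
    then have "1 / 4 \<le> gexp xs (\<lambda>z. (1 / c) * (\<Sum>T\<in>F. sqdist (C A) (T z))) 0" by simp
    also have "\<dots> = (1 / c) * (\<Sum>T\<in>F. gexp xs (\<lambda>z. sqdist (C A) (T z)) 0)"
      by (subst gexp_cmult) (auto intro!: lip_sum lT simp: gexp_sum[OF lT])
    also have "\<dots> \<le> (1 / c) * (\<Sum>T\<in>F. m A + 4 * s)"
      using c trans[of _ "C A"] by (intro mult_left_mono sum_mono) (auto simp: m_def)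
    finally show ?thesis using c by (simp add: field_simps)
  qed
  \<comment> \<open>The cones cover the whole space, so at each point some squared distance
    vanishes. If all means were large, the sum of the deviations from the means would be large
    everywhere, against \<open>conc\<close>.\<close>
  have "\<exists>A\<in>\<C>. m A \<le> real (card \<C>) * (8 * s)"
  proof (rule ccontr)
    assume big: "\<not> ?thesis"
    have "\<C> \<noteq> {}" 
    proof
      assume "\<C> = {}"
      then have "sphere (0::'a) 1 = {}" using \<C>(2) by simp
      then have "norm x = 0" for x :: 'a
        by (metis empty_iff inverse_nonnegative_iff_nonnegative mem_sphere_0 norm_eq_zero norm_sgn)
      then have "(\<lambda>x::'a. (norm x)\<^sup>2) = (\<lambda>x. 0)" by auto
      then show False using tr by simp
    qed
    define M where "M = Min (m ` \<C>)"
    have M: "M > real (card \<C>) * (8 * s)"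
      using big \<C>(1) \<open>\<C> \<noteq> {}\<close> by (auto simp: M_def)
    have l: "lip (\<lambda>x. \<bar>sqdist (C A) x - m A\<bar>)" for A
      by (intro lip_abs lip_diff lip_sqdist lip_const)
    have "M = gexp xs (\<lambda>x. M) 0" by (simp add: gexp_const)
    also have "\<dots> \<le> gexp xs (\<lambda>x. \<Sum>A\<in>\<C>. \<bar>sqdist (C A) x - m A\<bar>) 0"
    proof (rule gexp_mono)
      fix x :: 'a
      obtain A where A: "A \<in> \<C>" "x \<in> C A"
      proof (cases "x = 0")
        case True
        then show ?thesis using \<open>\<C> \<noteq> {}\<close> that by (auto simp: C_def)
      next
        case False
        then have "x /\<^sub>R norm x \<in> \<Union>\<C>" using \<C>(2) by simp
        then obtain A where "A \<in> \<C>" "x /\<^sub>R norm x \<in> A" by auto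
        moreover have "x = norm x *\<^sub>R (x /\<^sub>R norm x)" using False by simp
        ultimately show ?thesis using that norm_ge_zero[of x] unfolding C_def by blast
      qed
      have "sqdist (C A) x = 0" using A(2) by (simp add: sqdist_def)
      then have "M \<le> \<bar>sqdist (C A) x - m A\<bar>"
        using A(1) \<C>(1) by (auto simp: M_def intro: order_trans[of _ "m A"])
      also have "\<dots> \<le> (\<Sum>A\<in>\<C>. \<bar>sqdist (C A) x - m A\<bar>)"
        using A(1) \<C>(1) by (intro member_le_sum) auto
      finally show "M \<le> (\<Sum>A\<in>\<C>. \<bar>sqdist (C A) x - m A\<bar>)" .
    qed (intro lip_const lip_sum l)+
    also have "\<dots> = (\<Sum>A\<in>\<C>. gexp xs (\<lambda>x. \<bar>sqdist (C A) x - m A\<bar>) 0)"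
      by (rule gexp_sum[OF l])
    also have "\<dots> \<le> (\<Sum>A\<in>\<C>. 8 * s)"
      by (intro sum_mono conc)
    finally show False using M by simp
  qed
  then obtain A where A: "A \<in> \<C>" "m A \<le> real (card \<C>) * (8 * s)" by blast
  have "c / 4 \<le> real (card F) * (m A + 4 * s)" by (rule lower[OF A(1)])
  also have "\<dots> \<le> real (card F) * (real (card \<C>) * (8 * s) + 4 * s)"
    using A(2) by (intro mult_left_mono) auto
  also have "\<dots> \<le> (real (card F) + 1) * (real (card \<C>) * (8 * s) + 4 * s)"
    using s by (intro mult_right_mono) auto
  also have "\<dots> = N * s" by (simp add: N_def algebra_simps)
  also have "\<dots> = c / 8" using N by (simp add: s_def)
  finally show False using c by simp
qed

section \<open>Extension of positive functionals and Riesz representation\<close>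

text \<open>Families of quadratic forms will be treated as functions; the extension theorem is
  applied in the product of the reals with such a function space.\<close>

instantiation "fun" :: (type, real_vector) real_vector
begin

definition "r *\<^sub>R f = (\<lambda>x. r *\<^sub>R f x)"

instance
  by standard (simp_all add: scaleR_fun_def plus_fun_def scaleR_add_right scaleR_add_left)

end

lemma scaleR_fun_apply [simp]: "(r *\<^sub>R f) x = r *\<^sub>R f x"
  by (simp add: scaleR_fun_def)

text \<open>The M. Riesz extension theorem for an order unit \<open>u\<close>; the functional is linear on the subspace
  of vectors bounded by multiples of \<open>u\<close>.\<close>

lemma cone_extension:
  fixes P0 :: "'v::real_vector set" and u :: 'v
  defines "S \<equiv> {x. \<exists>t. t *\<^sub>R u - x \<in> P0 \<and> t *\<^sub>R u + x \<in> P0}"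
  assumes P0_add: "\<And>x y. x \<in> P0 \<Longrightarrow> y \<in> P0 \<Longrightarrow> x + y \<in> P0"
    and P0_scale: "\<And>t x. 0 \<le> t \<Longrightarrow> x \<in> P0 \<Longrightarrow> t *\<^sub>R x \<in> P0"
    and u: "u \<in> P0" "- u \<notin> P0"
  obtains \<psi> :: "'v \<Rightarrow> real" where
    "\<And>x y. x \<in> S \<Longrightarrow> y \<in> S \<Longrightarrow> \<psi> (x + y) = \<psi> x + \<psi> y"
    "\<And>t x. x \<in> S \<Longrightarrow> \<psi> (t *\<^sub>R x) = t * \<psi> x"
    "\<And>x. x \<in> S \<Longrightarrow> x \<in> P0 \<Longrightarrow> 0 \<le> \<psi> x"
    "\<psi> u = 1"
proof -
  define cone where "cone P \<longleftrightarrow> (\<forall>x\<in>P. \<forall>y\<in>P. x + y \<in> P) \<and> (\<forall>t\<ge>0. \<forall>x\<in>P. t *\<^sub>R x \<in> P)" for P :: "'v set"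
  define \<A> where "\<A> = {P. cone P \<and> P0 \<subseteq> P \<and> - u \<notin> P}"
  have "P0 \<in> \<A>"
    using P0_add P0_scale u by (auto simp: \<A>_def cone_def)
  \<comment> \<open>A maximal cone that avoids - u is a half-space up to its boundary; the
    functional is read off from it instead of being extended one dimension at a time.\<close>
  have "\<exists>M\<in>\<A>. \<forall>X\<in>\<A>. M \<subseteq> X \<longrightarrow> X = M"
  proof (rule subset_Zorn_nonempty)
    show "\<A> \<noteq> {}" using \<open>P0 \<in> \<A>\<close> by auto
    fix \<C> assume \<C>: "\<C> \<noteq> {}" "subset.chain \<A> \<C>"
    then have sub: "\<C> \<subseteq> \<A>" and lin: "\<And>X Y. X \<in> \<C> \<Longrightarrow> Y \<in> \<C> \<Longrightarrow> X \<subseteq> Y \<or> Y \<subseteq> X"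
      by (auto simp: subset.chain_def)
    have "cone (\<Union>\<C>)"
      unfolding cone_def
    proof (intro conjI ballI allI impI)
      fix x y assume "x \<in> \<Union>\<C>" "y \<in> \<Union>\<C>"
      then obtain X Y where XY: "X \<in> \<C>" "x \<in> X" "Y \<in> \<C>" "y \<in> Y" by auto
      have "\<exists>Z\<in>\<C>. x \<in> Z \<and> y \<in> Z" using lin[OF XY(1,3)] XY by blast
      then obtain Z where "Z \<in> \<C>" "x \<in> Z" "y \<in> Z" by blast
      moreover have "cone Z" using \<open>Z \<in> \<C>\<close> sub by (auto simp: \<A>_def)
      ultimately show "x + y \<in> \<Union>\<C>" by (auto simp: cone_def)
    next
      fix t :: real and x assume "0 \<le> t" "x \<in> \<Union>\<C>"
      then obtain X where X: "X \<in> \<C>" "x \<in> X" by auto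
      moreover have "cone X" using X sub by (auto simp: \<A>_def)
      ultimately show "t *\<^sub>R x \<in> \<Union>\<C>" using \<open>0 \<le> t\<close> unfolding cone_def by blast
    qed
    then show "\<Union>\<C> \<in> \<A>" using \<C>(1) sub by (auto simp: \<A>_def)
  qed
  then obtain P where P: "P \<in> \<A>" and max: "\<And>X. X \<in> \<A> \<Longrightarrow> P \<subseteq> X \<Longrightarrow> X = P" by blast
  have add: "x + y \<in> P" if "x \<in> P" "y \<in> P" for x y
    using P that by (auto simp: \<A>_def cone_def)
  have scale: "t *\<^sub>R x \<in> P" if "x \<in> P" "0 \<le> t" for x t
    using P that by (auto simp: \<A>_def cone_def)
  have sub: "P0 \<subseteq> P" and nu: "- u \<notin> P" and uP: "u \<in> P"
    using P u by (auto simp: \<A>_def)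
  have zero: "0 \<in> P" using scale[OF uP, of 0] by simp
  \<comment> \<open>By maximality the cone generated by P and x contains - u; solving for - x gives
    a positive multiple of u below it.\<close>
  have half: "\<exists>s>0. - x - s *\<^sub>R u \<in> P" if x: "x \<notin> P" for x
  proof -
    let ?P = "{a + t *\<^sub>R x | a t. a \<in> P \<and> 0 \<le> t}"
    have "cone ?P"
      unfolding cone_def
    proof (intro conjI ballI allI impI)
      fix y z assume "y \<in> ?P" "z \<in> ?P"
      then obtain a t b s where "y = a + t *\<^sub>R x" "z = b + s *\<^sub>R x" "a \<in> P" "b \<in> P" "0 \<le> t" "0 \<le> s" by blast
      then have "y + z = (a + b) + (t + s) *\<^sub>R x" "a + b \<in> P" "0 \<le> t + s"
        using add by (auto simp: algebra_simps)
      then show "y + z \<in> ?P" by blast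
    next
      fix r :: real and y assume "0 \<le> r" "y \<in> ?P"
      then obtain a t where "y = a + t *\<^sub>R x" "a \<in> P" "0 \<le> t" by blast
      then have "r *\<^sub>R y = r *\<^sub>R a + (r * t) *\<^sub>R x" "r *\<^sub>R a \<in> P" "0 \<le> r * t"
        using scale \<open>0 \<le> r\<close> by (auto simp: algebra_simps)
      then show "r *\<^sub>R y \<in> ?P" by blast
    qed
    moreover have "P \<subseteq> ?P"
    proof
      fix a assume "a \<in> P"
      then have "a = a + 0 *\<^sub>R x \<and> a \<in> P \<and> (0::real) \<le> 0" by simp
      then show "a \<in> ?P" by blast
    qed
    moreover have "x \<in> ?P"
    proof -
      have "x = 0 + 1 *\<^sub>R x \<and> 0 \<in> P \<and> (0::real) \<le> 1" using zero by simp
      then show ?thesis by blast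
    qed
    ultimately have "?P \<notin> \<A>" "cone ?P" "P0 \<subseteq> ?P"
      using max[of ?P] sub x by blast+
    then have "- u \<in> ?P"
      unfolding \<A>_def by blast
    then obtain a t where at: "- u = a + t *\<^sub>R x" "a \<in> P" "0 \<le> t" by blast
    have "t \<noteq> 0" using at nu by auto
    then have t: "0 < t" using at by simp
    have a: "a = - u - t *\<^sub>R x" using at(1) by (simp add: eq_diff_eq)
    have "t *\<^sub>R (- x - (1 / t) *\<^sub>R u) = a"
      unfolding a using t by (simp add: algebra_simps)
    then have "- x - (1 / t) *\<^sub>R u = (1 / t) *\<^sub>R a" using t by auto
    then show ?thesis using t scale[OF at(2), of "1 / t"] by (intro exI[of _ "1 / t"]) auto
  qed
  have pos: "0 \<le> t" if "t *\<^sub>R u \<in> P" for t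
  proof (rule ccontr)
    assume t: "\<not> 0 \<le> t"
    have "(1 / - t) *\<^sub>R (t *\<^sub>R u) \<in> P" by (rule scale[OF that]) (use t in simp)
    then show False using t nu by simp
  qed
  \<comment> \<open>Lower bounds on \<psi> are witnessed in P directly, upper bounds by way of
    \<open>half\<close>.\<close>
  define \<psi> where "\<psi> x = Sup {t. x - t *\<^sub>R u \<in> P}" for x
  have S: "\<exists>t. t *\<^sub>R u - x \<in> P \<and> t *\<^sub>R u + x \<in> P" if "x \<in> S" for x
    using that sub by (auto simp: S_def)
  have bdd: "bdd_above {t. x - t *\<^sub>R u \<in> P}" and ne: "{t. x - t *\<^sub>R u \<in> P} \<noteq> {}"
    and ub: "x - t *\<^sub>R u \<in> P \<Longrightarrow> T *\<^sub>R u - x \<in> P \<Longrightarrow> t \<le> T" if x: "x \<in> S" for x t T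
  proof -
    have ub': "t \<le> T" if "x - t *\<^sub>R u \<in> P" "T *\<^sub>R u - x \<in> P" for t T
      using pos[of "T - t"] add[OF that] by (simp add: algebra_simps)
    then show "x - t *\<^sub>R u \<in> P \<Longrightarrow> T *\<^sub>R u - x \<in> P \<Longrightarrow> t \<le> T" by blast
    obtain T where T: "T *\<^sub>R u - x \<in> P" "T *\<^sub>R u + x \<in> P" using S[OF x] by blast
    show "bdd_above {t. x - t *\<^sub>R u \<in> P}" using ub'[OF _ T(1)] by (intro bdd_aboveI[of _ T]) auto
    have "x - (- T) *\<^sub>R u \<in> P" using T(2) by (simp add: add.commute)
    then show "{t. x - t *\<^sub>R u \<in> P} \<noteq> {}" by blast
  qed
  have lo: "t \<le> \<psi> x" if "x - t *\<^sub>R u \<in> P" "x \<in> S" for x t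
    unfolding \<psi>_def using that bdd by (auto intro: cSup_upper)
  have up: "\<psi> x \<le> t" if "t *\<^sub>R u - x \<in> P" "x \<in> S" for x t
    unfolding \<psi>_def using that ne ub by (intro cSup_least) auto
  have lo': "x - t *\<^sub>R u \<in> P" if "t < \<psi> x" "x \<in> S" for x t
  proof -
    obtain t' where t': "t < t'" "x - t' *\<^sub>R u \<in> P"
      using \<open>t < \<psi> x\<close> less_cSup_iff[OF ne bdd, OF \<open>x \<in> S\<close> \<open>x \<in> S\<close>] unfolding \<psi>_def by auto
    have "(x - t' *\<^sub>R u) + (t' - t) *\<^sub>R u \<in> P" using t' by (intro add scale uP) auto
    then show ?thesis by (simp add: algebra_simps)
  qed
  have up': "t *\<^sub>R u - x \<in> P" if "\<psi> x < t" "x \<in> S" for x t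
  proof -
    have "x - t *\<^sub>R u \<notin> P" using lo[of x t] that by auto
    then obtain s where s: "s > 0" "- (x - t *\<^sub>R u) - s *\<^sub>R u \<in> P" using half by blast
    have "(- (x - t *\<^sub>R u) - s *\<^sub>R u) + s *\<^sub>R u \<in> P" using s by (intro add scale uP) auto
    then show ?thesis by simp
  qed
  have S_add: "x + y \<in> S" if "x \<in> S" "y \<in> S" for x y
  proof -
    obtain s t where "s *\<^sub>R u - x \<in> P0" "s *\<^sub>R u + x \<in> P0" "t *\<^sub>R u - y \<in> P0" "t *\<^sub>R u + y \<in> P0"
      using \<open>x \<in> S\<close> \<open>y \<in> S\<close> by (auto simp: S_def)
    then have "(s *\<^sub>R u - x) + (t *\<^sub>R u - y) \<in> P0" "(s *\<^sub>R u + x) + (t *\<^sub>R u + y) \<in> P0" by (auto intro: P0_add)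
    then have "(s + t) *\<^sub>R u - (x + y) \<in> P0" "(s + t) *\<^sub>R u + (x + y) \<in> P0" by (simp_all add: algebra_simps)
    then show ?thesis by (auto simp: S_def)
  qed
  have S_neg: "- x \<in> S" if "x \<in> S" for x
    using that by (auto simp: S_def)
  have S_pos: "t *\<^sub>R x \<in> S" if "x \<in> S" "0 \<le> t" for x t
  proof -
    obtain s where "s *\<^sub>R u - x \<in> P0" "s *\<^sub>R u + x \<in> P0" using \<open>x \<in> S\<close> by (auto simp: S_def)
    then have "t *\<^sub>R (s *\<^sub>R u - x) \<in> P0" "t *\<^sub>R (s *\<^sub>R u + x) \<in> P0" using P0_scale[OF \<open>0 \<le> t\<close>] by blast+
    then have "(t * s) *\<^sub>R u - t *\<^sub>R x \<in> P0" "(t * s) *\<^sub>R u + t *\<^sub>R x \<in> P0" by (simp_all add: algebra_simps)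
    then show ?thesis by (auto simp: S_def)
  qed
  have \<psi>_add: "\<psi> (x + y) = \<psi> x + \<psi> y" if x: "x \<in> S" and y: "y \<in> S" for x y
  proof (rule antisym)
    show "\<psi> x + \<psi> y \<le> \<psi> (x + y)"
    proof (rule field_le_epsilon)
      fix e :: real assume "e > 0"
      then have "(x - (\<psi> x - e / 2) *\<^sub>R u) + (y - (\<psi> y - e / 2) *\<^sub>R u) \<in> P"
        using x y by (intro add lo') auto
      then have "(x + y) - (\<psi> x + \<psi> y - e) *\<^sub>R u \<in> P"
        by (simp add: algebra_simps scaleR_left_distrib[symmetric] del: scaleR_left_distrib)
      from lo[OF this S_add[OF x y]] show "\<psi> x + \<psi> y \<le> \<psi> (x + y) + e" by simp
    qed
    show "\<psi> (x + y) \<le> \<psi> x + \<psi> y"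
    proof (rule field_le_epsilon)
      fix e :: real assume "e > 0"
      then have "((\<psi> x + e / 2) *\<^sub>R u - x) + ((\<psi> y + e / 2) *\<^sub>R u - y) \<in> P"
        using x y by (intro add up') auto
      moreover have "(a *\<^sub>R u - x) + (b *\<^sub>R u - y) = (a + b) *\<^sub>R u - (x + y)" for a b
        by (simp add: algebra_simps)
      ultimately have "(\<psi> x + \<psi> y + e) *\<^sub>R u - (x + y) \<in> P"
        by (metis (no_types, lifting) add.commute add.left_commute field_sum_of_halves)
      from up[OF this S_add[OF x y]] show "\<psi> (x + y) \<le> \<psi> x + \<psi> y + e" by simp
    qed
  qed
  have \<psi>_pos: "\<psi> (t *\<^sub>R x) = t * \<psi> x" if x: "x \<in> S" and t: "0 < t" for x t
  proof (rule antisym)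
    show "t * \<psi> x \<le> \<psi> (t *\<^sub>R x)"
    proof (rule field_le_epsilon)
      fix e :: real assume "e > 0"
      then have "t *\<^sub>R (x - (\<psi> x - e / t) *\<^sub>R u) \<in> P"
        using x t by (intro scale lo') auto
      then have "t *\<^sub>R x - (t * \<psi> x - e) *\<^sub>R u \<in> P"
        using t by (simp add: algebra_simps)
      from lo[OF this S_pos[OF x]] t show "t * \<psi> x \<le> \<psi> (t *\<^sub>R x) + e" by simp
    qed
    show "\<psi> (t *\<^sub>R x) \<le> t * \<psi> x"
    proof (rule field_le_epsilon)
      fix e :: real assume "e > 0"
      then have "t *\<^sub>R ((\<psi> x + e / t) *\<^sub>R u - x) \<in> P"
        using x t by (intro scale up') auto
      then have "(t * \<psi> x + e) *\<^sub>R u - t *\<^sub>R x \<in> P"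
        using t by (simp add: algebra_simps)
      from up[OF this S_pos[OF x]] t show "\<psi> (t *\<^sub>R x) \<le> t * \<psi> x + e" by simp
    qed
  qed
  have S0: "0 \<in> S" using u(1) P0_scale[of 0 u] by (auto simp: S_def intro: exI[of _ 0])
  have \<psi>0: "\<psi> 0 = 0" using \<psi>_add[OF S0 S0] by simp
  have \<psi>_neg: "\<psi> (- x) = - \<psi> x" if "x \<in> S" for x
    using \<psi>_add[OF that S_neg[OF that]] \<psi>0 by simp
  have uS: "u \<in> S"
  proof -
    have "1 *\<^sub>R u - u \<in> P0" "1 *\<^sub>R u + u \<in> P0"
      using P0_scale[of 0 u] P0_add[OF u(1) u(1)] u(1) by auto
    then show ?thesis unfolding S_def by blast
  qed
  show thesis
  proof (rule that)
    show "\<psi> (x + y) = \<psi> x + \<psi> y" if "x \<in> S" "y \<in> S" for x y by (rule \<psi>_add[OF that])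
    show "\<psi> (t *\<^sub>R x) = t * \<psi> x" if x: "x \<in> S" for t x
    proof (cases t "0::real" rule: linorder_cases)
      case less
      have "\<psi> ((- t) *\<^sub>R (- x)) = (- t) * \<psi> (- x)" using less by (intro \<psi>_pos S_neg x) auto
      then show ?thesis using \<psi>_neg[OF x] by simp
    qed (use \<psi>0 \<psi>_pos[OF x] in auto)
    show "0 \<le> \<psi> x" if "x \<in> S" "x \<in> P0" for x using lo[of x 0] that sub by auto
    show "\<psi> u = 1" 
      using lo[of u 1] up[of 1 u] zero uS by simp
  qed
qed

text \<open>The representing vector minimizes |y|^2/2 - f y. The parallelogram identity makes
  minimizing sequences Cauchy, and stationarity at the minimum is the representation
  formula.\<close>

lemma riesz_representation:
  fixes f :: "'a::{real_inner, complete_space} \<Rightarrow> real"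
  assumes "bounded_linear f"
  obtains v where "\<And>y. f y = v \<bullet> y"
proof -
  interpret f: bounded_linear f by fact
  obtain K where K: "\<And>x. \<bar>f x\<bar> \<le> norm x * K" using f.bounded by auto
  define J where "J y = (norm y)\<^sup>2 / 2 - f y" for y
  have low: "- (K\<^sup>2) / 2 \<le> J y" for y
  proof -
    have "f y \<le> norm y * K" using K[of y] by simp
    also have "\<dots> \<le> (norm y)\<^sup>2 / 2 + K\<^sup>2 / 2"
      using zero_le_power2[of "norm y - K"] by (simp add: power2_eq_square algebra_simps)
    finally show ?thesis by (simp add: J_def)
  qed
  define m where "m = Inf (range J)"
  have bdd: "bdd_below (range J)" using low by (auto intro!: bdd_belowI)
  have m: "m \<le> J y" for y unfolding m_def using bdd by (intro cInf_lower) auto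
  have "\<exists>y. J y < m + 1 / real (Suc n)" for n
  proof -
    have "Inf (range J) < m + 1 / real (Suc n)" by (simp add: m_def)
    then show ?thesis by (subst (asm) cInf_less_iff) (auto simp: bdd)
  qed
  then obtain X where X: "\<And>n. J (X n) < m + 1 / real (Suc n)" by metis
  have par: "(norm (x - y))\<^sup>2 \<le> 4 * (J x + J y - 2 * m)" for x y
  proof -
    have "J x + J y - 2 * J ((1/2) *\<^sub>R (x + y)) = (norm (x - y))\<^sup>2 / 4"
      unfolding J_def power2_norm_eq_inner f.scaleR f.add by (simp add: inner_simps inner_commute field_simps)
    then show ?thesis using m[of "(1/2) *\<^sub>R (x + y)"] by simp
  qed
  have "Cauchy X"
  proof (rule CauchyI)
    fix e :: real assume e: "e > 0"
    obtain N where N: "8 / e\<^sup>2 < real N" using reals_Archimedean2 by blast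
    have "norm (X i - X j) < e" if "N \<le> i" "N \<le> j" for i j
    proof -
      have inv: "1 / real (Suc k) \<le> 1 / real (Suc N)" if "N \<le> k" for k
        using that by (intro divide_left_mono) auto
      have "(norm (X i - X j))\<^sup>2 \<le> 4 * (J (X i) + J (X j) - 2 * m)" by (rule par)
      also have "\<dots> < 8 / real (Suc N)"
        using X[of i] X[of j] inv[OF that(1)] inv[OF that(2)] by simp
      also have "8 / real (Suc N) < e\<^sup>2"
        using N e by (simp add: field_simps) (smt (verit) zero_less_power)
      finally show ?thesis using e by (simp add: power_less_imp_less_base)
    qed
    then show "\<exists>M. \<forall>i\<ge>M. \<forall>j\<ge>M. norm (X i - X j) < e" by blast
  qed
  then obtain v where v: "X \<longlonglongrightarrow> v" using Cauchy_convergent convergent_def by blast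
  have "(\<lambda>n. J (X n)) \<longlonglongrightarrow> J v"
    unfolding J_def by (intro tendsto_intros f.tendsto v) auto
  moreover have "(\<lambda>n. m + 1 / real (Suc n)) \<longlonglongrightarrow> m + 0"
    by (intro tendsto_intros LIMSEQ_Suc[OF lim_1_over_n])
  ultimately have "J v \<le> m + 0"
    by (rule LIMSEQ_le) (use X less_imp_le in blast)
  then have min: "J v \<le> J y" for y using m[of y] by simp
  have "f y = v \<bullet> y" for y
  proof -
    define a where "a = v \<bullet> y - f y"
    have q: "0 \<le> t * a + t\<^sup>2 * (norm y)\<^sup>2 / 2" for t
    proof -
      have "J (v + t *\<^sub>R y) - J v = t * a + t\<^sup>2 * (norm y)\<^sup>2 / 2"
        unfolding J_def a_def power2_norm_eq_inner f.scaleR f.add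
        by (simp add: inner_simps inner_commute power2_eq_square field_simps)
      then show ?thesis using min[of "v + t *\<^sub>R y"] by simp
    qed
    \<comment> \<open>The step t = - a / b would lower the functional unless a = 0; the summand 1
      avoids division by zero.\<close>
    define b where "b = (norm y)\<^sup>2 + 1"
    have b: "0 < b" "(norm y)\<^sup>2 \<le> b" by (auto simp: b_def add_nonneg_pos)
    have "0 \<le> (- a / b) * a + (- a / b)\<^sup>2 * (norm y)\<^sup>2 / 2" by (rule q)
    also have "\<dots> \<le> (- a / b) * a + (- a / b)\<^sup>2 * b / 2"
      using b by (intro add_left_mono divide_right_mono mult_left_mono) auto
    also have "\<dots> = - (a\<^sup>2) / (2 * b)"
      using b by (simp add: power2_eq_square field_simps)
    finally have "a\<^sup>2 \<le> 0" using b by (simp add: field_simps)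
    then show ?thesis by (simp add: a_def)
  qed
  then show thesis by (rule that)
qed

section \<open>Almost invariant families\<close>

text \<open>The trace of the covariance operator, which is the total variance of the Gaussian
  vector.\<close>

definition tr :: "'a::real_inner list \<Rightarrow> real" where
  "tr xs = (\<Sum>x\<leftarrow>xs. (norm x)\<^sup>2)"

lemma tr_simps [simp]:
  "tr [] = 0" "tr (x # xs) = (norm x)\<^sup>2 + tr xs" "tr (xs @ ys) = tr xs + tr ys"
  by (auto simp: tr_def)

lemma tr_scaleR: "tr (map ((*\<^sub>R) c) xs) = c\<^sup>2 * tr xs"
  by (induction xs) (auto simp: power_mult_distrib algebra_simps)

lemma frame_scaleR: "frame (map ((*\<^sub>R) c) xs) h k = c\<^sup>2 * frame xs h k"
  by (induction xs) (auto simp: power2_eq_square algebra_simps)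

lemma tr_nonneg: "0 \<le> tr xs"
  by (induction xs) auto

text \<open>If no almost invariant family exists, the Riesz extension theorem yields quadratic forms \<open>b T\<close>
  whose displacement under \<open>F\<close> is bounded below on all spread-out families.\<close>

lemma dual_forms_of_not_almost_invariant:
  fixes F :: "('a::real_inner \<Rightarrow> 'a) set"
  assumes F: "finite F" "F \<noteq> {}" "\<And>T. T \<in> F \<Longrightarrow> linear T" and nontriv: "\<exists>x::'a. x \<noteq> 0" and \<delta>: "\<delta> > 0"
    and neg: "\<nexists>xs. almost_invariant F \<delta> xs"
  obtains b :: "('a \<Rightarrow> 'a) \<Rightarrow> 'a \<Rightarrow> 'a \<Rightarrow> real" where
    "\<And>T x y. T \<in> F \<Longrightarrow> b T x y = b T y x"
    "\<And>T x y z. T \<in> F \<Longrightarrow> b T (x + y) z = b T x z + b T y z"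
    "\<And>T x y c. T \<in> F \<Longrightarrow> b T (c *\<^sub>R x) y = c * b T x y"
    "\<And>T x y. T \<in> F \<Longrightarrow> \<bar>b T x y\<bar> \<le> ((norm x)\<^sup>2 + (norm y)\<^sup>2) / 2"
    "\<And>xs. (\<And>p. frame xs p p \<le> \<delta> * tr xs * (norm p)\<^sup>2) \<Longrightarrow>
       \<delta> * tr xs \<le> (\<Sum>x\<leftarrow>xs. \<Sum>T\<in>F. b T (T x) (T x) - b T x x)"
proof -
  define good where "good xs \<longleftrightarrow> (\<forall>p. frame xs p p \<le> \<delta> * tr xs * (norm p)\<^sup>2)" for xs :: "'a list"
  \<comment> \<open>First entry: the cost of the corrections minus \<delta> times the trace of xs.
    Second entry: for each T, the defect of invariance after the corrections R T and R' T. Second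
    entry zero with negative first entry would mean an almost invariant family up to
    scaling.\<close>
  define el where "el xs R R' = ((\<Sum>T\<in>F. tr (R T) + tr (R' T)) - \<delta> * tr xs,
      (\<lambda>(T, h). if T \<in> F then frame (map T xs) h h - frame xs h h + frame (R T) h h - frame (R' T) h h else 0))"
    for xs and R R' :: "('a \<Rightarrow> 'a) \<Rightarrow> 'a list"
  define P0 where "P0 = {el xs R R' | xs R R'. good xs}"
  define u :: "real \<times> (('a \<Rightarrow> 'a) \<times> 'a \<Rightarrow> real)" where "u = (1, 0)"
  define S where "S = {x. \<exists>t. t *\<^sub>R u - x \<in> P0 \<and> t *\<^sub>R u + x \<in> P0}"
  have good_Nil: "good []" by (simp add: good_def)
  have P0_add: "x + y \<in> P0" if xy: "x \<in> P0" "y \<in> P0" for x y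
  proof -
    obtain xs R R' ys Q Q' where e: "x = el xs R R'" "good xs" "y = el ys Q Q'" "good ys"
      using xy by (auto simp: P0_def)
    have "x + y = el (xs @ ys) (\<lambda>T. R T @ Q T) (\<lambda>T. R' T @ Q' T)"
      unfolding e el_def by (auto simp: plus_fun_def sum.distrib algebra_simps)
    moreover have "good (xs @ ys)"
      using e(2,4) unfolding good_def by (auto simp: algebra_simps intro!: add_mono)
    ultimately show ?thesis unfolding P0_def by blast
  qed
  have P0_scale: "t *\<^sub>R x \<in> P0" if t: "0 \<le> t" and x: "x \<in> P0" for t x
  proof -
    obtain xs R R' where e: "x = el xs R R'" "good xs"
      using x by (auto simp: P0_def)
    let ?s = "map ((*\<^sub>R) (sqrt t))"
    have comp: "map T (?s xs) = ?s (map T xs)" if "T \<in> F" for T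
      using F(3)[OF that] by (auto simp: linear_cmul)
    have "t *\<^sub>R x = el (?s xs) (\<lambda>T. ?s (R T)) (\<lambda>T. ?s (R' T))"
      unfolding e el_def using t
      by (auto intro!: ext simp: comp frame_scaleR tr_scaleR sum_distrib_left algebra_simps simp del: map_map)
    moreover have "good (?s xs)"
      using e(2) t unfolding good_def frame_scaleR tr_scaleR
      by (auto simp: mult.left_commute[of _ t] mult.assoc intro!: mult_left_mono)
    ultimately show ?thesis unfolding P0_def by blast
  qed
  \<comment> \<open>One-vector corrections produce rank-one forms in the slot of T. By polarization
    \<open>e T x y\<close> is then dominated by a multiple of u, which will bound the dual
    forms.\<close>
  define single where "single T x = (\<lambda>T'. if T' = T then [x] else [])" for T :: "'a \<Rightarrow> 'a" and x :: 'a
  define e where "e T x y = (0::real, \<lambda>(T', h). if T' = T then (h \<bullet> x) * (h \<bullet> y) else 0)"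
    for T :: "'a \<Rightarrow> 'a" and x y :: 'a
  have el_single: "el [] (single T x) (single T y) = ((norm x)\<^sup>2 + (norm y)\<^sup>2, snd (e T x x) - snd (e T y y))" if "T \<in> F" for T x y
  proof -
    have "(\<Sum>T'\<in>F. tr (single T x T') + tr (single T y T')) = (norm x)\<^sup>2 + (norm y)\<^sup>2"
    proof -
      have "(\<Sum>T'\<in>F. tr (single T x T') + tr (single T y T')) = (\<Sum>T'\<in>F. if T' = T then (norm x)\<^sup>2 + (norm y)\<^sup>2 else 0)"
        by (intro sum.cong) (auto simp: single_def)
      then show ?thesis using that F(1) by simp
    qed
    then show ?thesis
      using that unfolding el_def by (auto intro!: ext simp: single_def e_def)
  qed
  have uP: "u \<in> P0"
  proof -
    obtain x0 :: 'a where x0: "x0 \<noteq> 0" using nontriv by blast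
    obtain T where T: "T \<in> F" using F(2) by blast
    \<comment> \<open>Equal corrections on both sides cancel in the second entry, and squared norm
      1/2 makes their joint cost exactly 1.\<close>
    define r where "r = (1 / (sqrt 2 * norm x0)) *\<^sub>R x0"
    have "(norm r)\<^sup>2 = 1 / 2" using x0 by (simp add: r_def power_mult_distrib power_divide)
    then have "u = el [] (single T r) (single T r)"
      unfolding el_single[OF T] by (auto simp: u_def zero_fun_def)
    then show ?thesis using good_Nil unfolding P0_def by blast
  qed
  \<comment> \<open>Here the absence of almost invariant families enters: scaling xs to trace one
    would turn - u into such a family, with R' T and R T as its corrections.\<close>
  have nu: "- u \<notin> P0"
  proof
    assume "- u \<in> P0"
    then obtain xs R R' where el: "- u = el xs R R'" and xs: "good xs" by (auto simp: P0_def)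
    from el have t: "(\<Sum>T\<in>F. tr (R T) + tr (R' T)) = \<delta> * tr xs - 1"
      unfolding u_def el_def by auto
    have fr: "frame (map T xs) h h - frame xs h h + frame (R T) h h - frame (R' T) h h = 0" if "T \<in> F" for T h
    proof -
      have "snd (- u) (T, h) = snd (el xs R R') (T, h)" using el by simp
      then show ?thesis using that unfolding u_def el_def by simp
    qed
    have "0 \<le> (\<Sum>T\<in>F. tr (R T) + tr (R' T))" by (intro sum_nonneg add_nonneg_nonneg tr_nonneg)
    then have d: "1 \<le> \<delta> * tr xs" using t by simp
    then have pos: "tr xs > 0" using \<delta> by (metis less_le_trans zero_less_mult_pos zero_less_one)
    define c where "c = 1 / sqrt (tr xs)"
    have c2: "c\<^sup>2 = 1 / tr xs" using pos by (simp add: c_def power_divide)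
    let ?s = "map ((*\<^sub>R) c)"
    have small: "tr (?s (R T)) \<le> \<delta> \<and> tr (?s (R' T)) \<le> \<delta>" if "T \<in> F" for T
    proof -
      have "tr (R T) + tr (R' T) \<le> (\<Sum>T\<in>F. tr (R T) + tr (R' T))"
        using that F(1) by (intro member_le_sum add_nonneg_nonneg tr_nonneg)
      then have "tr (R T) + tr (R' T) \<le> \<delta> * tr xs" using t by simp
      then have "tr (R T) \<le> \<delta> * tr xs" "tr (R' T) \<le> \<delta> * tr xs"
        using tr_nonneg[of "R T"] tr_nonneg[of "R' T"] by linarith+
      then show ?thesis unfolding tr_scaleR c2 using pos by (simp add: field_simps)
    qed
    have "almost_invariant F \<delta> (?s xs)"
      unfolding almost_invariant_def tr_def[symmetric]
    proof (intro conjI ballI allI)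
      show "tr (?s xs) = 1" using pos by (simp add: tr_scaleR c2)
      show "(\<Sum>x\<leftarrow>?s xs. (p \<bullet> x)\<^sup>2) \<le> \<delta> * (norm p)\<^sup>2" for p
      proof -
        have "(\<Sum>x\<leftarrow>?s xs. (p \<bullet> x)\<^sup>2) = frame (?s xs) p p"
          by (simp add: frame_def power2_eq_square)
        also have "\<dots> = 1 / tr xs * frame xs p p" by (simp add: frame_scaleR c2)
        also have "\<dots> \<le> 1 / tr xs * (\<delta> * tr xs * (norm p)\<^sup>2)"
          using xs pos unfolding good_def by (intro mult_left_mono) auto
        finally show ?thesis using pos by simp
      qed
      fix T assume T: "T \<in> F"
      have comp: "map T (?s xs) = ?s (map T xs)"
        using F(3)[OF T] by (auto simp: linear_cmul)
      have "frame (?s xs @ ?s (R' T)) h h = frame (map T (?s xs) @ ?s (R T)) h h" for h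
      proof -
        have "frame xs h h + frame (R' T) h h = frame (map T xs) h h + frame (R T) h h"
          using fr[OF T, of h] by simp
        then have "c\<^sup>2 * (frame xs h h + frame (R' T) h h) = c\<^sup>2 * (frame (map T xs) h h + frame (R T) h h)"
          by simp
        then show ?thesis
          unfolding comp frame_simps frame_scaleR distrib_left .
      qed
      then show "\<exists>rs rs'. tr rs \<le> \<delta> \<and> tr rs' \<le> \<delta> \<and> (\<forall>h. frame (?s xs @ rs) h h = frame (map T (?s xs) @ rs') h h)"
        using small[OF T] by blast
    qed
    then show False using neg by blast
  qed
  obtain \<psi> where \<psi>_add: "\<And>x y. x \<in> S \<Longrightarrow> y \<in> S \<Longrightarrow> \<psi> (x + y) = \<psi> x + \<psi> y"
    and \<psi>_scale: "\<And>t x. x \<in> S \<Longrightarrow> \<psi> (t *\<^sub>R x) = t * \<psi> x"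
    and \<psi>_pos: "\<And>x. x \<in> S \<Longrightarrow> x \<in> P0 \<Longrightarrow> 0 \<le> \<psi> x" and \<psi>_u: "\<psi> u = (1::real)"
    using cone_extension[OF P0_add P0_scale uP nu] unfolding S_def by blast
  have S_I: "x \<in> S" if "t *\<^sub>R u - x \<in> P0" "t *\<^sub>R u + x \<in> P0" for t x
    using that unfolding S_def by blast
  have S_add: "x + y \<in> S" if "x \<in> S" "y \<in> S" for x y
  proof -
    obtain s t where "s *\<^sub>R u - x \<in> P0" "s *\<^sub>R u + x \<in> P0" "t *\<^sub>R u - y \<in> P0" "t *\<^sub>R u + y \<in> P0"
      using \<open>x \<in> S\<close> \<open>y \<in> S\<close> by (auto simp: S_def)
    then have "(s *\<^sub>R u - x) + (t *\<^sub>R u - y) \<in> P0" "(s *\<^sub>R u + x) + (t *\<^sub>R u + y) \<in> P0" by (auto intro: P0_add)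
    then show ?thesis by (intro S_I[of "s + t"]) (simp_all add: algebra_simps)
  qed
  have S_scale: "t *\<^sub>R x \<in> S" if x: "x \<in> S" for t x
  proof -
    obtain s where s: "s *\<^sub>R u - x \<in> P0" "s *\<^sub>R u + x \<in> P0" using x by (auto simp: S_def)
    have 1: "\<bar>t\<bar> *\<^sub>R (s *\<^sub>R u - x) \<in> P0" "\<bar>t\<bar> *\<^sub>R (s *\<^sub>R u + x) \<in> P0" using P0_scale[OF abs_ge_zero[of t]] s by blast+
    have 2: "(\<bar>t\<bar> * s) *\<^sub>R u - \<bar>t\<bar> *\<^sub>R x \<in> P0" "(\<bar>t\<bar> * s) *\<^sub>R u + \<bar>t\<bar> *\<^sub>R x \<in> P0"
      using 1 by (simp_all only: scaleR_diff_right scaleR_add_right scaleR_scaleR)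
    show ?thesis
    proof (cases "0 \<le> t")
      case True
      with 2 show ?thesis by (intro S_I[of "\<bar>t\<bar> * s"]) simp_all
    next
      case False
      then have "\<bar>t\<bar> *\<^sub>R x = - (t *\<^sub>R x)" by simp
      with 2 show ?thesis by (intro S_I[of "\<bar>t\<bar> * s"]) simp_all
    qed
  qed
  have u0: "t *\<^sub>R u + (0, z) = (t, z)" "t *\<^sub>R u - (0, z) = (t, - z)" for t z
    by (simp_all add: u_def)
  have e_P0: "(((norm x)\<^sup>2 + (norm y)\<^sup>2) / 2) *\<^sub>R u + e T x y \<in> P0"
    "(((norm x)\<^sup>2 + (norm y)\<^sup>2) / 2) *\<^sub>R u - e T x y \<in> P0" if T: "T \<in> F" for T x y
  proof -
    let ?p = "(1/2) *\<^sub>R (x + y)" and ?m = "(1/2) *\<^sub>R (x - y)"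
    have n: "(norm ?p)\<^sup>2 + (norm ?m)\<^sup>2 = ((norm x)\<^sup>2 + (norm y)\<^sup>2) / 2"
      unfolding power2_norm_eq_inner by (simp add: inner_simps inner_commute field_simps)
    have z: "snd (e T ?p ?p) - snd (e T ?m ?m) = snd (e T x y)"
      by (auto intro!: ext simp: e_def inner_simps field_simps)
    have e0: "e T x y = (0, snd (e T x y))" by (simp add: e_def)
    have "(((norm x)\<^sup>2 + (norm y)\<^sup>2) / 2) *\<^sub>R u + e T x y = el [] (single T ?p) (single T ?m)"
      unfolding el_single[OF T] n z by (subst e0) (simp only: u0)
    then show "(((norm x)\<^sup>2 + (norm y)\<^sup>2) / 2) *\<^sub>R u + e T x y \<in> P0"
      using good_Nil unfolding P0_def by blast
    have "(((norm x)\<^sup>2 + (norm y)\<^sup>2) / 2) *\<^sub>R u - e T x y = el [] (single T ?m) (single T ?p)"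
    proof -
      have n': "(norm ?m)\<^sup>2 + (norm ?p)\<^sup>2 = ((norm x)\<^sup>2 + (norm y)\<^sup>2) / 2"
        by (subst add.commute) (rule n)
      have z': "snd (e T ?m ?m) - snd (e T ?p ?p) = - snd (e T x y)"
        unfolding z[symmetric] by (rule minus_diff_eq[symmetric])
      show ?thesis
        unfolding el_single[OF T] n' z' by (subst e0) (simp only: u0)
    qed
    then show "(((norm x)\<^sup>2 + (norm y)\<^sup>2) / 2) *\<^sub>R u - e T x y \<in> P0"
      using good_Nil unfolding P0_def by blast
  qed
  have e_S: "e T x y \<in> S" if "T \<in> F" for T x y
    using e_P0[OF that] by (intro S_I)
  have uS: "u \<in> S"
  proof (rule S_I[of 1])
    show "1 *\<^sub>R u - u \<in> P0" using P0_scale[OF order_refl uP] by simp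
    show "1 *\<^sub>R u + u \<in> P0" using P0_add[OF uP uP] by simp
  qed
  define b where "b T x y = \<psi> (e T x y)" for T x y
  show thesis
  proof (rule that[of b])
    fix T x y z and c :: real assume T: "T \<in> F"
    have "e T x y = e T y x" by (auto intro!: ext simp: e_def)
    then show "b T x y = b T y x" by (simp add: b_def)
    have "e T (x + y) z = e T x z + e T y z" by (auto intro!: ext simp: e_def inner_simps algebra_simps)
    then show "b T (x + y) z = b T x z + b T y z" by (simp add: b_def \<psi>_add e_S[OF T])
    have "e T (c *\<^sub>R x) y = c *\<^sub>R e T x y" by (auto intro!: ext simp: e_def)
    then show "b T (c *\<^sub>R x) y = c * b T x y" by (simp add: b_def \<psi>_scale e_S[OF T])
    let ?n = "((norm x)\<^sup>2 + (norm y)\<^sup>2) / 2"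
    have "0 \<le> \<psi> (?n *\<^sub>R u + e T x y)"
      by (intro \<psi>_pos e_P0 S_add S_scale uS e_S T)
    then have "0 \<le> ?n + b T x y" by (simp add: b_def \<psi>_add \<psi>_scale S_scale uS e_S[OF T] \<psi>_u)
    moreover have "0 \<le> \<psi> (?n *\<^sub>R u + (- 1) *\<^sub>R e T x y)"
      using e_P0(2)[OF T] by (intro \<psi>_pos S_add S_scale uS e_S T) simp
    then have "0 \<le> ?n + (- 1) * b T x y"
      unfolding b_def by (subst (asm) \<psi>_add) (simp_all only: S_scale uS e_S[OF T] \<psi>_scale \<psi>_u mult_1_right)
    ultimately show "\<bar>b T x y\<bar> \<le> ?n" by linarith
  next
    fix xs :: "'a list" assume "\<And>p. frame xs p p \<le> \<delta> * tr xs * (norm p)\<^sup>2"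
    then have g: "good xs" by (simp add: good_def)
    \<comment> \<open>This is the element \<open>el\<close> of the one-vector family [x] without
      corrections, expanded in terms on which \<psi> is known. A single [x] need not be good; only
      the sum over xs has to lie in P0.\<close>
    define v where "v x = (\<Sum>T\<in>F. e T (T x) (T x) + (- 1) *\<^sub>R e T x x) + (- (\<delta> * (norm x)\<^sup>2)) *\<^sub>R u" for x
    have sum: "(\<Sum>T\<in>I. f T) \<in> S \<and> \<psi> (\<Sum>T\<in>I. f T) = (\<Sum>T\<in>I. \<psi> (f T))" if "finite I" "\<And>T. T \<in> I \<Longrightarrow> f T \<in> S" 
      for I :: "('a \<Rightarrow> 'a) set" and f
      using that
    proof (induction I rule: finite_induct)
      case empty
      show ?case using S_scale[OF uS, of 0] \<psi>_scale[OF uS, of 0] by simp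
    qed (auto simp: S_add \<psi>_add)
    have d_S: "e T (T x) (T x) + (- 1) *\<^sub>R e T x x \<in> S" if "T \<in> F" for T x
      by (intro S_add S_scale e_S that)
    have sum_d: "(\<Sum>T\<in>F. e T (T x) (T x) + (- 1) *\<^sub>R e T x x) \<in> S"
      "\<psi> (\<Sum>T\<in>F. e T (T x) (T x) + (- 1) *\<^sub>R e T x x) = (\<Sum>T\<in>F. \<psi> (e T (T x) (T x) + (- 1) *\<^sub>R e T x x))" for x
      using sum[OF F(1), of "\<lambda>T. e T (T x) (T x) + (- 1) *\<^sub>R e T x x", OF d_S] by blast+
    have v_S: "v x \<in> S" for x
      unfolding v_def by (intro S_add S_scale uS sum_d)
    have \<psi>_v: "\<psi> (v x) = (\<Sum>T\<in>F. b T (T x) (T x) - b T x x) - \<delta> * (norm x)\<^sup>2" for x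
    proof -
      have "\<psi> (v x) = \<psi> (\<Sum>T\<in>F. e T (T x) (T x) + (- 1) *\<^sub>R e T x x) + \<psi> ((- (\<delta> * (norm x)\<^sup>2)) *\<^sub>R u)"
        unfolding v_def by (intro \<psi>_add S_scale uS sum_d)
      also have "\<psi> ((- (\<delta> * (norm x)\<^sup>2)) *\<^sub>R u) = - (\<delta> * (norm x)\<^sup>2)" by (simp only: \<psi>_scale[OF uS] \<psi>_u mult_1_right)
      also have "\<psi> (\<Sum>T\<in>F. e T (T x) (T x) + (- 1) *\<^sub>R e T x x) = (\<Sum>T\<in>F. \<psi> (e T (T x) (T x) + (- 1) *\<^sub>R e T x x))"
        by (rule sum_d)
      also have "\<dots> = (\<Sum>T\<in>F. b T (T x) (T x) - b T x x)"
      proof (rule sum.cong[OF refl])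
        fix T assume T: "T \<in> F"
        have "\<psi> (e T (T x) (T x) + (- 1) *\<^sub>R e T x x) = \<psi> (e T (T x) (T x)) + (- 1) * \<psi> (e T x x)"
          by (simp only: \<psi>_add[OF e_S[OF T] S_scale[OF e_S[OF T]]] \<psi>_scale[OF e_S[OF T]])
        then show "\<psi> (e T (T x) (T x) + (- 1) *\<^sub>R e T x x) = b T (T x) (T x) - b T x x"
          by (simp add: b_def)
      qed
      finally show ?thesis by simp
    qed
    have total: "(\<Sum>x\<leftarrow>ys. v x) \<in> S \<and> \<psi> (\<Sum>x\<leftarrow>ys. v x) = (\<Sum>x\<leftarrow>ys. \<psi> (v x))" for ys
      using S_scale[OF uS, of 0] \<psi>_scale[OF uS, of 0]
      by (induction ys) (auto simp: S_add \<psi>_add v_S)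
    have v_el: "v x = (- (\<delta> * (norm x)\<^sup>2), \<lambda>(T, h). if T \<in> F then (h \<bullet> T x)\<^sup>2 - (h \<bullet> x)\<^sup>2 else 0)" for x
    proof -
      have "(\<Sum>T\<in>I. e T (T x) (T x) + (- 1) *\<^sub>R e T x x) = (0, \<lambda>(T, h). if T \<in> I then (h \<bullet> T x)\<^sup>2 - (h \<bullet> x)\<^sup>2 else 0)"
        if "finite I" for I
        using that by (induction I rule: finite_induct) (auto intro!: ext simp: e_def zero_prod_def power2_eq_square)
      from this[OF F(1)] show ?thesis unfolding v_def by (simp add: u_def)
    qed
    have "(\<Sum>x\<leftarrow>ys. v x) = el ys (\<lambda>_. []) (\<lambda>_. [])" for ys
    proof (induction ys)
      case Nil
      then show ?case by (auto intro!: ext simp: el_def zero_prod_def)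
    next
      case (Cons y ys)
      then show ?case by (auto intro!: ext simp: v_el el_def power2_eq_square algebra_simps)
    qed
    then have "(\<Sum>x\<leftarrow>xs. v x) \<in> P0" using g unfolding P0_def by blast
    then have "0 \<le> (\<Sum>x\<leftarrow>xs. \<psi> (v x))" using total[of xs] \<psi>_pos by metis
    also have "\<dots> = (\<Sum>x\<leftarrow>xs. \<Sum>T\<in>F. b T (T x) (T x) - b T x x) - \<delta> * tr xs"
      unfolding \<psi>_v by (induction xs) (auto simp: algebra_simps)
    finally show "\<delta> * tr xs \<le> (\<Sum>x\<leftarrow>xs. \<Sum>T\<in>F. b T (T x) (T x) - b T x x)" by simp
  qed
qed

section \<open>Orthonormal lists and projections\<close>

primrec orthonormal :: "'a::real_inner list \<Rightarrow> bool" where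
  "orthonormal [] \<longleftrightarrow> True"
| "orthonormal (e # es) \<longleftrightarrow> norm e = 1 \<and> (\<forall>f\<in>set es. e \<bullet> f = 0) \<and> orthonormal es"

definition proj :: "'a::real_inner list \<Rightarrow> 'a \<Rightarrow> 'a" where
  "proj es x = (\<Sum>e\<leftarrow>es. (x \<bullet> e) *\<^sub>R e)"

lemma proj_simps [simp]: "proj [] x = 0" "proj (e # es) x = (x \<bullet> e) *\<^sub>R e + proj es x"
  by (auto simp: proj_def)

lemma proj_orthogonal: "(\<And>e. e \<in> set es \<Longrightarrow> e \<bullet> y = 0) \<Longrightarrow> proj es x \<bullet> y = 0"
  by (induction es) (auto simp: inner_simps)

lemma proj_eq_0: "(\<And>e. e \<in> set es \<Longrightarrow> x \<bullet> e = 0) \<Longrightarrow> proj es x = 0"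
  by (induction es) auto

lemma proj_inner_basis: "orthonormal es \<Longrightarrow> e \<in> set es \<Longrightarrow> proj es x \<bullet> e = x \<bullet> e"
proof (induction es)
  case (Cons f es)
  show ?case
  proof (cases "e = f")
    case True
    have "proj es x \<bullet> f = 0" using Cons.prems(1) by (intro proj_orthogonal) (auto simp: inner_commute)
    then show ?thesis using True Cons.prems(1) by (simp add: inner_simps norm_eq_1)
  next
    case False
    then show ?thesis using Cons by (auto simp: inner_simps)
  qed
qed simp

lemma proj_in_span: "proj es x \<in> span (set es)"
proof (induction es)
  case (Cons e es)
  moreover have "span (set es) \<subseteq> span (set (e # es))" by (rule span_mono) auto
  ultimately have "proj es x \<in> span (set (e # es))" by blast
  moreover have "(x \<bullet> e) *\<^sub>R e \<in> span (set (e # es))" by (intro span_scale span_base) simp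
  ultimately show ?case unfolding proj_simps by (intro span_add)
qed (simp add: span_zero)

lemma proj_add: "proj es (x + y) = proj es x + proj es y"
  by (induction es) (auto simp: inner_simps algebra_simps)

lemma proj_scaleR: "proj es (c *\<^sub>R x) = c *\<^sub>R proj es x"
  by (induction es) (auto simp: algebra_simps)

lemma linear_proj: "linear (proj es)"
  by (rule linearI) (auto simp: proj_add proj_scaleR)

lemma orthogonal_span_eq_0:
  assumes "x \<in> span (set es)" "\<And>e. e \<in> set es \<Longrightarrow> x \<bullet> e = 0" shows "x = 0"
proof -
  have "orthogonal x x"
    by (rule orthogonal_to_span[OF assms(1)]) (use assms(2) in \<open>auto simp: orthogonal_def\<close>)
  then show ?thesis by (simp add: orthogonal_def)
qed

lemma proj_fixes_span:
  assumes "orthonormal es" "x \<in> span (set es)" shows "proj es x = x"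
proof -
  have "x - proj es x = 0"
    using assms by (intro orthogonal_span_eq_0[of _ es] span_diff proj_in_span) (auto simp: inner_simps proj_inner_basis)
  then show ?thesis by simp
qed

lemma inner_proj: "proj es x \<bullet> y = (\<Sum>e\<leftarrow>es. (x \<bullet> e) * (y \<bullet> e))"
  by (induction es) (auto simp: inner_simps inner_commute)

lemma norm_proj: "orthonormal es \<Longrightarrow> (norm (proj es x))\<^sup>2 = frame es x x"
  using proj_inner_basis[of es _ x]
  by (simp add: power2_norm_eq_inner inner_proj frame_def cong: map_cong)

lemma pythagoras_proj: 
  assumes "orthonormal es" shows "(norm x)\<^sup>2 = (norm (proj es x))\<^sup>2 + (norm (x - proj es x))\<^sup>2"
proof -
  have "proj es x \<bullet> (x - proj es x) = 0"
    by (rule proj_orthogonal) (use assms in \<open>auto simp: inner_simps inner_commute[of _ x] inner_commute[of _ "proj es x"] proj_inner_basis\<close>)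
  then have "(norm (proj es x + (x - proj es x)))\<^sup>2 = (norm (proj es x))\<^sup>2 + (norm (x - proj es x))\<^sup>2"
    unfolding power2_norm_eq_inner inner_add_left inner_add_right by (simp add: inner_commute)
  then show ?thesis by simp
qed

lemma bessel: "orthonormal es \<Longrightarrow> frame es x x \<le> (norm x)\<^sup>2"
  using pythagoras_proj[of es x] norm_proj[of es x] by simp

lemma tr_orthonormal: "orthonormal es \<Longrightarrow> tr es = real (length es)"
  by (induction es) auto

lemma orthonormal_Cons_normalized:
  assumes "orthonormal es" "x \<noteq> 0" "\<And>e. e \<in> set es \<Longrightarrow> x \<bullet> e = 0"
  shows "orthonormal ((x /\<^sub>R norm x) # es)"
  using assms by auto

section \<open>From dual forms to operators, and the separation argument\<close>

lemma operator_of_form: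
  fixes \<beta> :: "'a::{real_inner, complete_space} \<Rightarrow> 'a \<Rightarrow> real"
  assumes sym: "\<And>x y. \<beta> x y = \<beta> y x" and add: "\<And>x y z. \<beta> (x + y) z = \<beta> x z + \<beta> y z"
    and scale: "\<And>c x y. \<beta> (c *\<^sub>R x) y = c * \<beta> x y" and bound: "\<And>x y. \<bar>\<beta> x y\<bar> \<le> K * norm x * norm y"
  obtains B :: "'a \<Rightarrow>\<^sub>L 'a" where "\<And>x y. B x \<bullet> y = \<beta> x y"
proof -
  have "\<exists>v. \<forall>y. \<beta> x y = v \<bullet> y" for x
  proof -
    have "bounded_linear (\<beta> x)"
    proof (rule bounded_linear_intro)
      show "\<beta> x (y + z) = \<beta> x y + \<beta> x z" for y z using add[of y z x] by (simp add: sym)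
      show "\<beta> x (c *\<^sub>R y) = c *\<^sub>R \<beta> x y" for c y using scale[of c y x] by (simp add: sym)
      show "norm (\<beta> x y) \<le> norm y * (K * norm x)" for y using bound[of x y] by (simp add: mult_ac)
    qed
    then show ?thesis by (metis riesz_representation)
  qed
  then obtain f where f: "\<And>x y. \<beta> x y = f x \<bullet> y" by metis
  have eqI: "v = w" if "\<And>y. v \<bullet> y = w \<bullet> y" for v w :: 'a
  proof -
    have "(v - w) \<bullet> (v - w) = 0" using that[of "v - w"] by (simp add: inner_diff_left)
    then show ?thesis by simp
  qed
  have "bounded_linear f"
  proof (rule bounded_linear_intro)
    show "f (x + y) = f x + f y" for x y by (rule eqI) (simp add: inner_add_left f[symmetric] add)
    show "f (c *\<^sub>R x) = c *\<^sub>R f x" for c x by (rule eqI) (simp add: f[symmetric] scale)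
    show "norm (f x) \<le> norm x * K" for x
    proof (cases "f x = 0")
      case True
      have "0 \<le> K * norm x * norm x" using bound[of x x] by linarith
      then have "0 \<le> norm x * K" by (cases "x = 0") (auto simp: zero_le_mult_iff)
      then show ?thesis using True by simp
    next
      case False
      have "norm (f x) * norm (f x) = \<beta> x (f x)" by (simp add: f power2_norm_eq_inner[symmetric] power2_eq_square)
      also have "\<dots> \<le> K * norm x * norm (f x)" using bound[of x "f x"] by linarith
      finally show ?thesis using False by (simp add: mult.commute)
    qed
  qed
  then have "Blinfun f x \<bullet> y = \<beta> x y" for x y by (simp add: bounded_linear_Blinfun_apply f)
  then show thesis by (rule that)
qed

lemma form_bound_scaled:
  fixes \<beta> :: "'a::real_inner \<Rightarrow> 'a \<Rightarrow> real"
  assumes sym: "\<And>x y. \<beta> x y = \<beta> y x" and scale: "\<And>c x y. \<beta> (c *\<^sub>R x) y = c * \<beta> x y"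
    and bound: "\<And>x y. \<bar>\<beta> x y\<bar> \<le> ((norm x)\<^sup>2 + (norm y)\<^sup>2) / 2"
  shows "\<bar>\<beta> x y\<bar> \<le> norm x * norm y"
proof (cases "x = 0 \<or> y = 0")
  case True
  have "\<beta> 0 y = 0" for y using scale[of 0 0 y] by simp
  then show ?thesis using True sym[of x y] by auto
next
  case False
  let ?x = "x /\<^sub>R norm x" and ?y = "y /\<^sub>R norm y"
  have "\<beta> x y = \<beta> (norm x *\<^sub>R ?x) (norm y *\<^sub>R ?y)" using False by simp
  also have "\<dots> = norm x * \<beta> ?x (norm y *\<^sub>R ?y)" by (rule scale)
  also have "\<beta> ?x (norm y *\<^sub>R ?y) = norm y * \<beta> ?x ?y" using scale[of "norm y" ?y ?x] by (simp only: sym[of ?x])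
  finally have e: "\<beta> x y = (norm x * norm y) * \<beta> ?x ?y" by (simp add: mult.assoc)
  have "\<bar>\<beta> ?x ?y\<bar> \<le> 1" using bound[of ?x ?y] False by simp
  then show ?thesis unfolding e abs_mult by (simp add: mult_left_le)
qed

text \<open>The operators representing the dual forms have total displacement \<open>D\<close> with
  \<open>\<omega> D = 0\<close>. But D is at least \<delta> orthogonally to a finite list, and
  adding a multiple of the projection onto its span, where \<omega> vanishes, makes D - \<delta>/2
  positive although \<omega> takes the value -\<delta>/2 there. The dual forms are only real
  bilinear, hence a functional on real operators.\<close>

lemma almost_invariant_of_state:
  fixes F :: "('a::{real_inner, complete_space} \<Rightarrow> 'a) set" and \<omega> :: "('a \<Rightarrow>\<^sub>L 'a) \<Rightarrow> real"
  assumes F: "finite F" "F \<noteq> {}" "\<And>T. T \<in> F \<Longrightarrow> linear T" "\<And>T. T \<in> F \<Longrightarrow> surj T"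
      "\<And>T x y. T \<in> F \<Longrightarrow> T x \<bullet> T y = x \<bullet> y"
    and lin: "linear \<omega>"
    and pos: "\<And>B. (\<And>x y. blinfun_apply B x \<bullet> y = x \<bullet> blinfun_apply B y) \<Longrightarrow> (\<And>x. 0 \<le> blinfun_apply B x \<bullet> x) \<Longrightarrow> 0 \<le> \<omega> B"
    and id: "\<omega> id_blinfun = 1"
    and inv: "\<And>T B B'. T \<in> F \<Longrightarrow> (\<And>x. T (blinfun_apply B' x) = blinfun_apply B (T x)) \<Longrightarrow> \<omega> B' = \<omega> B"
    and singular: "\<And>e R. (\<And>x. blinfun_apply R x = (x \<bullet> e) *\<^sub>R e) \<Longrightarrow> \<omega> R = 0"
    and \<delta>: "\<delta> > 0"
  shows "\<exists>xs. almost_invariant F \<delta> xs"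
proof (rule ccontr)
  assume neg: "\<not> ?thesis"
  have nontriv: "\<exists>x::'a. x \<noteq> 0"
  proof (rule ccontr)
    assume "\<not> ?thesis"
    then have "(id_blinfun :: 'a \<Rightarrow>\<^sub>L 'a) = 0" by (intro blinfun_eqI) auto
    then show False using id linear_0[OF lin] by simp
  qed
  obtain b where b_sym: "\<And>T x y. T \<in> F \<Longrightarrow> b T x y = b T y x"
    and b_add: "\<And>T x y z. T \<in> F \<Longrightarrow> b T (x + y) z = b T x z + b T y z"
    and b_scale: "\<And>T x y c. T \<in> F \<Longrightarrow> b T (c *\<^sub>R x) y = c * b T x y"
    and b_bound: "\<And>T x y. T \<in> F \<Longrightarrow> \<bar>b T x y\<bar> \<le> ((norm x)\<^sup>2 + (norm y)\<^sup>2) / 2"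
    and b_lower: "\<And>xs. (\<And>p. frame xs p p \<le> \<delta> * tr xs * (norm p)\<^sup>2) \<Longrightarrow>
       \<delta> * tr xs \<le> (\<Sum>x\<leftarrow>xs. \<Sum>T\<in>F. b T (T x) (T x) - b T x x)"
    by (rule dual_forms_of_not_almost_invariant[OF F(1,2,3) nontriv \<delta> neg]) blast+
  have b_le: "\<bar>b T x y\<bar> \<le> norm x * norm y" if "T \<in> F" for T x y
    by (rule form_bound_scaled) (use b_sym[OF that] b_scale[OF that] b_bound[OF that] in blast)+
  have T_norm: "norm (T x) = norm x" if "T \<in> F" for T x
    using F(5)[OF that] by (simp add: norm_eq_sqrt_inner)
  have "\<exists>B :: 'a \<Rightarrow>\<^sub>L 'a. \<forall>x y. B x \<bullet> y = b T x y" if T: "T \<in> F" for T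
    by (rule operator_of_form[of "b T" 1]) (use b_sym[OF T] b_add[OF T] b_scale[OF T] b_le[OF T] in auto)
  then obtain B :: "('a \<Rightarrow> 'a) \<Rightarrow> 'a \<Rightarrow>\<^sub>L 'a" where B: "\<And>T x y. T \<in> F \<Longrightarrow> B T x \<bullet> y = b T x y" by metis
  \<comment> \<open>The resulting operator is the conjugate of B T by T; surjectivity of T
    identifies it below.\<close>
  have "\<exists>B :: 'a \<Rightarrow>\<^sub>L 'a. \<forall>x y. B x \<bullet> y = b T (T x) (T y)" if T: "T \<in> F" for T
  proof (rule operator_of_form[of "\<lambda>x y. b T (T x) (T y)" 1])
    show "\<bar>b T (T x) (T y)\<bar> \<le> 1 * norm x * norm y" for x y
      using b_le[OF T, of "T x" "T y"] by (simp add: T_norm[OF T])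
  qed (use b_sym[OF T] b_add[OF T] b_scale[OF T] linear_add[OF F(3)[OF T]] linear_cmul[OF F(3)[OF T]] in auto)
  then obtain B' :: "('a \<Rightarrow> 'a) \<Rightarrow> 'a \<Rightarrow>\<^sub>L 'a" where B': "\<And>T x y. T \<in> F \<Longrightarrow> B' T x \<bullet> y = b T (T x) (T y)" by metis
  have \<omega>B: "\<omega> (B' T) = \<omega> (B T)" if T: "T \<in> F" for T
  proof (rule inv[OF T])
    fix x
    let ?d = "T (B' T x) - B T (T x)"
    obtain y where y: "?d = T y" using F(4)[OF T] by (metis surjD)
    have "?d \<bullet> T y = 0"
      using B[OF T] B'[OF T] F(5)[OF T] by (simp add: inner_diff_left)
    then show "T (B' T x) = B T (T x)" using y by simp
  qed
  define D where "D = (\<Sum>T\<in>F. B' T - B T)"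
  have \<omega>D: "\<omega> D = 0"
    unfolding D_def linear_sum[OF lin] by (intro sum.neutral) (simp add: linear_diff[OF lin] \<omega>B)
  have D: "D x \<bullet> y = (\<Sum>T\<in>F. b T (T x) (T y) - b T x y)" for x y
    unfolding D_def by (simp add: blinfun.sum_left blinfun.diff_left inner_sum_left inner_diff_left B B')
  have D_sym: "D x \<bullet> y = D y \<bullet> x" for x y
    unfolding D by (intro sum.cong) (simp_all add: b_sym)
  define M where "M = 2 * real (card F)"
  have D_le: "\<bar>D x \<bullet> y\<bar> \<le> M * norm x * norm y" for x y
  proof -
    have "\<bar>D x \<bullet> y\<bar> \<le> (\<Sum>T\<in>F. \<bar>b T (T x) (T y) - b T x y\<bar>)" unfolding D by (rule sum_abs)
    also have "\<dots> \<le> (\<Sum>T\<in>F. 2 * (norm x * norm y))"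
    proof (rule sum_mono)
      fix T assume T: "T \<in> F"
      show "\<bar>b T (T x) (T y) - b T x y\<bar> \<le> 2 * (norm x * norm y)"
        using b_le[OF T, of "T x" "T y"] b_le[OF T, of x y] by (simp add: T_norm[OF T])
    qed
    finally show ?thesis by (simp add: M_def mult_ac)
  qed
  \<comment> \<open>An orthonormal list of length at least 1/\<delta> is spread out by Bessel's
    inequality, so \<open>b_lower\<close> forces the average of D e \<bullet> e to be at least
    \<delta>. Low lists are therefore short, and D is at least \<delta> orthogonally to a longest
    one.\<close>
  define low where "low es \<longleftrightarrow> orthonormal es \<and> (\<forall>e\<in>set es. D e \<bullet> e < \<delta>)" for es
  have short: "real (length es) < 1 / \<delta>" if es: "low es" for es
  proof (rule ccontr)
    assume n: "\<not> real (length es) < 1 / \<delta>"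
    then have "es \<noteq> []" using \<delta> by auto
    have "frame es p p \<le> \<delta> * tr es * (norm p)\<^sup>2" for p
    proof -
      have "1 \<le> \<delta> * tr es" using n es \<delta> by (simp add: low_def tr_orthonormal field_simps)
      then have "1 * (norm p)\<^sup>2 \<le> \<delta> * tr es * (norm p)\<^sup>2" by (intro mult_right_mono) auto
      then show ?thesis using bessel[of es p] es by (simp add: low_def)
    qed
    from b_lower[OF this] have "\<delta> * tr es \<le> (\<Sum>x\<leftarrow>es. D x \<bullet> x)" unfolding D .
    moreover have "(\<Sum>x\<leftarrow>es. D x \<bullet> x) < \<delta> * real (length es)"
      using \<open>es \<noteq> []\<close> es unfolding low_def
    proof (induction es rule: list_nonempty_induct)
      case (cons e es)
      then show ?case by (auto simp: algebra_simps intro: add_strict_mono)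
    qed auto
    ultimately show False using es by (simp add: low_def tr_orthonormal)
  qed
  have "\<exists>es. low es \<and> (\<forall>fs. low fs \<longrightarrow> length fs \<le> length es)"
  proof (rule ex_has_greatest_nat[of low "[]" length "nat \<lceil>1 / \<delta>\<rceil>"])
    show "low []" by (simp add: low_def)
    show "\<forall>es. low es \<longrightarrow> length es < nat \<lceil>1 / \<delta>\<rceil>"
      using short by (auto simp: less_ceiling_iff zless_nat_eq_int_zless)
  qed
  then obtain es where es: "low es" and es_max: "\<And>fs. low fs \<Longrightarrow> length fs \<le> length es" by blast
  have on: "orthonormal es" using es by (simp add: low_def)
  have lower: "\<delta> * (norm w)\<^sup>2 \<le> D w \<bullet> w" if w: "\<And>e. e \<in> set es \<Longrightarrow> w \<bullet> e = 0" for w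
  proof (rule ccontr)
    assume n: "\<not> ?thesis"
    then have "w \<noteq> 0" by auto
    let ?e = "w /\<^sub>R norm w"
    have "D ?e \<bullet> ?e = (D w \<bullet> w) / (norm w)\<^sup>2"
      by (simp add: blinfun.scaleR_right power2_eq_square divide_inverse)
    also have "\<dots> < \<delta>" using n \<open>w \<noteq> 0\<close> by (simp add: field_simps)
    finally have "low (?e # es)"
      using es orthonormal_Cons_normalized[OF on \<open>w \<noteq> 0\<close> w] by (simp add: low_def)
    from es_max[OF this] show False by simp
  qed
  define R where "R e = Blinfun (\<lambda>x. (x \<bullet> e) *\<^sub>R e)" for e :: 'a
  have R: "R e x = (x \<bullet> e) *\<^sub>R e" for e x
    unfolding R_def by (rule fun_cong[OF bounded_linear_Blinfun_apply]) (intro bounded_linear_intros)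
  define P where "P = (\<Sum>e\<leftarrow>es. R e)"
  have P: "P x = proj es x" for x
    unfolding P_def by (induction es) (auto simp: blinfun.add_left R)
  have \<omega>P: "\<omega> P = 0"
    unfolding P_def by (induction es) (auto simp: linear_0[OF lin] linear_add[OF lin] singular[OF R])
  \<comment> \<open>For x = v + w with v the projection: M absorbs D v \<bullet> v, 2 M^2/\<delta>
    absorbs the cross term at the expense of \<delta>/2 |w|^2, and \<delta>/2 absorbs the subtracted
    identity on v.\<close>
  define K where "K = 2 * M\<^sup>2 / \<delta> + M + \<delta> / 2"
  define Q where "Q = D + K *\<^sub>R P - (\<delta> / 2) *\<^sub>R id_blinfun"
  have Q: "Q x \<bullet> y = D x \<bullet> y + K * (proj es x \<bullet> y) - \<delta> / 2 * (x \<bullet> y)" for x y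
    unfolding Q_def by (simp add: blinfun.add_left blinfun.diff_left blinfun.scaleR_left P inner_simps)
  have "0 \<le> \<omega> Q"
  proof (rule pos)
    have ps: "proj es x \<bullet> y = proj es y \<bullet> x" for x y
      by (simp add: inner_proj mult.commute)
    have "Q x \<bullet> y = Q y \<bullet> x" for x y
      unfolding Q using D_sym[of x y] ps[of x y] by (simp add: inner_commute)
    then show "Q x \<bullet> y = x \<bullet> Q y" for x y by (simp add: inner_commute)
    fix x
    define v w where "v = proj es x" and "w = x - proj es x"
    have x: "x = v + w" by (simp add: v_def w_def)
    have n: "(norm x)\<^sup>2 = (norm v)\<^sup>2 + (norm w)\<^sup>2"
      unfolding v_def w_def by (rule pythagoras_proj[OF on])
    have px: "proj es x \<bullet> x = (norm v)\<^sup>2"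
      unfolding v_def norm_proj[OF on] by (simp add: inner_proj frame_def)
    have "\<delta> * (norm w)\<^sup>2 \<le> D w \<bullet> w"
      by (rule lower) (simp add: w_def inner_simps proj_inner_basis[OF on])
    moreover have "- M * (norm v)\<^sup>2 \<le> D v \<bullet> v" using D_le[of v v] by (simp add: power2_eq_square mult.assoc)
    moreover have "- (2 * M\<^sup>2 / \<delta> * (norm v)\<^sup>2 + \<delta> / 2 * (norm w)\<^sup>2) \<le> 2 * (D v \<bullet> w)"
    proof -
      have "0 \<le> (2 * M * norm v - \<delta> * norm w)\<^sup>2 / (2 * \<delta>)" using \<delta> by simp
      also have "\<dots> = 2 * M\<^sup>2 / \<delta> * (norm v)\<^sup>2 + \<delta> / 2 * (norm w)\<^sup>2 - 2 * (M * norm v * norm w)"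
        using \<delta> by (simp add: field_simps power2_eq_square)
      finally show ?thesis using D_le[of v w] by linarith
    qed
    moreover have "D x \<bullet> x = D v \<bullet> v + 2 * (D v \<bullet> w) + D w \<bullet> w"
      unfolding x blinfun.add_right inner_add_left inner_add_right using D_sym[of v w] by simp
    ultimately show "0 \<le> Q x \<bullet> x"
      unfolding Q px n power2_norm_eq_inner[symmetric] K_def by (simp add: algebra_simps)
  qed
  moreover have "\<omega> Q = - \<delta> / 2"
    unfolding Q_def by (simp add: linear_diff[OF lin] linear_add[OF lin] linear_cmul[OF lin] \<omega>D \<omega>P id)
  ultimately show False using \<delta> by simp
qed

section \<open>Invariant finite-dimensional subspaces\<close>

lemma frame_nonneg: "0 \<le> frame xs h h"
  by (induction xs) auto

lemma orthonormal_norm: "orthonormal es \<Longrightarrow> e \<in> set es \<Longrightarrow> norm e = 1"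
  by (induction es) auto

lemma inner_proj_span: "orthonormal es \<Longrightarrow> y \<in> span (set es) \<Longrightarrow> proj es x \<bullet> y = x \<bullet> y"
  using proj_fixes_span[of es y] inner_proj[of es x y] inner_proj[of es y x] by (simp add: mult.commute inner_commute)

text \<open>Requiring equality of the image with the span makes invariance of the orthogonal
  complement immediate.\<close>

definition preserves :: "('a::real_inner \<Rightarrow> 'a) \<Rightarrow> 'a list \<Rightarrow> bool" where
  "preserves T es \<longleftrightarrow> linear T \<and> (\<forall>x y. T x \<bullet> T y = x \<bullet> y) \<and> T ` span (set es) = span (set es)"

lemma preservesI:
  assumes "linear T" "\<And>x y. T x \<bullet> T y = x \<bullet> y" "\<And>e. e \<in> set es \<Longrightarrow> T e \<in> span (set es)"
    and inv: "\<And>e. e \<in> set es \<Longrightarrow> \<exists>y\<in>span (set es). T y = e"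
  shows "preserves T es"
proof -
  have "T ` span (set es) = span (T ` set es)"
    by (rule linear_span_image[OF assms(1), symmetric])
  also have "\<dots> \<subseteq> span (set es)"
    using assms(3) by (intro span_minimal subspace_span) auto
  finally have 1: "T ` span (set es) \<subseteq> span (set es)" .
  have "span (set es) \<subseteq> T ` span (set es)"
  proof (rule span_minimal)
    show "set es \<subseteq> T ` span (set es)" using inv by force
    show "subspace (T ` span (set es))" by (rule linear_subspace_image[OF assms(1) subspace_span])
  qed
  with 1 show ?thesis using assms(1,2) by (auto simp: preserves_def)
qed

lemma preserves_orthogonal:
  assumes T: "preserves T es" and x: "\<And>e. e \<in> set es \<Longrightarrow> x \<bullet> e = 0" and e: "e \<in> set es"
  shows "T x \<bullet> e = 0"
proof -
  have "e \<in> T ` span (set es)"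
    using T span_base[OF e] by (simp add: preserves_def)
  then obtain y where y: "y \<in> span (set es)" "e = T y" by blast
  have "orthogonal x y"
    by (rule orthogonal_to_span[OF y(1)]) (use x in \<open>auto simp: orthogonal_def\<close>)
  then show ?thesis using T y(2) by (simp add: preserves_def orthogonal_def)
qed

lemma preserves_proj:
  assumes T: "preserves T es" and es: "orthonormal es"
  shows "proj es (T x) = T (proj es x)"
proof -
  have lin: "linear T" using T by (simp add: preserves_def)
  have "proj es (T (x - proj es x)) = 0"
    by (rule proj_eq_0, rule preserves_orthogonal[OF T]) (auto simp: inner_diff_left proj_inner_basis[OF es])
  moreover have "T (proj es x) \<in> span (set es)"
    using T proj_in_span[of es x] by (auto simp: preserves_def)
  then have "proj es (T (proj es x)) = T (proj es x)"
    by (rule proj_fixes_span[OF es])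
  moreover have "T x = T (x - proj es x) + T (proj es x)"
    using linear_add[OF lin, of "x - proj es x" "proj es x"] by simp
  ultimately show ?thesis by (simp add: proj_add)
qed

text \<open>Scaling by 1/sqrt n gives the covariance operator 1/n times the projection. Since es and
  its image under T are orthonormal with the same span, they define the same projection, and no
  corrections are needed.\<close>

lemma almost_invariant_of_invariant_span:
  assumes es: "orthonormal es" and F: "\<And>T. T \<in> F \<Longrightarrow> preserves T es"
    and \<delta>: "\<delta> > 0" and long: "1 / \<delta> \<le> real (length es)"
  shows "\<exists>xs. almost_invariant F \<delta> xs"
proof -
  define n where "n = real (length es)"
  have n: "n > 0" using long \<delta> unfolding n_def by (metis less_le_trans zero_less_divide_1_iff)
  define c where "c = 1 / sqrt n"
  have c2: "c\<^sup>2 = 1 / n" using n by (simp add: c_def power_divide)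
  let ?s = "map ((*\<^sub>R) c)"
  have "almost_invariant F \<delta> (?s es)"
    unfolding almost_invariant_def tr_def[symmetric]
  proof (intro conjI allI ballI)
    show "tr (?s es) = 1" using n es by (simp add: tr_scaleR c2 tr_orthonormal n_def)
    fix p
    have "(\<Sum>x\<leftarrow>?s es. (p \<bullet> x)\<^sup>2) = 1 / n * frame es p p"
      unfolding c2[symmetric] frame_scaleR[symmetric] by (simp add: frame_def power2_eq_square)
    also have "\<dots> \<le> \<delta> * (norm p)\<^sup>2"
    proof (rule mult_mono)
      show "1 / n \<le> \<delta>" using long \<delta> n by (simp add: n_def field_simps)
      show "frame es p p \<le> (norm p)\<^sup>2" by (rule bessel[OF es])
      show "0 \<le> frame es p p" by (rule frame_nonneg)
    qed (use \<delta> in auto)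
    finally show "(\<Sum>x\<leftarrow>?s es. (p \<bullet> x)\<^sup>2) \<le> \<delta> * (norm p)\<^sup>2" .
  next
    fix T assume "T \<in> F"
    then have T: "preserves T es" by (rule F)
    then have lin: "linear T" by (simp add: preserves_def)
    have on: "orthonormal (map T es)"
    proof -
      have "T x \<bullet> T y = x \<bullet> y" for x y using T by (simp add: preserves_def)
      with es show ?thesis by (induction es) (auto simp: norm_eq_sqrt_inner)
    qed
    have sp: "span (set (map T es)) = span (set es)"
      using linear_span_image[OF lin, of "set es"] T by (simp add: preserves_def)
    have comp: "map T (?s es) = ?s (map T es)"
      using lin by (auto simp: linear_cmul)
    have "frame (map T es) h h = frame es h h" for h
    proof -
      let ?d = "proj (map T es) h - proj es h"
      have "?d = 0"
      proof (rule orthogonal_span_eq_0[of _ es])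
        show "?d \<in> span (set es)"
          using proj_in_span[of "map T es" h] proj_in_span[of es h] unfolding sp by (rule span_diff)
        fix e assume "e \<in> set es"
        then have "e \<in> span (set es)" by (rule span_base)
        then show "?d \<bullet> e = 0"
          using inner_proj_span[OF on, of e h] inner_proj_span[OF es, of e h] unfolding sp
          by (simp add: inner_diff_left)
      qed
      then show ?thesis using norm_proj[OF on, of h] norm_proj[OF es, of h] by simp
    qed
    then have "frame (?s es @ []) h h = frame (map T (?s es) @ []) h h" for h
      unfolding comp append_Nil2 frame_scaleR by simp
    moreover have "tr [] \<le> \<delta>" using \<delta> by simp
    ultimately show "\<exists>rs rs'. tr rs \<le> \<delta> \<and> tr rs' \<le> \<delta> \<and> (\<forall>h. frame (?s es @ rs) h h = frame (map T (?s es) @ rs') h h)"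
      by blast
  qed
  then show ?thesis by blast
qed

text \<open>The coefficients lie in [-1, 1], so the projections lie in a continuous image of a
  compact box.\<close>

lemma compact_proj_unit_ball:
  fixes es :: "'a::real_inner list"
  assumes "\<And>e. e \<in> set es \<Longrightarrow> norm e = 1"
  obtains K where "compact K" "\<And>x. norm x \<le> 1 \<Longrightarrow> proj es x \<in> K"
  using assms
proof (induction es arbitrary: thesis)
  case Nil
  show ?case by (rule Nil(1)[of "{0}"]) auto
next
  case (Cons e es)
  obtain K where K: "compact K" "\<And>x. norm x \<le> 1 \<Longrightarrow> proj es x \<in> K"
    using Cons.IH Cons.prems(2) by auto
  show ?case
  proof (rule Cons.prems(1))
    show "compact ((\<lambda>(t, z). t *\<^sub>R e + z) ` ({-1..1} \<times> K))"
      unfolding split_beta' by (intro compact_continuous_image continuous_intros compact_Times K compact_Icc)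
    fix x :: 'a assume x: "norm x \<le> 1"
    have "\<bar>x \<bullet> e\<bar> \<le> norm x * norm e" by (rule Cauchy_Schwarz_ineq2)
    also have "\<dots> \<le> 1" using x Cons.prems(2)[of e] by simp
    finally have "(x \<bullet> e, proj es x) \<in> {-1..1} \<times> K" using K(2)[OF x] by auto
    then show "proj (e # es) x \<in> (\<lambda>(t, z). t *\<^sub>R e + z) ` ({-1..1} \<times> K)" by force
  qed
qed

text \<open>A positive form of finite trace attains its norm: outside a finite-dimensional subspace it is bounded by
  half its norm, so maximizing sequences have convergent subsequences.\<close>

lemma trace_class_form_attains_norm:
  fixes \<beta> :: "'a::{real_inner, complete_space} \<Rightarrow> 'a \<Rightarrow> real"
  assumes sym: "\<And>x y. \<beta> x y = \<beta> y x" and add: "\<And>x y z. \<beta> (x + y) z = \<beta> x z + \<beta> y z"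
    and scale: "\<And>c x y. \<beta> (c *\<^sub>R x) y = c * \<beta> x y" and pos: "\<And>x. 0 \<le> \<beta> x x"
    and trace: "\<And>es. orthonormal es \<Longrightarrow> (\<Sum>e\<leftarrow>es. \<beta> e e) \<le> 1" and nz: "\<beta> a a \<noteq> 0"
  obtains l y where "l > 0" "y \<noteq> 0" "\<beta> y y = l * (norm y)\<^sup>2" "\<And>x. \<beta> x x \<le> l * (norm x)\<^sup>2"
proof -
  have scale2: "\<beta> (c *\<^sub>R x) (c *\<^sub>R x) = c\<^sup>2 * \<beta> x x" for c x
    using scale[of c x "c *\<^sub>R x"] scale[of c x x] sym[of x "c *\<^sub>R x"] by (simp add: power2_eq_square)
  have add': "\<beta> z (x + y) = \<beta> z x + \<beta> z y" for x y z using add[of x y z] by (simp add: sym)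
  have neg: "\<beta> (- x) y = - \<beta> x y" "\<beta> y (- x) = - \<beta> y x" for x y
    using scale[of "-1" x y] by (simp_all add: sym[of y])
  have diff: "\<beta> (x - y) z = \<beta> x z - \<beta> y z" "\<beta> z (x - y) = \<beta> z x - \<beta> z y" for x y z
    using add[of x "- y" z] add'[of z x "- y"] by (simp_all add: neg)
  have \<beta>0: "\<beta> 0 0 = 0" using scale[of 0 0 0] by simp
  define S where "S = (\<lambda>x. \<beta> x x) ` sphere 0 1"
  define l where "l = Sup S"
  have a: "a \<noteq> 0" using nz \<beta>0 by auto
  have unit: "\<beta> x x \<le> 1" if "norm x = 1" for x
    using trace[of "[x]"] that by simp
  have bdd: "bdd_above S" unfolding S_def using unit by (auto intro!: bdd_aboveI)
  have na: "a /\<^sub>R norm a \<in> sphere 0 1" using a by simp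
  then have ne: "S \<noteq> {}" unfolding S_def by blast
  have l_upper: "\<beta> x x \<le> l" if "norm x = 1" for x
    unfolding l_def by (rule cSup_upper[OF _ bdd]) (use that in \<open>auto simp: S_def\<close>)
  have upper: "\<beta> x x \<le> l * (norm x)\<^sup>2" for x
  proof (cases "x = 0")
    case False
    have "\<beta> (x /\<^sub>R norm x) (x /\<^sub>R norm x) \<le> l" using False by (intro l_upper) simp
    then show ?thesis unfolding scale2 using False by (simp add: field_simps)
  qed (simp add: \<beta>0)
  have l: "l > 0"
  proof -
    have "0 < \<beta> a a" using pos[of a] nz by simp
    also have "\<dots> \<le> l * (norm a)\<^sup>2" by (rule upper)
    finally show ?thesis using a by (simp add: zero_less_mult_iff)
  qed
  \<comment> \<open>A nonnegative quadratic form whose zeros are the vectors attaining the bound;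
    the parallelogram identity gives it the weak triangle inequality \<open>q_add\<close>.\<close>
  define q where "q x = l * (norm x)\<^sup>2 - \<beta> x x" for x
  have q_pos: "0 \<le> q x" for x using upper[of x] by (simp add: q_def)
  have q_le: "q x \<le> l * (norm x)\<^sup>2" for x using pos[of x] by (simp add: q_def)
  have q_neg: "q (- x) = q x" for x by (simp add: q_def neg)
  have q_add: "q (x + y) \<le> 2 * q x + 2 * q y" for x y
  proof -
    have "q (x + y) + q (x + - y) = 2 * q x + 2 * q y"
      unfolding q_def power2_norm_eq_inner by (simp add: add add' diff sym[of y x] inner_simps inner_commute algebra_simps)
    then show ?thesis using q_pos[of "x + - y"] by linarith
  qed
  define high where "high es \<longleftrightarrow> orthonormal es \<and> (\<forall>e\<in>set es. l / 2 < \<beta> e e)" for es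
  have short: "real (length es) \<le> 2 / l" if "high es" for es
  proof -
    have "l / 2 * real (length es) \<le> (\<Sum>e\<leftarrow>es. \<beta> e e)"
      using that unfolding high_def by (induction es) (auto simp: algebra_simps)
    also have "\<dots> \<le> 1" using that by (intro trace) (simp add: high_def)
    finally show ?thesis using l by (simp add: field_simps)
  qed
  have "\<exists>es. high es \<and> (\<forall>fs. high fs \<longrightarrow> length fs \<le> length es)"
  proof (rule ex_has_greatest_nat[of high "[]" length "Suc (nat \<lfloor>2 / l\<rfloor>)"])
    show "high []" by (simp add: high_def)
    show "\<forall>es. high es \<longrightarrow> length es < Suc (nat \<lfloor>2 / l\<rfloor>)"
      using short by (auto simp: less_Suc_eq_le le_nat_floor)
  qed
  then obtain es where es: "high es" and es_max: "\<And>fs. high fs \<Longrightarrow> length fs \<le> length es" by blast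
  have on: "orthonormal es" using es by (simp add: high_def)
  have half: "l / 2 * (norm w)\<^sup>2 \<le> q w" if w: "\<And>e. e \<in> set es \<Longrightarrow> w \<bullet> e = 0" for w
  proof (rule ccontr)
    assume n: "\<not> ?thesis"
    then have w0: "w \<noteq> 0" using q_pos by auto
    let ?e = "w /\<^sub>R norm w"
    have "l / 2 * (norm w)\<^sup>2 < \<beta> w w" using n by (simp add: q_def)
    then have "l / 2 < \<beta> ?e ?e" unfolding scale2 using w0 by (simp add: field_simps)
    then have "high (?e # es)"
      using es orthonormal_Cons_normalized[OF on w0 w] by (simp add: high_def)
    from es_max[OF this] show False by simp
  qed
  have "\<exists>x. norm x = 1 \<and> q x < 1 / real (Suc n)" for n
  proof -
    have "l - 1 / real (Suc n) < Sup S" by (simp add: l_def)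
    then obtain s where "s \<in> S" "l - 1 / real (Suc n) < s" using less_cSup_iff[OF ne bdd] by blast
    then show ?thesis unfolding S_def q_def by force
  qed
  then obtain x where x: "\<And>n. norm (x n) = 1" "\<And>n. q (x n) < 1 / real (Suc n)" by metis
  obtain K where K: "compact K" "\<And>x. norm x \<le> 1 \<Longrightarrow> proj es x \<in> K"
    by (rule compact_proj_unit_ball[of es]) (auto intro: orthonormal_norm[OF on])
  have "\<forall>n. proj es (x n) \<in> K" using K(2) x(1) by simp
  with K(1)[unfolded compact_def, rule_format, of "\<lambda>n. proj es (x n)"]
  obtain p r where "strict_mono r" "((\<lambda>n. proj es (x n)) \<circ> r) \<longlonglongrightarrow> p"
    by blast
  then have r: "strict_mono r" "(\<lambda>n. proj es (x (r n))) \<longlonglongrightarrow> p"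
    by (simp_all add: o_def)
  define y where "y n = x (r n)" for n
  have yp: "(\<lambda>n. proj es (y n)) \<longlonglongrightarrow> p" using r(2) by (simp add: y_def)
  have q_bound: "q (y n) < 1 / real (Suc n)" for n
  proof -
    have "q (y n) < 1 / real (Suc (r n))" using x(2) by (simp add: y_def)
    also have "\<dots> \<le> 1 / real (Suc n)"
      using seq_suble[OF r(1), of n] by (intro divide_left_mono) auto
    finally show ?thesis .
  qed
  have qy: "(\<lambda>n. q (y n)) \<longlonglongrightarrow> 0"
  proof (rule tendsto_sandwich[of "\<lambda>n. 0" _ _ "\<lambda>n. 1 / real (Suc n)"])
    show "\<forall>\<^sub>F n in sequentially. q (y n) \<le> 1 / real (Suc n)"
      using q_bound by (auto intro: always_eventually less_imp_le)
  qed (use q_pos LIMSEQ_Suc[OF lim_1_over_n] in auto)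
  \<comment> \<open>So far only the projections converge. The component of u - v orthogonal to es is
    controlled by q through \<open>half\<close>, with factor 4 for the projection; the projection
    itself adds one more, giving 5.\<close>
  have key: "(norm (u - v))\<^sup>2 \<le> 5 * (norm (proj es u - proj es v))\<^sup>2 + 8 / l * (q u + q v)" for u v
  proof -
    define s where "s = u - v"
    define w where "w = s - proj es s"
    have ps: "proj es s = proj es u - proj es v"
      unfolding s_def by (rule linear_diff[OF linear_proj])
    have "l / 2 * (norm w)\<^sup>2 \<le> q w"
      by (rule half) (simp add: w_def inner_diff_left proj_inner_basis[OF on])
    also have "q w \<le> 2 * q s + 2 * q (proj es s)"
      using q_add[of s "- proj es s"] by (simp add: w_def q_neg)
    also have "q (proj es s) \<le> l * (norm (proj es s))\<^sup>2" by (rule q_le)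
    also have "q s \<le> 2 * q u + 2 * q v"
      using q_add[of u "- v"] by (simp add: s_def q_neg)
    finally have 1: "l / 2 * (norm w)\<^sup>2 \<le> 2 * (2 * q u + 2 * q v) + 2 * (l * (norm (proj es s))\<^sup>2)" by simp
    have 2: "l / 2 * (4 * (norm (proj es s))\<^sup>2 + 8 / l * (q u + q v))
        = 2 * (l * (norm (proj es s))\<^sup>2) + 4 * (q u + q v)"
      using l by (simp add: distrib_left)
    have "l / 2 * (norm w)\<^sup>2 \<le> l / 2 * (4 * (norm (proj es s))\<^sup>2 + 8 / l * (q u + q v))"
      unfolding 2 using 1 by simp
    then have "(norm w)\<^sup>2 \<le> 4 * (norm (proj es s))\<^sup>2 + 8 / l * (q u + q v)"
      using l by (simp only: mult_le_cancel_left_pos half_gt_zero)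
    then show ?thesis
      using pythagoras_proj[OF on, of s] unfolding w_def[symmetric] ps[symmetric] s_def[symmetric] by linarith
  qed
  have "Cauchy y"
  proof (rule CauchyI)
    fix e :: real assume e: "e > 0"
    obtain N1 where N1: "\<And>m n. m \<ge> N1 \<Longrightarrow> n \<ge> N1 \<Longrightarrow> norm (proj es (y m) - proj es (y n)) < e / 4"
      using CauchyD[OF LIMSEQ_imp_Cauchy[OF yp], of "e / 4"] e by auto
    have "l * e\<^sup>2 / 32 > 0" using e l by simp
    from order_tendstoD(2)[OF qy this]
    obtain N2 where N2: "\<And>n. n \<ge> N2 \<Longrightarrow> q (y n) < l * e\<^sup>2 / 32"
      unfolding eventually_sequentially by blast
    have "norm (y m - y n) < e" if mn: "m \<ge> max N1 N2" "n \<ge> max N1 N2" for m n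
    proof -
      have "(norm (proj es (y m) - proj es (y n)))\<^sup>2 \<le> (e / 4)\<^sup>2"
        using N1[of m n] mn by (intro power_mono) auto
      moreover have "8 / l * (q (y m) + q (y n)) \<le> 8 / l * (l * e\<^sup>2 / 16)"
        using N2[of m] N2[of n] mn l by (intro mult_left_mono) auto
      moreover have "8 / l * (l * e\<^sup>2 / 16) = e\<^sup>2 / 2" using l by simp
      moreover have "(e / 4)\<^sup>2 = e\<^sup>2 / 16" by (simp add: power_divide)
      moreover have "0 < e\<^sup>2" using e by simp
      ultimately have "(norm (y m - y n))\<^sup>2 < e\<^sup>2" using key[of "y m" "y n"] by linarith
      then show ?thesis using e by (simp add: power_less_imp_less_base)
    qed
    then show "\<exists>M. \<forall>m\<ge>M. \<forall>n\<ge>M. norm (y m - y n) < e" by blast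
  qed
  then obtain z where z: "y \<longlonglongrightarrow> z" using Cauchy_convergent convergent_def by blast
  have "(\<lambda>n. norm (y n)) \<longlonglongrightarrow> norm z" by (intro tendsto_norm z)
  then have nz: "norm z = 1" using x(1) LIMSEQ_unique[OF _ tendsto_const] by (fastforce simp: y_def)
  have "(\<lambda>n. 2 * q (y n) + 2 * (l * (norm (z - y n))\<^sup>2)) \<longlonglongrightarrow> 2 * 0 + 2 * (l * (norm (z - z))\<^sup>2)"
    by (intro tendsto_intros qy z)
  moreover have "q z \<le> 2 * q (y n) + 2 * (l * (norm (z - y n))\<^sup>2)" for n
    using q_add[of "y n" "z - y n"] q_le[of "z - y n"] by simp
  ultimately have "q z \<le> 0" using LIMSEQ_le_const by fastforce
  then have "\<beta> z z = l * (norm z)\<^sup>2" using q_pos[of z] by (simp add: q_def)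
  moreover have "z \<noteq> 0" using nz by auto
  ultimately show thesis using that[OF l] upper by blast
qed

section \<open>States on complex Hilbert spaces\<close>

interpretation cvs: vector_space "scaleC :: complex \<Rightarrow> 'a \<Rightarrow> 'a::complex_inner"
  by (rule vector_space_scaleC)

text \<open>Multiplication by the imaginary unit, viewed as a real isometry. Complex subspaces and
  operators are the real ones stable under or commuting with it.\<close>

abbreviation J :: "'a::complex_inner \<Rightarrow> 'a" where "J x \<equiv> \<i> *\<^sub>C x"

lemma J_add: "J (x + y) = J x + J y"
  by (rule scaleC_add_right)

lemma J_scaleR: "J (r *\<^sub>R x) = r *\<^sub>R J x"
  unfolding scaleC_of_real[symmetric] scaleC_scaleC by (simp add: mult.commute)

lemma J_J: "J (J x) = - x"
proof -
  have "J (J x) = complex_of_real (-1) *\<^sub>C x"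
    by (simp only: scaleC_scaleC i_squared[unfolded power2_eq_square] of_real_minus of_real_1 complex_i_mult_minus)
  then show ?thesis by (simp only: scaleC_of_real) simp
qed

lemma linear_J: "linear J"
  by (rule linearI) (rule J_add, rule J_scaleR)

lemma scaleC_conv_J: "c *\<^sub>C x = Re c *\<^sub>R x + Im c *\<^sub>R J x"
proof -
  have "c *\<^sub>C x = (complex_of_real (Re c) + complex_of_real (Im c) * \<i>) *\<^sub>C x"
    by (simp add: complex_eq mult.commute)
  then show ?thesis
    by (simp only: scaleC_add_left scaleC_scaleC[symmetric] scaleC_of_real)
qed

lemma cinner_J_right: "cinner x (J y) = - \<i> * cinner x y"
  by (subst (1 2) cinner_commute) (simp add: cinner_scaleC_left)

lemma inner_J_J: "J x \<bullet> J y = x \<bullet> y"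
  unfolding Re_cinner[symmetric] by (simp add: cinner_J_right cinner_scaleC_left)

lemma inner_J: "J x \<bullet> y = - (x \<bullet> J y)"
  using inner_J_J[of x "J y"] by (simp add: J_J)

lemma Im_cinner: "Im (cinner x y) = x \<bullet> J y"
  unfolding Re_cinner[symmetric] by (simp add: cinner_J_right)

lemma norm_J: "norm (J x) = norm x"
  by (simp add: norm_eq_sqrt_inner inner_J_J)

text \<open>A state on the orthogonal complement of \<open>es\<close> becomes a functional on all bounded real operators
  of the whole space by compressing their complex linear parts.\<close>

locale invariant_state =
  fixes es :: "'a::chilbert_space list" and W :: "'a set" and \<phi> :: "('a \<Rightarrow> 'a) \<Rightarrow> complex"
    and \<T> :: "('a \<Rightarrow> 'a) set"
  assumes on: "orthonormal es" and W_def: "W = {x. \<forall>e\<in>set es. x \<bullet> e = 0}"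
    and J_pres: "preserves J es" and state: "state_on W \<phi>"
    and T_pres: "\<And>T. T \<in> \<T> \<Longrightarrow> preserves T es" and T_surj: "\<And>T. T \<in> \<T> \<Longrightarrow> surj T"
    and T_J: "\<And>T x. T \<in> \<T> \<Longrightarrow> T (J x) = J (T x)"
    and \<phi>_inv: "\<And>T B B'. T \<in> \<T> \<Longrightarrow> B \<in> bounded_ops W \<Longrightarrow> B' \<in> bounded_ops W \<Longrightarrow>
      (\<And>x. x \<in> W \<Longrightarrow> T (B' x) = B (T x)) \<Longrightarrow> \<phi> B' = \<phi> B"
begin

definition P :: "'a \<Rightarrow> 'a" where "P x = x - proj es x"

text \<open>B is averaged with its conjugate - J B J; the average commutes with J and is therefore
  complex linear.\<close>

definition op :: "('a \<Rightarrow>\<^sub>L 'a) \<Rightarrow> 'a \<Rightarrow> 'a" where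
  "op B = restrict (\<lambda>x. P ((1/2) *\<^sub>R (blinfun_apply B x - J (blinfun_apply B (J x))))) W"

definition \<omega> :: "('a \<Rightarrow>\<^sub>L 'a) \<Rightarrow> real" where "\<omega> B = Re (\<phi> (op B))"

lemma P_in_W: "P x \<in> W"
  by (simp add: P_def W_def inner_diff_left proj_inner_basis[OF on])

lemma P_add: "P (x + y) = P x + P y"
  by (simp add: P_def proj_add)

lemma P_scaleR: "P (c *\<^sub>R x) = c *\<^sub>R P x"
  by (simp add: P_def proj_scaleR scaleR_diff_right)

lemma P_diff: "P (x - y) = P x - P y"
  using P_add[of "x - y" y] by (simp add: eq_diff_eq)

lemma P_preserves: "preserves T es \<Longrightarrow> P (T x) = T (P x)"
  by (simp add: P_def preserves_proj[OF _ on] linear_diff[of T] preserves_def)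

lemma P_J: "P (J x) = J (P x)"
  by (rule P_preserves[OF J_pres])

lemma P_scaleC: "P (c *\<^sub>C x) = c *\<^sub>C P x"
  unfolding scaleC_conv_J[of c] by (simp add: P_add P_scaleR P_J)

lemma P_W: "x \<in> W \<Longrightarrow> P x = x"
  by (simp add: P_def W_def proj_eq_0)

lemma inner_P_W: "x \<in> W \<Longrightarrow> P y \<bullet> x = y \<bullet> x"
  using proj_orthogonal[of es x y] by (simp add: P_def W_def inner_diff_left inner_commute[of _ x] inner_diff_right)

lemma norm_P: "norm (P x) \<le> norm x"
proof (rule power2_le_imp_le[OF _ norm_ge_zero])
  show "(norm (P x))\<^sup>2 \<le> (norm x)\<^sup>2"
    unfolding P_def pythagoras_proj[OF on, of x] by simp
qed

lemma W_preserves: "preserves T es \<Longrightarrow> x \<in> W \<Longrightarrow> T x \<in> W"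
  using preserves_orthogonal[of T es x] by (simp add: W_def)

lemma W_J: "x \<in> W \<Longrightarrow> J x \<in> W"
  by (rule W_preserves[OF J_pres])

lemma W_add: "x \<in> W \<Longrightarrow> y \<in> W \<Longrightarrow> x + y \<in> W"
  by (simp add: W_def inner_add_left)

lemma W_scaleR: "x \<in> W \<Longrightarrow> c *\<^sub>R x \<in> W"
  by (simp add: W_def)

lemma W_scaleC: "x \<in> W \<Longrightarrow> c *\<^sub>C x \<in> W"
  unfolding scaleC_conv_J[of c] by (intro W_add W_scaleR W_J)

lemma op_apply: "x \<in> W \<Longrightarrow> op B x = P ((1/2) *\<^sub>R (B x - J (B (J x))))"
  by (simp add: op_def)

lemma op_bounded: "op B \<in> bounded_ops W"
  unfolding bounded_ops_def
proof (intro CollectI conjI ballI allI)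
  show "op B \<in> W \<rightarrow>\<^sub>E W" unfolding op_def using P_in_W by auto
  fix x assume x: "x \<in> W"
  show "op B (x + y) = op B x + op B y" if "y \<in> W" for y
    using x that by (simp add: op_apply W_add J_add blinfun.add_right P_add[symmetric] algebra_simps)
  let ?C = "\<lambda>x. (1/2) *\<^sub>R (B x - J (B (J x)))"
  have CJ: "?C (J x) = J (?C x)" for x
    by (simp add: J_J J_scaleR linear_diff[OF linear_J] blinfun.minus_right linear_neg[OF linear_J] algebra_simps)
  show "op B (c *\<^sub>C x) = c *\<^sub>C op B x" for c
  proof -
    have C_lin: "?C (a *\<^sub>R y + b *\<^sub>R z) = a *\<^sub>R ?C y + b *\<^sub>R ?C z" for a b y z
      by (simp add: J_add J_scaleR blinfun.add_right blinfun.scaleR_right algebra_simps)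
    have "?C (c *\<^sub>C x) = Re c *\<^sub>R ?C x + Im c *\<^sub>R ?C (J x)"
      unfolding scaleC_conv_J[of c x] by (rule C_lin)
    also have "\<dots> = c *\<^sub>C ?C x" unfolding CJ scaleC_conv_J[of c "?C x"] ..
    finally show ?thesis using x by (simp add: op_apply W_scaleC P_scaleC)
  qed
next
  have "norm (op B x) \<le> norm B * norm x" if x: "x \<in> W" for x
  proof -
    have "norm (op B x) \<le> norm ((1/2) *\<^sub>R (B x - J (B (J x))))"
      using x norm_P by (simp add: op_apply del: norm_scaleR)
    also have "\<dots> \<le> (norm (B x) + norm (B (J x))) / 2"
      using norm_triangle_ineq4[of "B x" "J (B (J x))"] by (simp add: norm_J)
    also have "\<dots> \<le> norm B * norm x"
      using norm_blinfun[of B x] norm_blinfun[of B "J x"] by (simp add: norm_J)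
    finally show ?thesis .
  qed
  then show "\<exists>K. \<forall>x\<in>W. norm (op B x) \<le> K * norm x" by blast
qed

lemma \<phi>_add: "S \<in> bounded_ops W \<Longrightarrow> T \<in> bounded_ops W \<Longrightarrow> \<phi> (\<lambda>x\<in>W. S x + T x) = \<phi> S + \<phi> T"
  and \<phi>_scale: "T \<in> bounded_ops W \<Longrightarrow> \<phi> (\<lambda>x\<in>W. c *\<^sub>C T x) = c * \<phi> T"
  and \<phi>_pos: "positive_op W T \<Longrightarrow> \<phi> T \<in> \<real>\<^sub>\<ge>\<^sub>0" and \<phi>_id: "\<phi> (\<lambda>x\<in>W. x) = 1"
  using state unfolding state_on_def bounded_functional_def by blast+

lemma linear_\<omega>: "linear \<omega>"
proof (rule linearI)
  fix A B :: "'a \<Rightarrow>\<^sub>L 'a" and r :: real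
  have "op (A + B) = (\<lambda>x\<in>W. op A x + op B x)"
    by (auto simp: op_def blinfun.add_left J_add P_add[symmetric] algebra_simps)
  then show "\<omega> (A + B) = \<omega> A + \<omega> B"
    unfolding \<omega>_def by (simp add: \<phi>_add op_bounded)
  have "op (r *\<^sub>R A) = (\<lambda>x\<in>W. complex_of_real r *\<^sub>C op A x)"
    by (auto simp: op_def blinfun.scaleR_left J_scaleR P_scaleR[symmetric] scaleC_of_real scaleR_diff_right mult.commute)
  then show "\<omega> (r *\<^sub>R A) = r *\<^sub>R \<omega> A"
    unfolding \<omega>_def by (simp add: \<phi>_scale op_bounded)
qed

text \<open>Symmetry of B makes the imaginary part of the diagonal values vanish, which complex
  positivity requires; their real part averages the values of the form of B at x and J x.\<close>

lemma \<omega>_pos: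
  assumes sym: "\<And>x y. blinfun_apply B x \<bullet> y = x \<bullet> blinfun_apply B y" and pos: "\<And>x. 0 \<le> blinfun_apply B x \<bullet> x"
  shows "0 \<le> \<omega> B"
proof -
  have "positive_op W (op B)"
    unfolding positive_op_def
  proof (intro conjI ballI op_bounded)
    fix x assume x: "x \<in> W"
    have Re: "op B x \<bullet> x = (B x \<bullet> x + B (J x) \<bullet> J x) / 2"
      using x by (simp add: op_apply inner_P_W inner_diff_left inner_J)
    have "op B x \<bullet> J x = (B x \<bullet> J x - B (J x) \<bullet> x) / 2"
      using x W_J[OF x] by (simp add: op_apply inner_P_W inner_diff_left inner_J_J)
    also have "B (J x) \<bullet> x = B x \<bullet> J x" using sym[of x "J x"] by (simp add: inner_commute)
    finally have "Im (cinner (op B x) x) = 0" by (simp add: Im_cinner)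
    moreover have "Re (cinner (op B x) x) \<ge> 0" using pos[of x] pos[of "J x"] by (simp add: Re_cinner Re)
    ultimately show "cinner (op B x) x \<in> \<real>\<^sub>\<ge>\<^sub>0" by (simp add: complex_nonneg_Reals_iff)
  qed
  then show ?thesis using \<phi>_pos unfolding \<omega>_def by (auto simp: complex_nonneg_Reals_iff)
qed

lemma \<omega>_id: "\<omega> id_blinfun = 1"
proof -
  have "op id_blinfun = (\<lambda>x\<in>W. x)"
    by (auto simp: op_def J_J P_W scaleR_2[symmetric])
  then show ?thesis by (simp add: \<omega>_def \<phi>_id)
qed

lemma \<omega>_inv:
  assumes T: "T \<in> \<T>" and BB: "\<And>x. T (blinfun_apply B' x) = blinfun_apply B (T x)"
  shows "\<omega> B' = \<omega> B"
proof -
  have lin: "linear T" using T_pres[OF T] by (simp add: preserves_def)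
  have "\<phi> (op B') = \<phi> (op B)"
  proof (rule \<phi>_inv[OF T op_bounded op_bounded])
    fix x assume x: "x \<in> W"
    have "T (op B' x) = P (T ((1/2) *\<^sub>R (B' x - J (B' (J x)))))"
      using x by (simp add: op_apply P_preserves[OF T_pres[OF T]])
    also have "T ((1/2) *\<^sub>R (B' x - J (B' (J x)))) = (1/2) *\<^sub>R (B (T x) - J (B (J (T x))))"
      by (simp add: linear_cmul[OF lin] linear_diff[OF lin] T_J[OF T] BB)
    finally show "T (op B' x) = op B (T x)"
      using W_preserves[OF T_pres[OF T] x] by (simp add: op_apply)
  qed
  then show ?thesis by (simp add: \<omega>_def)
qed

text \<open>The averaging in \<open>op\<close> absorbs conjugation by J. This puts J on the same
  footing as the members of \<T>, so that eigenspaces found later are complex.\<close>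

lemma \<omega>_inv_J:
  assumes BB: "\<And>x. J (blinfun_apply B' x) = blinfun_apply B (J x)"
  shows "\<omega> B' = \<omega> B"
proof -
  have B': "B' x = - J (B (J x))" for x
  proof -
    have "- B' x = J (B (J x))" using arg_cong[OF BB[of x], of J] by (simp add: J_J)
    from arg_cong[OF this, of uminus] show ?thesis by simp
  qed
  have "op B' = op B"
    unfolding op_def
    by (auto simp: B' J_J linear_neg[OF linear_J] blinfun.minus_right intro!: arg_cong[of _ _ P])
  then show ?thesis by (simp add: \<omega>_def)
qed

text \<open>Symmetrized rank-one operators; \<open>\<omega> (R e f)\<close> is a symmetric bilinear
  form standing in for the density operator of the normal part of the state.\<close>

definition R :: "'a \<Rightarrow> 'a \<Rightarrow> 'a \<Rightarrow>\<^sub>L 'a" where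
  "R e f = Blinfun (\<lambda>x. (1/2) *\<^sub>R ((x \<bullet> e) *\<^sub>R f + (x \<bullet> f) *\<^sub>R e))"

lemma R_apply: "R e f x = (1/2) *\<^sub>R ((x \<bullet> e) *\<^sub>R f + (x \<bullet> f) *\<^sub>R e)"
  unfolding R_def by (rule fun_cong[OF bounded_linear_Blinfun_apply]) (intro bounded_linear_intros)

lemma R_diag: "R e e x = (x \<bullet> e) *\<^sub>R e"
  by (simp add: R_apply scaleR_2[symmetric])

lemma R_sym: "R e f = R f e"
  by (simp add: R_def add.commute)

lemma \<omega>_R_preserved: "\<omega> (R (T e) (T e)) = \<omega> (R e e)" if "T \<in> \<T> \<or> T = J"
proof -
  have T: "preserves T es" using that T_pres J_pres by auto
  then have lin: "linear T" and iso: "\<And>x y. T x \<bullet> T y = x \<bullet> y" by (auto simp: preserves_def)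
  have "T (R e e x) = R (T e) (T e) (T x)" for x
    by (simp add: R_diag linear_cmul[OF lin] iso)
  then have "\<omega> (R e e) = \<omega> (R (T e) (T e))"
    using that \<omega>_inv[of T "R e e"] \<omega>_inv_J[of "R e e"] by blast
  then show ?thesis by simp
qed

text \<open>Only the compression to W counts. Projecting e keeps the value while shortening e unless
  e lies in W, which later forces maximizers of the form into W.\<close>

lemma \<omega>_R_P: "\<omega> (R (P e) (P e)) = \<omega> (R e e)"
proof -
  have "op (R (P e) (P e)) x = op (R e e) x" if x: "x \<in> W" for x
  proof -
    have "x \<bullet> P e = x \<bullet> e" "J x \<bullet> P e = J x \<bullet> e"
      using inner_P_W[OF x, of e] inner_P_W[OF W_J[OF x], of e] by (simp_all add: inner_commute)
    then show ?thesis
      using x by (simp add: op_apply R_diag P_scaleR P_diff P_J J_scaleR P_W[OF P_in_W])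
  qed
  then have "op (R (P e) (P e)) = op (R e e)"
    unfolding op_def by (auto simp: restrict_def fun_eq_iff)
  then show ?thesis by (simp add: \<omega>_def)
qed

text \<open>A nonzero value would give a positive form of trace at most one, since \<omega> is
  nonnegative on the identity minus a projection. Such a form attains its norm l > 0. The vectors
  attaining it form a nonzero subspace of W of dimension at most 1/l, invariant under \<T> and J,
  which \<open>max\<close> excludes.\<close>

lemma \<omega>_singular:
  assumes max: "\<And>fs. orthonormal fs \<Longrightarrow> set fs \<subseteq> W \<Longrightarrow> (\<And>T f. T \<in> \<T> \<or> T = J \<Longrightarrow> f \<in> set fs \<Longrightarrow> T f \<in> span (set fs))
    \<Longrightarrow> fs = []"
  shows "\<omega> (R a a) = 0"
proof (rule ccontr)
  assume nz: "\<omega> (R a a) \<noteq> 0"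
  define \<beta> where "\<beta> x y = \<omega> (R x y)" for x y
  have sym: "\<beta> x y = \<beta> y x" for x y by (simp add: \<beta>_def R_sym)
  have add: "\<beta> (x + y) z = \<beta> x z + \<beta> y z" for x y z
  proof -
    have "R (x + y) z = R x z + R y z"
      by (rule blinfun_eqI) (simp add: R_apply blinfun.add_left inner_add_right algebra_simps)
    then show ?thesis by (simp add: \<beta>_def linear_add[OF linear_\<omega>])
  qed
  have scale: "\<beta> (c *\<^sub>R x) y = c * \<beta> x y" for c x y
  proof -
    have "R (c *\<^sub>R x) y = c *\<^sub>R R x y"
      by (rule blinfun_eqI) (simp add: R_apply blinfun.scaleR_left algebra_simps)
    then show ?thesis by (simp add: \<beta>_def linear_cmul[OF linear_\<omega>])
  qed
  have pos: "0 \<le> \<beta> x x" for x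
    unfolding \<beta>_def by (rule \<omega>_pos) (simp_all add: R_diag inner_commute)
  have trace: "(\<Sum>f\<leftarrow>fs. \<beta> f f) \<le> 1" if fs: "orthonormal fs" for fs
  proof -
    let ?Q = "\<Sum>f\<leftarrow>fs. R f f"
    have Q: "?Q x = proj fs x" for x by (induction fs) (auto simp: blinfun.add_left R_diag)
    have "0 \<le> \<omega> (id_blinfun - ?Q)"
    proof (rule \<omega>_pos)
      show "(id_blinfun - ?Q) x \<bullet> y = x \<bullet> (id_blinfun - ?Q) y" for x y
        using inner_proj[of fs x y] inner_proj[of fs y x]
        by (simp add: blinfun.diff_left Q inner_diff_left inner_diff_right mult.commute inner_commute[of x])
      show "0 \<le> (id_blinfun - ?Q) x \<bullet> x" for x
        using bessel[OF fs, of x] inner_proj[of fs x x]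
        by (simp add: blinfun.diff_left Q inner_diff_left frame_def power2_norm_eq_inner)
    qed
    also have "\<dots> = 1 - \<omega> ?Q" by (simp add: linear_diff[OF linear_\<omega>] \<omega>_id)
    also have "\<omega> ?Q = (\<Sum>f\<leftarrow>fs. \<beta> f f)"
      by (induction fs) (auto simp: linear_0[OF linear_\<omega>] linear_add[OF linear_\<omega>] \<beta>_def)
    finally show ?thesis by simp
  qed
  obtain l y where l: "l > 0" and y: "y \<noteq> 0" "\<beta> y y = l * (norm y)\<^sup>2" and upper: "\<And>x. \<beta> x x \<le> l * (norm x)\<^sup>2"
    using trace_class_form_attains_norm[of \<beta> a, OF sym add scale pos trace] nz unfolding \<beta>_def by blast
  define E where "E = {x. \<beta> x x = l * (norm x)\<^sup>2}"
  have add': "\<beta> z (x + y) = \<beta> z x + \<beta> z y" for x y z using add[of x y z] by (simp add: sym)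
  have neg: "\<beta> (- x) y = - \<beta> x y" "\<beta> y (- x) = - \<beta> y x" for x y
    using scale[of "-1" x y] by (simp_all add: sym[of y])
  have diff: "\<beta> (x - y) z = \<beta> x z - \<beta> y z" "\<beta> z (x - y) = \<beta> z x - \<beta> z y" for x y z
    using add[of x "- y" z] add'[of z x "- y"] by (simp_all add: neg)
  \<comment> \<open>By the parallelogram identity the upper bounds at x + y and x - y add up to an
    equality, so each is an equality.\<close>
  have E_add: "x + y \<in> E \<and> x - y \<in> E" if xy: "x \<in> E" "y \<in> E" for x y
  proof -
    have "\<beta> (x + y) (x + y) + \<beta> (x + - y) (x + - y) = l * (norm (x + y))\<^sup>2 + l * (norm (x + - y))\<^sup>2"
      using xy unfolding E_def power2_norm_eq_inner
      by (simp add: add add' diff sym[of y x] inner_simps inner_commute algebra_simps)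
    then show ?thesis using upper[of "x + y"] upper[of "x + - y"] unfolding E_def by simp
  qed
  have E_scale: "c *\<^sub>R x \<in> E" if "x \<in> E" for c x
  proof -
    have "\<beta> (c *\<^sub>R x) (c *\<^sub>R x) = c * (c * \<beta> x x)"
      using scale[of c x "c *\<^sub>R x"] scale[of c x x] sym[of x "c *\<^sub>R x"] by simp
    then show ?thesis using that by (simp add: E_def power_mult_distrib power2_eq_square)
  qed
  have E_sub: "subspace E"
    unfolding subspace_def using E_add E_scale E_scale[of y 0] y by (auto simp: E_def)
  have E_W: "x \<in> W" if x: "x \<in> E" for x
  proof -
    have "l * (norm x)\<^sup>2 = \<beta> (P x) (P x)" using x \<omega>_R_P[of x] by (simp add: E_def \<beta>_def)
    also have "\<dots> \<le> l * (norm (P x))\<^sup>2" by (rule upper)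
    finally have "(norm x)\<^sup>2 \<le> (norm (P x))\<^sup>2" using l by simp
    then have "proj es x = 0" using pythagoras_proj[OF on, of x] by (simp add: P_def)
    then show ?thesis using P_in_W[of x] by (simp add: P_def)
  qed
  have E_T: "T x \<in> E" if T: "T \<in> \<T> \<or> T = J" and x: "x \<in> E" for T x
  proof -
    have "preserves T es" using T T_pres J_pres by auto
    then have "norm (T x) = norm x" by (simp add: preserves_def norm_eq_sqrt_inner)
    then show ?thesis using x \<omega>_R_preserved[OF T, of x] by (simp add: E_def \<beta>_def)
  qed
  define inE where "inE fs \<longleftrightarrow> orthonormal fs \<and> set fs \<subseteq> E" for fs
  have short: "real (length fs) \<le> 1 / l" if fs: "inE fs" for fs
  proof -
    have "(\<Sum>f\<leftarrow>fs. \<beta> f f) = l * real (length fs)"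
      using fs unfolding inE_def by (induction fs) (auto simp: E_def algebra_simps)
    then show ?thesis using trace[of fs] fs l by (simp add: inE_def field_simps)
  qed
  have "\<exists>fs. inE fs \<and> (\<forall>gs. inE gs \<longrightarrow> length gs \<le> length fs)"
  proof (rule ex_has_greatest_nat[of inE "[]" length "Suc (nat \<lfloor>1 / l\<rfloor>)"])
    show "inE []" by (simp add: inE_def)
    show "\<forall>fs. inE fs \<longrightarrow> length fs < Suc (nat \<lfloor>1 / l\<rfloor>)"
      using short by (auto simp: less_Suc_eq_le le_nat_floor)
  qed
  then obtain fs where fs: "inE fs" and fs_max: "\<And>gs. inE gs \<Longrightarrow> length gs \<le> length fs" by blast
  have on_fs: "orthonormal fs" using fs by (simp add: inE_def)
  have spanE: "x \<in> span (set fs)" if x: "x \<in> E" for x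
  proof (rule ccontr)
    assume "x \<notin> span (set fs)"
    define w where "w = x - proj fs x"
    have w0: "w \<noteq> 0" using proj_in_span[of fs x] \<open>x \<notin> span (set fs)\<close> by (auto simp: w_def)
    have "proj fs x \<in> E"
      using proj_in_span[of fs x] span_minimal[OF _ E_sub, of "set fs"] fs by (auto simp: inE_def)
    then have "w \<in> E" using E_add x by (simp add: w_def)
    moreover have "w \<bullet> f = 0" if "f \<in> set fs" for f
      using that by (simp add: w_def inner_diff_left proj_inner_basis[OF on_fs])
    ultimately have "inE ((w /\<^sub>R norm w) # fs)"
      using orthonormal_Cons_normalized[OF on_fs w0] fs E_scale by (simp add: inE_def)
    from fs_max[OF this] show False by simp
  qed
  have "fs = []"
  proof (rule max[OF on_fs])
    show "set fs \<subseteq> W" using fs E_W by (auto simp: inE_def)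
    show "T f \<in> span (set fs)" if "T \<in> \<T> \<or> T = J" "f \<in> set fs" for T f
    proof -
      have "f \<in> E" using that(2) fs unfolding inE_def by blast
      from spanE[OF E_T[OF that(1) this]] show ?thesis .
    qed
  qed
  then show False using spanE[of y] y by (simp add: E_def)
qed

lemma almost_invariant_families:
  assumes max: "\<And>fs. orthonormal fs \<Longrightarrow> set fs \<subseteq> W \<Longrightarrow> (\<And>T f. T \<in> \<T> \<or> T = J \<Longrightarrow> f \<in> set fs \<Longrightarrow> T f \<in> span (set fs))
      \<Longrightarrow> fs = []"
    and F: "finite F" "F \<noteq> {}" "F \<subseteq> \<T>" and \<delta>: "\<delta> > 0"
  shows "\<exists>xs. almost_invariant F \<delta> xs"
proof (rule almost_invariant_of_state[OF F(1,2) _ _ _ linear_\<omega> \<omega>_pos \<omega>_id _ _ \<delta>])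
  fix T assume "T \<in> F"
  then have T: "T \<in> \<T>" using F by auto
  show "linear T" "surj T" "T x \<bullet> T y = x \<bullet> y" for x y
    using T_pres[OF T] T_surj[OF T] by (auto simp: preserves_def)
  show "\<omega> B' = \<omega> B" if "\<And>x. T (blinfun_apply B' x) = blinfun_apply B (T x)" for B B'
    by (rule \<omega>_inv[OF T that])
next
  fix e and Q :: "'a \<Rightarrow>\<^sub>L 'a" assume "\<And>x. blinfun_apply Q x = (x \<bullet> e) *\<^sub>R e"
  then have "Q = R e e" by (intro blinfun_eqI) (simp add: R_diag)
  moreover have "\<omega> (R e e) = 0"
    by (rule \<omega>_singular) (fact max)
  ultimately show "\<omega> Q = 0" by (simp only:)
qed

end

section \<open>Unitary representations\<close>

lemma unitary_rep_facts:
  assumes rep: "unitary_rep G \<pi>" and g: "g \<in> carrier G"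
  shows "\<pi> g (c *\<^sub>C x) = c *\<^sub>C \<pi> g x"
    and "linear (\<pi> g)"
    and "\<pi> g x \<bullet> \<pi> g y = x \<bullet> y"
    and "surj (\<pi> g)"
    and "\<pi> (inv\<^bsub>G\<^esub> g) (\<pi> g x) = x"
    and "\<pi> g (\<pi> (inv\<^bsub>G\<^esub> g) x) = x"
proof -
  interpret group G using rep by (simp add: unitary_rep_def)
  have hom: "\<pi> \<in> hom G unitary_group" using rep by (simp add: unitary_rep_def)
  have U: "clinear (\<pi> h)" "surj (\<pi> h)" "cinner (\<pi> h x) (\<pi> h y) = cinner x y" if "h \<in> carrier G" for h x y
    using hom that by (auto simp: hom_def unitary_group_def Pi_iff)
  have mult: "\<pi> (h \<otimes>\<^bsub>G\<^esub> k) = \<pi> h \<circ> \<pi> k" if "h \<in> carrier G" "k \<in> carrier G" for h k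
    using hom that by (simp add: hom_def unitary_group_def)
  \<comment> \<open>Multiplicativity only makes this map idempotent; surjectivity then makes it the
    identity.\<close>
  have one: "\<pi> \<one>\<^bsub>G\<^esub> = id"
  proof
    fix x
    obtain y where y: "x = \<pi> \<one>\<^bsub>G\<^esub> y" using U(2)[OF one_closed] by (metis surjD)
    show "\<pi> \<one>\<^bsub>G\<^esub> x = id x"
      using fun_cong[OF mult[OF one_closed one_closed], of y] y by simp
  qed
  interpret lin: Vector_Spaces.linear scaleC scaleC "\<pi> g" by (rule U(1)[OF g])
  show scale: "\<pi> g (c *\<^sub>C x) = c *\<^sub>C \<pi> g x" for c x by (rule lin.scale)
  show "linear (\<pi> g)"
  proof (rule linearI)
    show "\<pi> g (x + y) = \<pi> g x + \<pi> g y" for x y by (rule lin.add)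
    show "\<pi> g (r *\<^sub>R x) = r *\<^sub>R \<pi> g x" for r x
      using scale[of "complex_of_real r" x] by (simp add: scaleC_of_real)
  qed
  show "\<pi> g x \<bullet> \<pi> g y = x \<bullet> y" using U(3)[OF g, of x y] by (simp add: Re_cinner[symmetric])
  show "surj (\<pi> g)" by (rule U(2)[OF g])
  show "\<pi> (inv\<^bsub>G\<^esub> g) (\<pi> g x) = x"
    using fun_cong[OF mult[of "inv\<^bsub>G\<^esub> g" g], of x] g one by simp
  show "\<pi> g (\<pi> (inv\<^bsub>G\<^esub> g) x) = x"
    using fun_cong[OF mult[of g "inv\<^bsub>G\<^esub> g"], of x] g one by simp
qed

lemma orthonormal_append:
  "orthonormal fs \<Longrightarrow> orthonormal es \<Longrightarrow> (\<And>f e. f \<in> set fs \<Longrightarrow> e \<in> set es \<Longrightarrow> f \<bullet> e = 0) \<Longrightarrow> orthonormal (fs @ es)"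
  by (induction fs) auto

text \<open>An invariant list of length at least 1/\<delta> is enough, whether or not its span is
  complex. Failing that, 1/\<delta> bounds the length of all invariant lists, which provides a
  longest one for the second case.\<close>

lemma unitary_rep_almost_invariant:
  fixes G :: "('g, 'm) monoid_scheme" and \<pi> :: "'g \<Rightarrow> 'a::chilbert_space \<Rightarrow> 'a"
  assumes rep: "unitary_rep G \<pi>"
    and amenable: "\<And>V. invariant_subspace G \<pi> V \<Longrightarrow> finite_codim V \<Longrightarrow> amenable_rep G V (subrep \<pi> V)"
    and F: "finite F" "F \<noteq> {}" "F \<subseteq> carrier G" and \<delta>: "\<delta> > 0"
  shows "\<exists>xs. almost_invariant (\<pi> ` F) \<delta> xs"
proof -
  interpret G: group G using rep by (simp add: unitary_rep_def)
  note facts = unitary_rep_facts[OF rep]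
  define inv_list where "inv_list es \<longleftrightarrow> orthonormal es \<and> (\<forall>g\<in>carrier G. \<forall>e\<in>set es. \<pi> g e \<in> span (set es))" for es
  have pres: "preserves (\<pi> g) es" if es: "inv_list es" and g: "g \<in> carrier G" for es g
  proof (rule preservesI[OF facts(2)[OF g] facts(3)[OF g]])
    fix e assume e: "e \<in> set es"
    show "\<pi> g e \<in> span (set es)" using es g e by (simp add: inv_list_def)
    show "\<exists>y\<in>span (set es). \<pi> g y = e"
      using es g e facts(6)[OF g] G.inv_closed[OF g] unfolding inv_list_def by blast
  qed
  show ?thesis
  proof (cases "\<exists>es. inv_list es \<and> 1 / \<delta> \<le> real (length es)")
    case True
    then obtain es where es: "inv_list es" "1 / \<delta> \<le> real (length es)" by blast
    show ?thesis
      by (rule almost_invariant_of_invariant_span[OF _ _ \<delta> es(2)]) (use es(1) pres F in \<open>auto simp: inv_list_def\<close>)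
  next
    case False
    \<comment> \<open>Stability under J makes the orthogonal complement a complex subspace, to which
      amenability applies.\<close>
    define good where "good es \<longleftrightarrow> inv_list es \<and> (\<forall>e\<in>set es. J e \<in> span (set es))" for es
    have "\<exists>es. good es \<and> (\<forall>fs. good fs \<longrightarrow> length fs \<le> length es)"
    proof (rule ex_has_greatest_nat[of good "[]" length "Suc (nat \<lfloor>1 / \<delta>\<rfloor>)"])
      show "good []" by (simp add: good_def inv_list_def)
      show "\<forall>es. good es \<longrightarrow> length es < Suc (nat \<lfloor>1 / \<delta>\<rfloor>)"
      proof (intro allI impI)
        fix es assume "good es"
        then have "real (length es) \<le> 1 / \<delta>"
          using False unfolding good_def by (meson nle_le)
        then show "length es < Suc (nat \<lfloor>1 / \<delta>\<rfloor>)"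
          by (simp only: less_Suc_eq_le le_nat_floor)
      qed
    qed
    then obtain es where es: "good es" and es_max: "\<And>fs. good fs \<Longrightarrow> length fs \<le> length es" by blast
    have on: "orthonormal es" using es by (simp add: good_def inv_list_def)
    have pres_es: "preserves (\<pi> g) es" if "g \<in> carrier G" for g
      using es that by (intro pres) (simp_all add: good_def)
    have J_pres: "preserves J es"
    proof (rule preservesI[OF linear_J inner_J_J])
      fix e assume e: "e \<in> set es"
      then show Je: "J e \<in> span (set es)" using es by (simp add: good_def)
      have "J (- J e) = e" by (simp add: linear_neg[OF linear_J] J_J)
      then show "\<exists>y\<in>span (set es). J y = e" using span_neg[OF Je] by blast
    qed
    define W where "W = {x. \<forall>e\<in>set es. x \<bullet> e = 0}"
    have W_add: "x + y \<in> W" if "x \<in> W" "y \<in> W" for x y using that by (simp add: W_def inner_add_left)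
    have W_pres: "T x \<in> W" if "preserves T es" "x \<in> W" for T x
      using preserves_orthogonal[OF that(1), of x] that(2) by (simp add: W_def)
    have "invariant_subspace G \<pi> W"
      unfolding invariant_subspace_def
    proof (intro conjI ballI)
      show "csubspace W"
        unfolding cvs.subspace_def
      proof (intro conjI ballI allI)
        show "c *\<^sub>C x \<in> W" if x: "x \<in> W" for c x
          unfolding scaleC_conv_J[of c]
          by (rule W_add) (use x W_pres[OF J_pres x] in \<open>simp_all add: W_def\<close>)
      qed (simp_all add: W_add, simp add: W_def)
      have "W = (\<Inter>e\<in>set es. {x. x \<bullet> e = 0})" by (auto simp: W_def)
      then show "closed W"
        by (auto intro!: closed_INT closed_Collect_eq continuous_intros)
      show "\<pi> g x \<in> W" if "g \<in> carrier G" "x \<in> W" for g x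
        using W_pres[OF pres_es] that by blast
    qed
    moreover have "finite_codim W"
      unfolding finite_codim_def
    proof (intro exI conjI)
      let ?S = "cspan (W \<union> set es)"
      have sp: "proj fs x \<in> ?S" if "set fs \<subseteq> set es" for fs x
        using that
      proof (induction fs)
        case Nil
        then show ?case by (simp add: cvs.span_zero)
      next
        case (Cons f fs)
        have "complex_of_real (x \<bullet> f) *\<^sub>C f \<in> ?S"
          using Cons.prems by (intro cvs.span_scale cvs.span_base) auto
        then show ?case using Cons by (auto simp: scaleC_of_real intro!: cvs.span_add)
      qed
      have "x \<in> ?S" for x
      proof -
        have "x - proj es x \<in> W" by (simp add: W_def inner_diff_left proj_inner_basis[OF on])
        then have "(x - proj es x) + proj es x \<in> ?S"
          by (intro cvs.span_add sp) (auto intro: cvs.span_base)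
        then show ?thesis by simp
      qed
      then show "?S = UNIV" by blast
    qed simp
    ultimately have "amenable_rep G W (subrep \<pi> W)" by (rule amenable)
    then obtain \<phi> where \<phi>: "state_on W \<phi>"
      "\<And>g B. g \<in> carrier G \<Longrightarrow> B \<in> bounded_ops W \<Longrightarrow>
        \<phi> (compose W (subrep \<pi> W g) (compose W B (subrep \<pi> W (inv\<^bsub>G\<^esub> g)))) = \<phi> B"
      unfolding amenable_rep_def by blast
    interpret invariant_state es W \<phi> "\<pi> ` carrier G"
    proof
      fix T assume "T \<in> \<pi> ` carrier G"
      then obtain g where g: "g \<in> carrier G" and T: "T = \<pi> g" by blast
      show "preserves T es" "surj T" "T (J x) = J (T x)" for x
        unfolding T by (rule pres_es[OF g], rule facts(4)[OF g], rule facts(1)[OF g])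
      fix B B' assume B: "B \<in> bounded_ops W" "B' \<in> bounded_ops W" and TB: "\<And>x. x \<in> W \<Longrightarrow> T (B' x) = B (T x)"
      \<comment> \<open>On W the operator B' is the conjugate of B by the inverse of g, so the
        invariance of \<phi> is applied at that inverse.\<close>
      have h: "inv\<^bsub>G\<^esub> g \<in> carrier G" "inv\<^bsub>G\<^esub> (inv\<^bsub>G\<^esub> g) = g" using g by simp_all
      have "compose W (subrep \<pi> W (inv\<^bsub>G\<^esub> g)) (compose W B (subrep \<pi> W g)) = B'"
      proof
        fix x
        show "compose W (subrep \<pi> W (inv\<^bsub>G\<^esub> g)) (compose W B (subrep \<pi> W g)) x = B' x"
        proof (cases "x \<in> W")
          case True
          have gx: "\<pi> g x \<in> W" by (rule W_pres[OF pres_es[OF g] True])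
          then have "B (\<pi> g x) \<in> W" using B(1) by (auto simp: bounded_ops_def)
          then have "compose W (subrep \<pi> W (inv\<^bsub>G\<^esub> g)) (compose W B (subrep \<pi> W g)) x = \<pi> (inv\<^bsub>G\<^esub> g) (B (\<pi> g x))"
            using True gx by (simp add: compose_def subrep_def)
          also have "B (\<pi> g x) = \<pi> g (B' x)" using TB[OF True] by (simp add: T)
          finally show ?thesis using facts(5)[OF g] by simp
        next
          case False
          then show ?thesis using B(2) by (auto simp: compose_def bounded_ops_def PiE_def extensional_def)
        qed
      qed
      then show "\<phi> B' = \<phi> B" using \<phi>(2)[OF h(1) B(1)] unfolding h(2) by simp
    qed (rule on, rule W_def, rule J_pres, rule \<phi>(1))
    show ?thesis
    proof (rule almost_invariant_families[OF _ _ _ _ \<delta>])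
      fix fs assume fs: "orthonormal fs" "set fs \<subseteq> W"
        and inv: "\<And>T f. T \<in> \<pi> ` carrier G \<or> T = J \<Longrightarrow> f \<in> set fs \<Longrightarrow> T f \<in> span (set fs)"
      have mono: "span (set fs) \<subseteq> span (set (fs @ es))" "span (set es) \<subseteq> span (set (fs @ es))"
        by (intro span_mono; auto)+
      have "good (fs @ es)"
        unfolding good_def inv_list_def
      proof (intro conjI ballI)
        show "orthonormal (fs @ es)"
          using fs by (intro orthonormal_append on) (auto simp: W_def)
        show "\<pi> g e \<in> span (set (fs @ es))" if g: "g \<in> carrier G" and e: "e \<in> set (fs @ es)" for g e
          using e inv[of "\<pi> g" e] g es mono unfolding good_def inv_list_def by fastforce
        show "J e \<in> span (set (fs @ es))" if e: "e \<in> set (fs @ es)" for e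
          using e inv[of J e] es mono unfolding good_def by fastforce
      qed
      from es_max[OF this] show "fs = []" by simp
    qed (use F in auto)
  qed
qed

text \<open>If concentration fails, each member of the cover comes with a radius and a finite set
  witnessing it. The cover being finite, the least radius and the union of the sets serve all
  members at once, against \<open>concentration_of_almost_invariant\<close>.\<close>

theorem theorem6p4:
  fixes G :: "('g, 'm) monoid_scheme"
    and \<pi> :: "'g \<Rightarrow> 'a::chilbert_space \<Rightarrow> 'a"
  assumes "unitary_rep G \<pi>"
    and infinite_dim: "\<not> (\<exists>B::'a set. finite B \<and> cspan B = UNIV)"
    and amenable: "\<And>V. invariant_subspace G \<pi> V \<Longrightarrow> finite_codim V \<Longrightarrow> amenable_rep G V (subrep \<pi> V)"
  shows "concentration_property G (sphere 0 1) \<pi>"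
  unfolding concentration_property_def
proof (intro allI impI)
  fix \<C> :: "'a set set"
  assume "finite \<C> \<and> (\<forall>A\<in>\<C>. A \<subseteq> sphere 0 1) \<and> \<Union>\<C> = sphere 0 1"
  then have \<C>: "finite \<C>" "\<And>A. A \<in> \<C> \<Longrightarrow> A \<subseteq> sphere 0 1" "\<Union>\<C> = sphere 0 1" by blast+
  interpret G: group G using assms(1) by (simp add: unitary_rep_def)
  note facts = unitary_rep_facts[OF assms(1)]
  show "\<exists>A\<in>\<C>. essential G (sphere 0 1) \<pi> A"
  proof (rule ccontr)
    assume not_ess: "\<not> ?thesis"
    define avoids where "avoids A \<epsilon> F \<longleftrightarrow> \<epsilon> > 0 \<and> finite F \<and> F \<noteq> {} \<and> F \<subseteq> carrier G \<and>
        (\<Inter>g\<in>F. \<pi> g ` nbhd_in (sphere 0 1) \<epsilon> A) = {}" for A \<epsilon> F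
    have "\<exists>\<epsilon> F. avoids A \<epsilon> F" if A: "A \<in> \<C>" for A
    proof -
      have "\<not> essential G (sphere 0 1) \<pi> A" using not_ess A by blast
      with \<C>(2)[OF A] show ?thesis unfolding essential_def avoids_def by meson
    qed
    then obtain \<epsilon> Fs where "\<And>A. A \<in> \<C> \<Longrightarrow> avoids A (\<epsilon> A) (Fs A)"
      by metis
    then have \<epsilon>Fs: "\<epsilon> A > 0" "finite (Fs A)" "Fs A \<noteq> {}" "Fs A \<subseteq> carrier G"
        "(\<Inter>g\<in>Fs A. \<pi> g ` nbhd_in (sphere 0 1) (\<epsilon> A) A) = {}" if "A \<in> \<C>" for A
      using that unfolding avoids_def by blast+
    \<comment> \<open>An empty cover would mean an empty sphere, hence the zero space, which
      infinite dimension excludes.\<close>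
    have ne: "\<C> \<noteq> {}"
    proof
      assume "\<C> = {}"
      have "x = 0" for x :: 'a
      proof (rule ccontr)
        assume "x \<noteq> 0"
        then have "x /\<^sub>R norm x \<in> \<Union>\<C>" using \<C>(3) by simp
        with \<open>\<C> = {}\<close> show False by simp
      qed
      then have "cspan {} = (UNIV :: 'a set)" using cvs.span_zero[of "{}"] by (metis UNIV_eq_I)
      with infinite_dim show False by blast
    qed
    define F where "F = (\<Union>A\<in>\<C>. Fs A)"
    obtain A0 where "A0 \<in> \<C>" using ne by blast
    then have "F \<noteq> {}" using \<epsilon>Fs(3)[of A0] unfolding F_def by blast
    moreover have "finite F" unfolding F_def by (rule finite_UN_I[OF \<C>(1) \<epsilon>Fs(2)])
    moreover have "F \<subseteq> carrier G" unfolding F_def by (rule UN_least[OF \<epsilon>Fs(4)])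
    ultimately have F: "finite F" "F \<noteq> {}" "F \<subseteq> carrier G" by blast+
    define e where "e = Min (\<epsilon> ` \<C>)"
    have e: "e > 0" using \<epsilon>Fs(1) \<C>(1) ne by (simp add: e_def)
    \<comment> \<open>Inverses, because z lies in the translate of a neighbourhood by g as soon as
      the inverse of g moves z into that neighbourhood.\<close>
    let ?F = "(\<lambda>g. \<pi> (inv\<^bsub>G\<^esub> g)) ` F"
    have im: "?F = \<pi> ` ((\<lambda>g. inv\<^bsub>G\<^esub> g) ` F)" by (simp add: image_image)
    obtain A z where Az: "A \<in> \<C>" "z \<in> sphere 0 1" "\<And>T. T \<in> ?F \<Longrightarrow> \<exists>a\<in>A. dist (T z) a < e"
    proof (rule concentration_of_almost_invariant[OF \<C>(1,3) _ _ _ e, of ?F])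
      fix A z assume "A \<in> \<C>" "z \<in> sphere 0 1" "\<And>T. T \<in> ?F \<Longrightarrow> \<exists>a\<in>A. dist (T z) a < e"
      then show thesis by (rule that)
    next
      show "finite ?F" using F(1) by simp
    next
      fix T assume "T \<in> ?F"
      then obtain h where h: "h \<in> carrier G" "T = \<pi> h" using F(3) by auto
      show "linear T" unfolding h(2) by (rule facts(2)[OF h(1)])
      show "norm (T x) = norm x" for x
        unfolding h(2) using facts(3)[OF h(1), of x x] by (simp add: norm_eq_sqrt_inner)
    next
      fix \<delta> :: real assume "\<delta> > 0"
      then show "\<exists>xs. almost_invariant ?F \<delta> xs"
        unfolding im by (intro unitary_rep_almost_invariant[OF assms(1) amenable]) (use F in auto)
    qed
    have "z \<in> (\<Inter>g\<in>Fs A. \<pi> g ` nbhd_in (sphere 0 1) (\<epsilon> A) A)"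
    proof (rule INT_I)
      fix g assume "g \<in> Fs A"
      then have gF: "g \<in> F" using Az(1) by (auto simp: F_def)
      then have g: "g \<in> carrier G" using F by auto
      let ?y = "\<pi> (inv\<^bsub>G\<^esub> g) z"
      obtain a where a: "a \<in> A" "dist ?y a < e" using Az(3) gF by blast
      have "e \<le> \<epsilon> A" using Az(1) \<C>(1) by (simp add: e_def)
      with a(2) have "dist ?y a < \<epsilon> A" by linarith
      moreover have "norm ?y = norm z"
        using facts(3)[OF G.inv_closed[OF g], of z z] by (simp add: norm_eq_sqrt_inner)
      ultimately have "?y \<in> nbhd_in (sphere 0 1) (\<epsilon> A) A"
        using a(1) Az(2) unfolding nbhd_in_def by auto
      then show "z \<in> \<pi> g ` nbhd_in (sphere 0 1) (\<epsilon> A) A"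
        using facts(6)[OF g, of z] by (metis imageI)
    qed
    then show False using \<epsilon>Fs(5)[OF Az(1)] by blast
  qed
qed

end
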